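(* The Weber kernel group $\Gamma_2$ equals $\Gamma(4)$, and $\mathcal{W}_2=X(4)$.
   Context: Write $\zeta_k=e^{2\pi i/k}$. Let $\eta$ be the Dedekind eta function and $$\mathfrak{f}(\tau)=\zeta_{48}^{-1}\frac{\eta\left(\frac{\tau+1}{2}\right)}{\eta(\tau)},\quad \mathfrak{f}_1(\tau)=\frac{\eta\left(\frac{\tau}{2}\right)}{\eta(\tau)},\quad \mathfrak{f}_2(\tau)=\sqrt2\,\frac{\eta(2\tau)}{\eta(\tau)},$$ $(\mathfrak{u}_0,\mathfrak{u}_1,\mathfrak{u}_2)=(\mathfrak{f},\zeta_{16}\mathfrak{f}_1,\zeta_{16}^{-1}\mathfrak{f}_2)$. For $n\mid 24$, the Weber kernel group $\Gamma_n\subset\mathrm{PSL}_2(\mathbb{Z})$ is the group of all $g$ with $\mathfrak{u}_i^{24/n}\circ g=\mathfrak{u}_i^{24/n}$ for $i=0,1,2$. The Weber curve $\mathcal{W}_n$ is the image in $\mathbb{P}^3$ of $(\mathfrak{u}_0^{24/n}:\mathfrak{u}_1^{24/n}:\mathfrak{u}_2^{24/n}:1)$, and it is identified (as smooth projective model / function field) with the modular curve $X(\Gamma_n)$; for $n=2$ it has equations $X_0^2+X_1^2+X_2^2=48X_3^2$, $X_0X_1X_2=64X_3^3$. Here $\Gamma(N)$ denotes the image in $\mathrm{PSL}_2(\mathbb{Z})$ of the principal congruence subgroup of level $N$, and $X(N)$ is the associated modular curve. *)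

theory Defs
  imports
    "HOL-Complex_Analysis.Complex_Analysis"
    "HOL-Number_Theory.Cong"
    "HOL-Algebra.Coset"
    "HOL-Algebra.QuotRing"
begin

section \<open>The modular group\<close>

definition SL2Z :: "(int^2^2) monoid" where
  "SL2Z = \<lparr>carrier = {A. det A = 1}, monoid.mult = (**), one = mat 1\<rparr>"

text \<open>Elements of \<open>PSL2Z\<close> are cosets, that is, sets of the form \<open>{A, - A}\<close>.\<close>

definition PSL2Z :: "(int^2^2) set monoid" where
  "PSL2Z = SL2Z Mod {mat 1, - mat 1}"

definition principal_congruence_SL2Z :: "nat \<Rightarrow> (int^2^2) set" where
  "principal_congruence_SL2Z N =
     {A \<in> carrier SL2Z. \<forall>i j. [A $ i $ j = (mat 1 :: int^2^2) $ i $ j] (mod int N)}"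

definition principal_congruence_PSL2Z :: "nat \<Rightarrow> (int^2^2) set set" where
  "principal_congruence_PSL2Z N =
     (\<lambda>A. {mat 1, - mat 1} #>\<^bsub>SL2Z\<^esub> A) ` principal_congruence_SL2Z N"

abbreviation upper_half_plane :: "complex set" where
  "upper_half_plane \<equiv> {\<tau>. Im \<tau> > 0}"

definition moebius_act :: "int^2^2 \<Rightarrow> complex \<Rightarrow> complex" where
  "moebius_act A \<tau> =
     (of_int (A $ 1 $ 1) * \<tau> + of_int (A $ 1 $ 2)) /
     (of_int (A $ 2 $ 1) * \<tau> + of_int (A $ 2 $ 2))"


section \<open>Weber functions and Weber kernel groups\<close>

definition zeta :: "nat \<Rightarrow> complex" where
  "zeta k = exp (2 * of_real pi * \<i> / of_nat k)"

definition dedekind_eta :: "complex \<Rightarrow> complex" where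
  "dedekind_eta \<tau> =
     exp (of_real pi * \<i> * \<tau> / 12) *
     (\<Prod>n. 1 - exp (2 * of_real pi * \<i> * \<tau>) ^ Suc n)"

definition weber_f :: "complex \<Rightarrow> complex" where
  "weber_f \<tau> = inverse (zeta 48) * dedekind_eta ((\<tau> + 1) / 2) / dedekind_eta \<tau>"

definition weber_f1 :: "complex \<Rightarrow> complex" where
  "weber_f1 \<tau> = dedekind_eta (\<tau> / 2) / dedekind_eta \<tau>"

definition weber_f2 :: "complex \<Rightarrow> complex" where
  "weber_f2 \<tau> = of_real (sqrt 2) * dedekind_eta (2 * \<tau>) / dedekind_eta \<tau>"

text \<open>Only the indices \<open>0\<close>, \<open>1\<close>, \<open>2\<close> are meaningful.\<close>

definition weber_u :: "nat \<Rightarrow> complex \<Rightarrow> complex" where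
  "weber_u i \<tau> =
     (if i = 0 then weber_f \<tau>
      else if i = 1 then zeta 16 * weber_f1 \<tau>
      else inverse (zeta 16) * weber_f2 \<tau>)"

text \<open>The following definitions are meant for \<open>n dvd 24\<close>, so that \<open>24 div n\<close> is the exact
  quotient.\<close>

definition weber_kernel :: "nat \<Rightarrow> (int^2^2) set set" where
  "weber_kernel n =
     {g \<in> carrier PSL2Z. \<forall>A\<in>g. \<forall>i\<in>{0, 1, 2}. \<forall>\<tau>\<in>upper_half_plane.
        weber_u i (moebius_act A \<tau>) ^ (24 div n) = weber_u i \<tau> ^ (24 div n)}"


section \<open>Curves in projective space and their function fields\<close>

text \<open>Points of projective 3-space are represented by the set of their homogeneous coordinate
  vectors.\<close>

definition proj_point :: "complex^4 \<Rightarrow> (complex^4) set" where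
  "proj_point v = {c *s v |c. c \<noteq> 0}"

definition proj3 :: "(complex^4) set set" where
  "proj3 = proj_point ` (UNIV - {0})"

text \<open>Homogeneous polynomial functions of degree \<open>d\<close> (including \<open>0\<close>).\<close>

definition is_form :: "nat \<Rightarrow> (complex^4 \<Rightarrow> complex) \<Rightarrow> bool" where
  "is_form d F \<longleftrightarrow>
     (\<exists>a :: (4 \<Rightarrow> nat) \<Rightarrow> complex.
        F = (\<lambda>v. \<Sum>m | (\<Sum>i\<in>UNIV. m i) = d. a m * (\<Prod>i\<in>UNIV. (v $ i) ^ m i)))"

definition vanishes_on :: "(complex^4 \<Rightarrow> complex) \<Rightarrow> (complex^4) set set \<Rightarrow> bool" where
  "vanishes_on F V \<longleftrightarrow> (\<forall>p\<in>V. \<forall>v\<in>p. F v = 0)"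

definition zariski_closure :: "(complex^4) set set \<Rightarrow> (complex^4) set set" where
  "zariski_closure S =
     {p \<in> proj3. \<forall>d F. is_form d F \<longrightarrow> vanishes_on F S \<longrightarrow> vanishes_on F {p}}"

text \<open>The function field of an irreducible projective set \<open>V\<close>: classes of fractions \<open>F / G\<close> of forms
  of equal degree with \<open>G\<close> not identically \<open>0\<close> on \<open>V\<close>, two fractions being identified when
  \<open>F * G' - F' * G\<close> vanishes on \<open>V\<close>.\<close>

type_synonym fraction = "(complex^4 \<Rightarrow> complex) \<times> (complex^4 \<Rightarrow> complex)"

definition form_fractions :: "(complex^4) set set \<Rightarrow> fraction set" where
  "form_fractions V =
     {(F, G). (\<exists>d. is_form d F \<and> is_form d G) \<and> \<not> vanishes_on G V}"

definition fraction_rel :: "(complex^4) set set \<Rightarrow> (fraction \<times> fraction) set" where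
  "fraction_rel V =
     {((F, G), (F', G')). (F, G) \<in> form_fractions V \<and> (F', G') \<in> form_fractions V \<and>
        vanishes_on (\<lambda>v. F v * G' v - F' v * G v) V}"

definition function_field :: "(complex^4) set set \<Rightarrow> fraction set ring" where
  "function_field V =
     \<lparr>carrier = form_fractions V // fraction_rel V,
      monoid.mult = (\<lambda>r s. \<Union>(F, G)\<in>r. \<Union>(F', G')\<in>s.
        fraction_rel V `` {(\<lambda>v. F v * F' v, \<lambda>v. G v * G' v)}),
      one = fraction_rel V `` {(\<lambda>_. 1, \<lambda>_. 1)},
      zero = fraction_rel V `` {(\<lambda>_. 0, \<lambda>_. 1)},
      add = (\<lambda>r s. \<Union>(F, G)\<in>r. \<Union>(F', G')\<in>s.
        fraction_rel V `` {(\<lambda>v. F v * G' v + F' v * G v, \<lambda>v. G v * G' v)})\<rparr>"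


section \<open>Function fields of modular curves\<close>

text \<open>The function field of the modular curve \<open>X(\<Gamma>)\<close> consists of the modular functions for \<open>\<Gamma>\<close>. A
  meromorphic function on the upper half-plane is represented by a function that is continuous
  away from its poles and is \<open>0\<close> at its poles and outside the upper half-plane.\<close>

definition normalize_mero :: "(complex \<Rightarrow> complex) \<Rightarrow> complex \<Rightarrow> complex" where
  "normalize_mero f = (\<lambda>\<tau>. if \<tau> \<in> upper_half_plane then remove_sings f \<tau> else 0)"

text \<open>\<open>meromorphic_at_ioo f\<close>: for some \<open>N > 0\<close>, \<open>f\<close> is given near \<open>\<i>\<infinity>\<close> by a Laurent series in
  \<open>exp (2 \<pi> \<i> \<tau> / N)\<close> with only finitely many negative exponents.\<close>

definition meromorphic_at_ioo :: "(complex \<Rightarrow> complex) \<Rightarrow> bool" where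
  "meromorphic_at_ioo f \<longleftrightarrow>
     (\<exists>N>0. \<exists>F y. F meromorphic_on {0} \<and>
        (\<forall>\<tau>. Im \<tau> > y \<longrightarrow> f \<tau> = F (exp (2 * of_real pi * \<i> * \<tau> / of_nat N))))"

definition is_modular_function :: "(int^2^2) set set \<Rightarrow> (complex \<Rightarrow> complex) \<Rightarrow> bool" where
  "is_modular_function \<Gamma> f \<longleftrightarrow>
     f nicely_meromorphic_on upper_half_plane \<and>
     (\<forall>\<tau>. \<tau> \<notin> upper_half_plane \<longrightarrow> f \<tau> = 0) \<and>
     (\<forall>g\<in>\<Gamma>. \<forall>A\<in>g. \<forall>\<tau>\<in>upper_half_plane. f (moebius_act A \<tau>) = f \<tau>) \<and>
     (\<forall>A\<in>carrier SL2Z. meromorphic_at_ioo (\<lambda>\<tau>. f (moebius_act A \<tau>)))"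

definition modular_function_field :: "(int^2^2) set set \<Rightarrow> (complex \<Rightarrow> complex) ring" where
  "modular_function_field \<Gamma> =
     \<lparr>carrier = {f. is_modular_function \<Gamma> f},
      monoid.mult = (\<lambda>f g. normalize_mero (\<lambda>\<tau>. f \<tau> * g \<tau>)),
      one = normalize_mero (\<lambda>_. 1),
      zero = normalize_mero (\<lambda>_. 0),
      add = (\<lambda>f g. normalize_mero (\<lambda>\<tau>. f \<tau> + g \<tau>))\<rparr>"


section \<open>Weber curves\<close>

definition weber_coords :: "nat \<Rightarrow> complex \<Rightarrow> complex^4" where
  "weber_coords n \<tau> =
     vector [weber_u 0 \<tau> ^ (24 div n), weber_u 1 \<tau> ^ (24 div n), weber_u 2 \<tau> ^ (24 div n), 1]"

text \<open>The image of the upper half-plane misses the points at the cusps; the projective curve is its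
  closure.\<close>

definition weber_curve :: "nat \<Rightarrow> (complex^4) set set" where
  "weber_curve n =
     zariski_closure ((\<lambda>\<tau>. proj_point (weber_coords n \<tau>)) ` upper_half_plane)"

text \<open>Pullback of rational functions on the Weber curve along its parametrization. Different
  representatives of a class give quotients that agree outside a discrete set, so the normalized
  function does not depend on the choice.\<close>

definition weber_pullback :: "nat \<Rightarrow> fraction set \<Rightarrow> complex \<Rightarrow> complex" where
  "weber_pullback n r =
     (let (F, G) = (SOME x. x \<in> r)
      in normalize_mero (\<lambda>\<tau>. F (weber_coords n \<tau>) / G (weber_coords n \<tau>)))"

text \<open>The Weber curve \<open>n\<close> is the modular curve \<open>X(\<Gamma>)\<close>: its parametrization by the upper half-plane
  identifies its function field with that of \<open>X(\<Gamma>)\<close>, so that \<open>X(\<Gamma>)\<close> is its smooth projective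
  model. The pullback fixes constants, so this is an isomorphism over the complex numbers.\<close>

definition weber_curve_is_modular_curve :: "nat \<Rightarrow> (int^2^2) set set \<Rightarrow> bool" where
  "weber_curve_is_modular_curve n \<Gamma> \<longleftrightarrow>
     weber_pullback n \<in> ring_iso (function_field (weber_curve n)) (modular_function_field \<Gamma>)"

end

theory Submission
  imports Defs
begin

text \<open>
  Write \<open>x\<^sub>i = \<uu>\<^sub>i\<^sup>1\<^sup>2\<close>. Jacobi's theta product, viewed as a function of its elliptic variable, is
  determined up to a constant by its quasi-periods and zeros; comparing the products for \<open>\<tau>\<close> and
  \<open>-1/\<tau>\<close> and specialising to the half periods yields the action of \<open>\<tau> \<mapsto> -1/\<tau>\<close> on the Weber functions.
  Hence \<open>PSL\<^sub>2(\<int>)\<close> acts on \<open>x\<^sub>0, x\<^sub>1, x\<^sub>2\<close> by signed permutations that depend only on the matrix modulo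
  4, and the kernel is \<open>\<Gamma>(4)\<close>.

  The polynomial \<open>J = x\<^sub>0\<^sup>4 + x\<^sub>1\<^sup>4 + x\<^sub>2\<^sup>4\<close> has level one and a simple pole at the cusp, so every
  holomorphic function of level one with a pole at the cusp is a polynomial in \<open>J\<close>. A modular function
  \<open>f\<close> for \<open>\<Gamma>(4)\<close> becomes holomorphic after multiplication by a polynomial in \<open>J\<close>. Choose a linear form
  \<open>y\<close> in the \<open>x\<^sub>i\<close> with trivial stabiliser in \<open>PSL\<^sub>2(\<int>)/\<Gamma>(4)\<close>. The Lagrange interpolation polynomial
  that maps each conjugate of \<open>y\<close> to the corresponding conjugate of \<open>f\<close> has coefficients of level
  one, so \<open>f\<close> is a rational function of the \<open>x\<^sub>i\<close>.
\<close>

section \<open>The Weber functions as infinite products\<close>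

text \<open>The constant \<open>c\<close> in the inversion of the theta product is never evaluated.
  The three half periods share it, so the squares of the Weber functions acquire one common factor
  \<open>k\<close>. The product of the three functions is the constant \<open>sqrt 2\<close>, which
  forces \<open>k ^ 3 = 1\<close>, and \<open>k\<close> disappears in the twelfth powers. Following
  a matrix through the signed permutations leaves a single unknown sign \<open>s\<close> per matrix.
  On the kernel it is fixed by the product of the three twelfth powers being 64, so the sign
  character never has to be computed. Lagrange interpolation divides by differences of conjugates,
  which may vanish at isolated points. Multiplying by \<open>wD\<close>, the product of all these
  differences, keeps the coefficients holomorphic; \<open>wD\<close> is itself a polynomial in the
  coordinates, so dividing by it at the end stays inside the function field. The coefficients have
  level one, so their growth matters at one cusp only; but they are built from all conjugates of
  \<open>f\<close>, and this is where meromorphy of \<open>f\<close> at every cusp enters.\<close>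

abbreviation (input) act :: "int^2^2 \<Rightarrow> complex \<Rightarrow> complex" where "act \<equiv> moebius_act"
abbreviation (input) SL2 :: "(int^2^2) set" where "SL2 \<equiv> carrier SL2Z"
abbreviation (input) UHP :: "complex set" ("\<H>") where "\<H> \<equiv> upper_half_plane"

text \<open>This is the infinite q-Pochhammer symbol \<open>(- a; w)\<close>.\<close>

definition qprod :: "complex \<Rightarrow> complex \<Rightarrow> complex" where
  "qprod a w = (\<Prod>n. 1 + a * w ^ n)"

lemma convergent_qprod:
  fixes a w :: complex
  assumes "norm w < 1"
  shows "convergent_prod (\<lambda>n. 1 + a * w ^ n)"
proof -
  have "summable (\<lambda>n. norm (1 + a * w ^ n - 1))"
    using assms by (simp add: norm_mult norm_power summable_mult summable_geometric)
  thus ?thesis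
    by (intro abs_convergent_prod_imp_convergent_prod summable_imp_abs_convergent_prod)
qed

lemma qprod_LIMSEQ:
  assumes "norm w < 1"
  shows "(\<lambda>n. \<Prod>k<n. 1 + a * w ^ k) \<longlonglongrightarrow> qprod a w"
  using convergent_prod_LIMSEQ[OF convergent_qprod[OF assms, of a]]
  unfolding qprod_def lessThan_Suc_atMost[symmetric]
  by (rule LIMSEQ_imp_Suc)

lemma qprod_rec:
  assumes "norm w < 1"
  shows "qprod a w = (1 + a) * qprod (a * w) w"
proof (rule LIMSEQ_unique)
  show "(\<lambda>n. \<Prod>k<Suc n. 1 + a * w ^ k) \<longlonglongrightarrow> qprod a w"
    using qprod_LIMSEQ[OF assms] by (rule LIMSEQ_Suc)
  have "(\<lambda>n. (1 + a) * (\<Prod>k<n. 1 + a * w * w ^ k)) \<longlonglongrightarrow> (1 + a) * qprod (a * w) w"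
    by (intro tendsto_intros qprod_LIMSEQ assms)
  thus "(\<lambda>n. \<Prod>k<Suc n. 1 + a * w ^ k) \<longlonglongrightarrow> (1 + a) * qprod (a * w) w"
    by (simp only: prod.lessThan_Suc_shift) (simp add: mult.assoc)
qed

text \<open>Even and odd exponents are collected separately; the partial product of length
  \<open>2 * n\<close> is exactly a product of two partial products of length
  \<open>n\<close>.\<close>

lemma qprod_split:
  assumes "norm w < 1"
  shows "qprod a w = qprod a (w\<^sup>2) * qprod (a * w) (w\<^sup>2)"
proof (rule LIMSEQ_unique)
  have w2: "norm (w\<^sup>2) < 1"
    using assms by (simp add: norm_power power_less_one_iff)
  show "(\<lambda>n. \<Prod>k<2*n. 1 + a * w ^ k) \<longlonglongrightarrow> qprod a w"
    using LIMSEQ_subseq_LIMSEQ[OF qprod_LIMSEQ[OF assms], of "\<lambda>n. 2 * n"]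
    by (simp add: o_def strict_mono_def)
  have "(\<Prod>k<2*n. 1 + a * w ^ k) = (\<Prod>k<n. 1 + a * (w\<^sup>2) ^ k) * (\<Prod>k<n. 1 + a * w * (w\<^sup>2) ^ k)" for n
    by (induction n) (simp_all add: power_mult[symmetric] power_add algebra_simps)
  thus "(\<lambda>n. \<Prod>k<2*n. 1 + a * w ^ k) \<longlonglongrightarrow> qprod a (w\<^sup>2) * qprod (a * w) (w\<^sup>2)"
    by (simp only:) (intro tendsto_intros qprod_LIMSEQ w2)
qed

text \<open>Factor by factor this is \<open>(1 + x) * (1 - x) = 1 - x ^ 2\<close>.\<close>

lemma qprod_mult_minus:
  assumes "norm w < 1"
  shows "qprod a w * qprod (- a) w = qprod (- (a\<^sup>2)) (w\<^sup>2)"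
  unfolding qprod_def
  by (subst prodinf_mult[OF convergent_qprod[OF assms] convergent_qprod[OF assms]],
      rule arg_cong[where f = prodinf], rule ext)
     (simp add: algebra_simps power2_eq_square power_mult_distrib)

lemma qprod_nonzero:
  assumes "norm w < 1" "\<And>n. 1 + a * w ^ n \<noteq> 0"
  shows "qprod a w \<noteq> 0"
  unfolding qprod_def by (rule prodinf_nonzero) (use assms convergent_qprod in auto)

lemma qprod_nonzero':
  assumes "norm w < 1" "norm a < 1"
  shows "qprod a w \<noteq> 0"
proof (rule qprod_nonzero[OF assms(1)])
  fix n
  have "norm (a * w ^ n) \<le> norm a * 1"
    unfolding norm_mult norm_power using assms by (intro mult_left_mono power_le_one) auto
  hence "norm (a * w ^ n) \<noteq> norm (- 1 :: complex)"
    using assms by simp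
  thus "1 + a * w ^ n \<noteq> 0"
    by (metis add_eq_0_iff)
qed

text \<open>The partial products converge uniformly on closed discs: compactness turns the pointwise
  bound on \<open>g\<close> into a bound \<open>r < 1\<close>, so the terms are dominated by
  \<open>M * r ^ n\<close>.\<close>

lemma qprod_holomorphic:
  assumes "open A" "f holomorphic_on A" "g holomorphic_on A" "\<And>z. z \<in> A \<Longrightarrow> norm (g z) < 1"
  shows "(\<lambda>z. qprod (f z) (g z)) holomorphic_on A"
proof (rule holomorphic_uniform_sequence[OF assms(1)])
  show "(\<lambda>z. \<Prod>k<n. 1 + f z * g z ^ k) holomorphic_on A" for n
    by (intro holomorphic_intros assms)
  fix x assume x: "x \<in> A"
  then obtain d where d: "d > 0" "cball x d \<subseteq> A"
    using assms(1) open_contains_cball by blast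
  let ?C = "cball x d"
  have cf: "continuous_on ?C f" and cg: "continuous_on ?C g"
    using assms d by (auto intro: holomorphic_on_imp_continuous_on continuous_on_subset)
  obtain M where M: "\<And>z. z \<in> ?C \<Longrightarrow> norm (f z) \<le> M"
    using compact_imp_bounded[OF compact_continuous_image[OF cf compact_cball]]
    unfolding bounded_iff by (metis imageI)
  have "\<exists>y\<in>?C. \<forall>z\<in>?C. norm (g z) \<le> norm (g y)"
    using d by (intro continuous_attains_sup continuous_intros cg) auto
  then obtain y where y: "y \<in> ?C" "\<And>z. z \<in> ?C \<Longrightarrow> norm (g z) \<le> norm (g y)"
    by blast
  define r where "r = norm (g y)"
  have r: "r < 1" "r \<ge> 0"
    using y(1) d assms(4) by (auto simp: r_def)
  have "uniformly_convergent_on ?C (\<lambda>N z. \<Sum>n<N. norm (f z * g z ^ n))"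
  proof (rule Weierstrass_m_test')
    show "norm (norm (f z * g z ^ n)) \<le> M * r ^ n" if "z \<in> ?C" for n z
      using M[OF that] y(2)[OF that] order_trans[OF norm_ge_zero M[OF that]]
      by (auto simp: norm_mult norm_power r_def intro!: mult_mono power_mono)
    show "summable (\<lambda>n. M * r ^ n)"
      using r by (intro summable_mult summable_geometric) auto
  qed
  hence "uniformly_convergent_on ?C (\<lambda>N z. \<Prod>n<N. 1 + f z * g z ^ n)"
    by (intro uniformly_convergent_on_prod continuous_intros cf cg) auto
  then obtain l where l: "uniform_limit ?C (\<lambda>N z. \<Prod>n<N. 1 + f z * g z ^ n) l sequentially"
    unfolding uniformly_convergent_on_def by blast
  have "l z = qprod (f z) (g z)" if "z \<in> ?C" for z
    using LIMSEQ_unique[OF tendsto_uniform_limitI[OF l that] qprod_LIMSEQ] that d assms(4) by blast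
  hence "uniform_limit ?C (\<lambda>N z. \<Prod>n<N. 1 + f z * g z ^ n) (\<lambda>z. qprod (f z) (g z)) sequentially"
    using l by (metis (no_types, lifting) uniform_limit_cong')
  thus "\<exists>d>0. cball x d \<subseteq> A \<and>
      uniform_limit (cball x d) (\<lambda>N z. \<Prod>n<N. 1 + f z * g z ^ n) (\<lambda>z. qprod (f z) (g z)) sequentially"
    using d by blast
qed

text \<open>Its square is the local parameter of level one. The half-integral exponents in the
  products for \<open>weber_f\<close> and \<open>weber_f1\<close> become integral in terms of the
  nome.\<close>

definition nome :: "complex \<Rightarrow> complex" where
  "nome \<tau> = exp (of_real pi * \<i> * \<tau>)"

lemma nome_nonzero [simp]: "nome z \<noteq> 0"
  by (simp add: nome_def)

lemma norm_nome: "norm (nome z) = exp (- pi * Im z)"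
  by (simp add: nome_def)

lemma norm_nome_less_1: "Im z > 0 \<Longrightarrow> norm (nome z) < 1"
  by (simp add: norm_nome)

lemma norm_nome_power_less_1: "Im z > 0 \<Longrightarrow> n > 0 \<Longrightarrow> norm (nome z ^ n) < 1"
  by (simp add: norm_nome_less_1 norm_power power_less_one_iff)

lemma dedekind_eta_qprod:
  "dedekind_eta z = exp (of_real pi * \<i> * z / 12) * qprod (- (nome z)\<^sup>2) ((nome z)\<^sup>2)"
proof -
  have "exp (2 * of_real pi * \<i> * z) = (nome z)\<^sup>2"
    by (simp add: nome_def exp_double[symmetric] mult_ac)
  thus ?thesis
    by (simp add: dedekind_eta_def qprod_def)
qed

text \<open>The eta product at \<open>(z + 1) / 2\<close> has base \<open>- nome z\<close>.
  Splitting it by parity leaves one factor that cancels against \<open>dedekind_eta z\<close>;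
  \<open>inverse (zeta 48)\<close> removes the phase caused by the shift by 1.\<close>

lemma weber_f_qprod:
  assumes "Im z > 0"
  shows "weber_f z = exp (- (of_real pi * \<i> * z / 24)) * qprod (nome z) ((nome z)\<^sup>2)"
proof -
  let ?q = "nome z"
  have n: "norm ?q < 1" "norm (?q\<^sup>2) < 1"
    using assms norm_nome_less_1 norm_nome_power_less_1 by auto
  have "(nome ((z + 1) / 2))\<^sup>2 = - ?q"
  proof -
    have "2 * (of_real pi * \<i> * ((z + 1) / 2)) = of_real pi * \<i> * z + of_real pi * \<i>"
      by (simp add: field_simps)
    thus ?thesis
      by (simp only: nome_def exp_double[symmetric] exp_add) simp
  qed
  hence "weber_f z = inverse (zeta 48) * exp (of_real pi * \<i> * ((z + 1) / 2) / 12) / exp (of_real pi * \<i> * z / 12)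
      * (qprod ?q (- ?q) / qprod (- (?q\<^sup>2)) (?q\<^sup>2))"
    by (simp add: weber_f_def dedekind_eta_qprod)
  also have "qprod ?q (- ?q) = qprod ?q (?q\<^sup>2) * qprod (- (?q\<^sup>2)) (?q\<^sup>2)"
    using qprod_split[of "- ?q" ?q] n by (simp add: power2_eq_square)
  also have "inverse (zeta 48) * exp (of_real pi * \<i> * ((z + 1) / 2) / 12) / exp (of_real pi * \<i> * z / 12)
      = exp (- (of_real pi * \<i> * z / 24))"
  proof -
    have "- (2 * p * \<i> / of_nat 48) + p * \<i> * ((z + 1) / 2) / 12 - p * \<i> * z / 12 = - (p * \<i> * z / 24)" for p
      by (simp add: add_divide_distrib ring_distribs)
    from arg_cong[where f = exp, OF this[of "of_real pi"]] show ?thesis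
      by (simp only: zeta_def exp_minus exp_add exp_diff)
  qed
  finally show ?thesis
    using qprod_nonzero'[of "?q\<^sup>2" "- (?q\<^sup>2)"] n by simp
qed

lemma weber_f1_qprod:
  assumes "Im z > 0"
  shows "weber_f1 z = exp (- (of_real pi * \<i> * z / 24)) * qprod (- nome z) ((nome z)\<^sup>2)"
proof -
  let ?q = "nome z"
  have n: "norm ?q < 1" "norm (?q\<^sup>2) < 1"
    using assms norm_nome_less_1 norm_nome_power_less_1 by auto
  have "(nome (z / 2))\<^sup>2 = ?q"
    by (simp add: nome_def exp_double[symmetric] ring_distribs exp_add)
  hence "weber_f1 z = exp (of_real pi * \<i> * (z / 2) / 12) / exp (of_real pi * \<i> * z / 12)
      * (qprod (- ?q) ?q / qprod (- (?q\<^sup>2)) (?q\<^sup>2))"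
    by (simp add: weber_f1_def dedekind_eta_qprod)
  also have "qprod (- ?q) ?q = qprod (- ?q) (?q\<^sup>2) * qprod (- (?q\<^sup>2)) (?q\<^sup>2)"
    using qprod_split[of ?q "- ?q"] n by (simp add: power2_eq_square)
  also have "exp (of_real pi * \<i> * (z / 2) / 12) / exp (of_real pi * \<i> * z / 12)
      = exp (- (of_real pi * \<i> * z / 24))"
    unfolding exp_diff[symmetric] by (rule arg_cong[where f = exp]) simp
  finally show ?thesis
    using qprod_nonzero'[of "?q\<^sup>2" "- (?q\<^sup>2)"] n by simp
qed

text \<open>Here \<open>qprod_mult_minus\<close> takes the place of the parity splitting: the
  factors of \<open>dedekind_eta (2 * z)\<close> are differences of squares.\<close>

lemma weber_f2_qprod:
  assumes "Im z > 0"
  shows "weber_f2 z = of_real (sqrt 2) * exp (of_real pi * \<i> * z / 12) * qprod ((nome z)\<^sup>2) ((nome z)\<^sup>2)"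
proof -
  let ?q = "nome z"
  have n: "norm ?q < 1" "norm (?q\<^sup>2) < 1"
    using assms norm_nome_less_1 norm_nome_power_less_1 by auto
  have "nome (2 * z) = ?q\<^sup>2"
    by (simp only: nome_def exp_double[symmetric] mult.left_commute)
  hence "weber_f2 z = of_real (sqrt 2) * (exp (of_real pi * \<i> * (2 * z) / 12) / exp (of_real pi * \<i> * z / 12))
      * (qprod (- ((?q\<^sup>2)\<^sup>2)) ((?q\<^sup>2)\<^sup>2) / qprod (- (?q\<^sup>2)) (?q\<^sup>2))"
    by (simp add: weber_f2_def dedekind_eta_qprod)
  also have "qprod (- ((?q\<^sup>2)\<^sup>2)) ((?q\<^sup>2)\<^sup>2) = qprod (?q\<^sup>2) (?q\<^sup>2) * qprod (- (?q\<^sup>2)) (?q\<^sup>2)"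
    using qprod_mult_minus[of "?q\<^sup>2" "?q\<^sup>2"] n by simp
  also have "exp (of_real pi * \<i> * (2 * z) / 12) / exp (of_real pi * \<i> * z / 12)
      = exp (of_real pi * \<i> * z / 12)"
    unfolding exp_diff[symmetric] by (rule arg_cong[where f = exp]) simp
  finally show ?thesis
    using qprod_nonzero'[of "?q\<^sup>2" "- (?q\<^sup>2)"] n by simp
qed

text \<open>Parity splitting followed by two differences of squares expresses
  \<open>qprod (- (q ^ 2)) (q ^ 2)\<close> as itself times the triple product, and this value is
  nonzero.\<close>

lemma qprod_weber_product:
  assumes "norm q < 1"
  shows "qprod q (q\<^sup>2) * qprod (- q) (q\<^sup>2) * qprod (q\<^sup>2) (q\<^sup>2) = 1"
proof -
  have n: "norm (q\<^sup>2) < 1"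
    using assms by (simp add: norm_power power_less_one_iff)
  have "qprod (- (q\<^sup>2)) (q\<^sup>2) = qprod (- (q\<^sup>2)) ((q\<^sup>2)\<^sup>2) * qprod (- ((q\<^sup>2)\<^sup>2)) ((q\<^sup>2)\<^sup>2)"
    using qprod_split[OF n, of "- (q\<^sup>2)"] by (simp only: power2_eq_square mult_minus_left mult.assoc)
  also have "\<dots> = qprod (- (q\<^sup>2)) (q\<^sup>2) * (qprod q (q\<^sup>2) * qprod (- q) (q\<^sup>2) * qprod (q\<^sup>2) (q\<^sup>2))"
    unfolding qprod_mult_minus[OF n, of "q\<^sup>2", symmetric] qprod_mult_minus[OF n, of q] by (simp add: mult_ac)
  finally show ?thesis
    using qprod_nonzero'[OF n, of "- (q\<^sup>2)"] n by simp
qed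

lemma weber_product:
  assumes "Im z > 0"
  shows "weber_f z * weber_f1 z * weber_f2 z = of_real (sqrt 2)"
proof -
  have "weber_f z * weber_f1 z * weber_f2 z = of_real (sqrt 2) *
     (exp (- (of_real pi * \<i> * z / 24)) * exp (- (of_real pi * \<i> * z / 24)) * exp (of_real pi * \<i> * z / 12))
     * (qprod (nome z) ((nome z)\<^sup>2) * qprod (- nome z) ((nome z)\<^sup>2) * qprod ((nome z)\<^sup>2) ((nome z)\<^sup>2))"
    using assms by (simp add: weber_f_qprod weber_f1_qprod weber_f2_qprod mult_ac)
  also have "exp (- (of_real pi * \<i> * z / 24)) * exp (- (of_real pi * \<i> * z / 24)) * exp (of_real pi * \<i> * z / 12) = 1"
    by (simp add: exp_add[symmetric])
  finally show ?thesis
    using qprod_weber_product[OF norm_nome_less_1[OF assms]] by simp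
qed

section \<open>Transformation of the Weber functions under the modular group\<close>

lemma nome_add: "nome (a + b) = nome a * nome b"
  by (simp add: nome_def ring_distribs exp_add)

lemma nome_0 [simp]: "nome 0 = 1"
  by (simp add: nome_def)

lemma nome_1 [simp]: "nome 1 = - 1"
  by (simp add: nome_def)

lemma nome_minus: "nome (- a) = inverse (nome a)"
  by (simp add: nome_def exp_minus)

lemma nome_diff: "nome (a - b) = nome a / nome b"
  using nome_add[of a "- b"] by (simp add: nome_minus field_simps)

lemma nome_power: "nome a ^ n = nome (of_nat n * a)"
  by (simp add: nome_def exp_of_nat_mult[symmetric] mult_ac)

lemma nome_half: "nome (1 / 2) = \<i>"
  by (simp add: nome_def complex_eq_iff Re_exp Im_exp)

lemma nome_plus_2 [simp]: "nome (a + 2) = nome a"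
  using nome_add[of a 2] nome_power[of 1 2] by simp

lemma nome_eq_minus_1D:
  assumes "nome a = - 1"
  obtains m :: int where "a = 1 + 2 * of_int m"
proof -
  have "exp (of_real pi * \<i> * a) = exp (of_real pi * \<i>)"
    using assms by (simp add: nome_def)
  then obtain m :: int where m: "of_real pi * \<i> * a = of_real pi * \<i> + (of_int (2 * m) * pi) * \<i>"
    unfolding exp_eq by blast
  have "of_real pi * \<i> * a = of_real pi * \<i> * (1 + 2 * of_int m)"
    using m by (simp add: algebra_simps)
  hence "a = 1 + 2 * of_int m"
    by (subst (asm) mult_cancel_left) simp
  thus ?thesis
    by (rule that)
qed

lemma nome_holomorphic [holomorphic_intros]:
  "f holomorphic_on A \<Longrightarrow> (\<lambda>z. nome (f z)) holomorphic_on A"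
  unfolding nome_def by (intro holomorphic_intros)

text \<open>Jacobi's third theta function in product form, without the factor that is independent of
  \<open>z\<close>; what follows relies on the quasi-periods and zeros in \<open>z\<close>.\<close>

definition theta :: "complex \<Rightarrow> complex \<Rightarrow> complex" where
  "theta z \<tau> = qprod (nome (\<tau> + 2 * z)) ((nome \<tau>)\<^sup>2) * qprod (nome (\<tau> - 2 * z)) ((nome \<tau>)\<^sup>2)"

lemma theta_uminus: "theta (- z) \<tau> = theta z \<tau>"
  by (simp add: theta_def)

lemma theta_plus_1: "theta (z + 1) \<tau> = theta z \<tau>"
proof -
  have "nome (\<tau> - 2 * (z + 1)) = nome (\<tau> - 2 * z)"
    using nome_plus_2[of "\<tau> - 2 * (z + 1)"] by (simp add: algebra_simps)
  moreover have "nome (\<tau> + 2 * (z + 1)) = nome (\<tau> + 2 * z)"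
    using nome_plus_2[of "\<tau> + 2 * z"] by (simp add: algebra_simps)
  ultimately show ?thesis
    by (simp add: theta_def)
qed

text \<open>The shift removes the factor \<open>1 + a\<close> from one product and adds
  \<open>1 + inverse a = inverse a * (1 + a)\<close> to the other; the quotient of the two is the
  multiplier.\<close>

lemma theta_plus_tau:
  assumes "Im t > 0"
  shows "theta (z + t) t = nome (- (t + 2 * z)) * theta z t"
proof -
  define a b w where "a = nome (t + 2 * z)" and "b = nome (t - 2 * z)" and "w = (nome t)\<^sup>2"
  have w: "norm w < 1" "w \<noteq> 0"
    using norm_nome_power_less_1[OF assms] by (auto simp: w_def)
  have w': "w = nome (2 * t)"
    by (simp add: w_def nome_power)
  have 1: "nome (t + 2 * (z + t)) = a * w"
    unfolding a_def w' nome_add[symmetric] by (simp add: algebra_simps)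
  have 2: "nome (t - 2 * (z + t)) = inverse a"
    unfolding a_def nome_minus[symmetric] by (simp add: algebra_simps)
  have 3: "inverse a * w = b"
    unfolding a_def b_def w' nome_minus[symmetric] nome_add[symmetric] by (simp add: algebra_simps)
  have "theta (z + t) t = qprod (a * w) w * ((1 + inverse a) * qprod b w)"
    unfolding theta_def 1 2 w_def[symmetric] using qprod_rec[OF w(1), of "inverse a"] 3 by simp
  also have "\<dots> = inverse a * (((1 + a) * qprod (a * w) w) * qprod b w)"
    by (simp add: field_simps a_def)
  also have "(1 + a) * qprod (a * w) w = qprod a w"
    by (rule qprod_rec[OF w(1), symmetric])
  finally show ?thesis
    unfolding theta_def a_def b_def w_def nome_minus by (simp only: mult.assoc)
qed

lemma theta_holomorphic:
  assumes "Im \<tau> > 0"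
  shows "(\<lambda>z. theta z \<tau>) holomorphic_on UNIV"
  unfolding theta_def
  by (intro holomorphic_intros qprod_holomorphic)
     (use norm_nome_power_less_1[OF assms, of 2] in auto)

lemma theta_eq_0D:
  assumes "Im t > 0" "theta z t = 0"
  obtains m k :: int where "z = (1 + t) / 2 + (of_int m + of_int k * t)"
proof -
  have n: "norm ((nome t)\<^sup>2) < 1"
    using assms norm_nome_power_less_1 by auto
  have *: "\<exists>n. nome (of_nat (2 * n + 1) * t + y) = - 1" if y: "qprod (nome (t + y)) ((nome t)\<^sup>2) = 0" for y
  proof -
    obtain k where "1 + nome (t + y) * ((nome t)\<^sup>2) ^ k = 0"
      using qprod_nonzero[OF n, of "nome (t + y)"] y by metis
    moreover have "nome (t + y) * ((nome t)\<^sup>2) ^ k = nome (of_nat (2 * k + 1) * t + y)"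
      unfolding power_mult[symmetric] nome_power nome_add[symmetric] by (simp add: algebra_simps)
    ultimately show ?thesis
      by (metis add_eq_0_iff)
  qed
  have "qprod (nome (t + 2 * z)) ((nome t)\<^sup>2) = 0 \<or> qprod (nome (t + - (2 * z))) ((nome t)\<^sup>2) = 0"
    using assms by (simp add: theta_def)
  thus ?thesis
  proof
    assume "qprod (nome (t + 2 * z)) ((nome t)\<^sup>2) = 0"
    then obtain n m where "of_nat (2 * n + 1) * t + 2 * z = 1 + 2 * of_int m"
      using * nome_eq_minus_1D by metis
    hence "2 * z = 1 + 2 * of_int m - of_nat (2 * n + 1) * t"
      by (simp add: algebra_simps)
    hence "z = (1 + t) / 2 + (of_int m + of_int (- int n - 1) * t)"
      by (simp add: field_simps)
    thus ?thesis
      by (rule that)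
  next
    assume "qprod (nome (t + - (2 * z))) ((nome t)\<^sup>2) = 0"
    then obtain n m where "of_nat (2 * n + 1) * t + - (2 * z) = 1 + 2 * of_int m"
      using * nome_eq_minus_1D by metis
    hence "2 * z = of_nat (2 * n + 1) * t - (1 + 2 * of_int m)"
      by (simp add: algebra_simps)
    hence "z = (1 + t) / 2 + (of_int (- m - 1) + of_int (int n) * t)"
      by (simp add: field_simps)
    thus ?thesis
      by (rule that)
  qed
qed

lemma int_multiple_period:
  fixes f :: "complex \<Rightarrow> complex"
  assumes "\<And>z. f (z + a) = f z"
  shows "f (z + of_int k * a) = f z"
proof -
  have nat: "f (z + of_nat n * a) = f z" for n z
  proof (induction n)
    case (Suc n)
    have "f (z + of_nat (Suc n) * a) = f (z + of_nat n * a + a)"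
      by (simp add: algebra_simps)
    thus ?case
      using Suc assms by simp
  qed simp
  show ?thesis
  proof (cases k)
    case (neg n)
    have "f z = f (z + of_int k * a + of_nat (Suc n) * a)"
      unfolding neg by (simp add: algebra_simps)
    thus ?thesis
      using nat[of "z + of_int k * a" "Suc n"] by simp
  qed (simp add: nat)
qed

text \<open>Periodicity brings every argument into the closed period parallelogram, so all values
  are taken on a compact set and Liouville's theorem applies.\<close>

lemma doubly_periodic_entire_constant:
  assumes f: "f holomorphic_on UNIV" and \<tau>: "Im \<tau> > 0"
    and p1: "\<And>z. f (z + 1) = f z" and p\<tau>: "\<And>z. f (z + \<tau>) = f z"
  shows "\<exists>c. \<forall>z. f z = c"
proof -
  let ?g = "\<lambda>(s :: real, t :: real). of_real s + of_real t * \<tau>"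
  let ?K = "?g ` ({0..1} \<times> {0..1})"
  have "compact ?K"
    unfolding case_prod_beta
    by (intro compact_continuous_image compact_Times continuous_intros) auto
  moreover have "continuous_on ?K f"
    using f by (intro holomorphic_on_imp_continuous_on) (auto intro: holomorphic_on_subset)
  ultimately have "compact (f ` ?K)"
    by (rule compact_continuous_image[rotated])
  moreover have "range f \<subseteq> f ` ?K"
  proof safe
    fix z :: complex
    define t s where "t = Im z / Im \<tau>" and "s = Re z - t * Re \<tau>"
    have z: "z = of_real s + of_real t * \<tau>"
      using \<tau> by (auto simp: complex_eq_iff t_def s_def)
    have "f z = f (z + of_int (- \<lfloor>s\<rfloor>) * 1 + of_int (- \<lfloor>t\<rfloor>) * \<tau>)"
      using int_multiple_period[of f \<tau>, OF p\<tau>] int_multiple_period[of f 1, OF p1] by metis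
    also have "z + of_int (- \<lfloor>s\<rfloor>) * 1 + of_int (- \<lfloor>t\<rfloor>) * \<tau> = ?g (frac s, frac t)"
      by (simp add: z frac_def algebra_simps)
    finally show "f z \<in> f ` ?K"
      by (intro image_eqI[of _ _ "?g (frac s, frac t)"]) (auto simp: frac_lt_1 less_imp_le)
  qed
  ultimately have "bounded (range f)"
    using compact_imp_bounded bounded_subset by blast
  thus ?thesis
    using Liouville_theorem[OF f] by (auto simp: constant_on_def)
qed

lemma remove_sings_shift_period:
  assumes "\<And>z. f (z + p) = f z"
  shows "remove_sings f (z + p) = remove_sings f z"
proof -
  have "remove_sings f (z + p) = remove_sings (\<lambda>w. f (z + p + w)) 0"
    by (rule remove_sings_shift_0)
  also have "(\<lambda>w. f (z + p + w)) = (\<lambda>w. f (z + w))"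
    using assms[of "z + w" for w] by (simp add: algebra_simps)
  also have "remove_sings (\<lambda>w. f (z + w)) 0 = remove_sings f z"
    by (rule remove_sings_shift_0[symmetric])
  finally show ?thesis .
qed

text \<open>All zeros of \<open>theta\<close> are translates by periods of the simple zero at \<open>(1 + \<tau>) / 2\<close>, where the
  left-hand side also vanishes; so the quotient of the two sides is an entire elliptic function.\<close>

lemma theta_inversion:
  assumes t: "Im t > 0"
  obtains c where "\<And>z. theta z t \<noteq> 0 \<Longrightarrow>
    theta (z / t) (- 1 / t) * nome (- (z\<^sup>2 / t)) = c * theta z t"
proof -
  define t' where "t' = - 1 / t"
  have [simp]: "t \<noteq> 0"
    using t by auto
  have t': "Im t' > 0"
    using t by (simp add: t'_def Im_divide divide_pos_pos sum_power2_gt_zero_iff)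
  \<comment> \<open>The Gaussian factor converts the quasi-periods of the theta function for
    \<open>-1/t\<close> into those of \<open>theta z t\<close>. This is checked in \<open>N1\<close>
    and \<open>Nt\<close>, and it gives \<open>M\<close> the periods 1 and \<open>t\<close>.\<close>
  define N where "N = (\<lambda>z. theta (z / t) t' * nome (- (z\<^sup>2 / t)))"
  define M where "M = (\<lambda>z. N z / theta z t)"
  define E where "E = remove_sings M"
  define z0 where "z0 = (1 + t) / 2"
  have "((\<lambda>w. theta w t') \<circ> (\<lambda>z. z / t)) holomorphic_on UNIV"
    by (rule holomorphic_on_compose) (auto intro!: holomorphic_intros holomorphic_on_subset[OF theta_holomorphic[OF t']])
  hence N_hol: "N holomorphic_on UNIV"
    unfolding N_def o_def by (intro holomorphic_intros) auto
  note th_hol = theta_holomorphic[OF t]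
  have N1: "N (z + 1) = N z" for z
  proof -
    define u where "u = (z + 1) / t"
    have "z / t = u + t'"
      by (simp add: u_def t'_def field_simps)
    hence "theta (z / t) t' = nome (- (t' + 2 * u)) * theta u t'"
      by (simp add: theta_plus_tau[OF t'])
    hence "N z = (nome (- (t' + 2 * u)) * nome (- (z\<^sup>2 / t))) * theta u t'"
      by (simp add: N_def)
    also have "nome (- (t' + 2 * u)) * nome (- (z\<^sup>2 / t)) = nome (- ((z + 1)\<^sup>2 / t))"
      unfolding nome_add[symmetric]
      by (rule arg_cong[where f = nome]) (simp add: u_def t'_def field_simps power2_eq_square)
    finally show ?thesis
      by (simp add: N_def u_def)
  qed
  have Nt: "N (z + t) = nome (- (t + 2 * z)) * N z" for z
  proof -
    have "(z + t) / t = z / t + 1"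
      by (simp add: field_simps)
    hence "N (z + t) = theta (z / t) t' * nome (- ((z + t)\<^sup>2 / t))"
      by (simp add: N_def theta_plus_1)
    also have "nome (- ((z + t)\<^sup>2 / t)) = nome (- (t + 2 * z)) * nome (- (z\<^sup>2 / t))"
      unfolding nome_add[symmetric]
      by (rule arg_cong[where f = nome]) (simp add: field_simps power2_eq_square)
    finally show ?thesis
      by (simp add: N_def)
  qed
  have M1: "M (z + 1) = M z" and Mt: "M (z + t) = M z" for z
    by (simp_all add: M_def N1 theta_plus_1 Nt theta_plus_tau[OF t])
  have E1: "E (z + 1) = E z" and Et: "E (z + t) = E z" for z
    unfolding E_def by (intro remove_sings_shift_period M1 Mt)+
  have E_ana: "E analytic_on {z}" if "theta z t \<noteq> 0" for z
    unfolding E_def M_def using that N_hol th_hol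
    by (intro remove_sings_analytic_on analytic_intros) (auto simp: analytic_on_holomorphic)

  have E_z0: "E analytic_on {z0}"
  proof -
    define w where "w = (nome t)\<^sup>2"
    have w: "norm w < 1" "w = nome (2 * t)"
      using norm_nome_power_less_1[OF t, of 2] by (auto simp: w_def nome_power)
    \<comment> \<open>The factor \<open>g\<close> of \<open>theta\<close> vanishes at
      \<open>z0\<close> and the remaining product \<open>R\<close> does not. The derivative of
      \<open>g\<close> at \<open>z0\<close> is nonzero, so the zero is simple.\<close>
    define g where "g = (\<lambda>z. 1 + nome (t - 2 * z))"
    define R where "R = (\<lambda>z. qprod (nome (t + 2 * z)) w * qprod (nome (t - 2 * z) * w) w)"
    have th: "theta z t = g z * R z" for z
      using qprod_rec[OF w(1), of "nome (t - 2 * z)"]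
      by (simp add: theta_def g_def R_def w_def)
    have e: "t + 2 * z0 = 2 * t + 1" "t - 2 * z0 = - 1"
      by (auto simp: z0_def field_simps)
    have n1: "nome (t - 2 * z0) = - 1"
      unfolding e by (simp add: nome_minus)
    have n2: "nome (t + 2 * z0) = - w"
      unfolding e by (simp add: nome_add w)
    have g0: "g z0 = 0"
      by (simp add: g_def n1)
    have R0: "R z0 \<noteq> 0"
      unfolding R_def n1 n2 using w(1) by (simp add: qprod_nonzero')
    have R_hol: "R holomorphic_on UNIV"
      unfolding R_def by (intro holomorphic_intros qprod_holomorphic) (use w in auto)
    have "nome ((z0 / t) * 2 + t') = - 1"
    proof -
      have "z0 / t * 2 + t' = 1"
        by (simp add: z0_def t'_def field_simps)
      thus ?thesis
        by simp
    qed
    hence "qprod (nome (t' + 2 * (z0 / t))) ((nome t')\<^sup>2) = 0"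
      using qprod_rec[of "(nome t')\<^sup>2" "- 1"] norm_nome_power_less_1[OF t', of 2]
      by (simp add: add.commute mult.commute)
    hence N0: "N z0 = 0"
      by (simp add: N_def theta_def)
    have g': "(g has_field_derivative 2 * of_real pi * \<i>) (at z0)"
    proof -
      have "(g has_field_derivative exp (of_real pi * \<i> * (t - 2 * z0)) * (of_real pi * \<i> * (- 2))) (at z0)"
        unfolding g_def nome_def by (auto intro!: derivative_eq_intros)
      thus ?thesis
        using n1 by (simp add: nome_def mult_ac)
    qed
    have N': "(N has_field_derivative deriv N z0) (at z0)"
      using N_hol by (intro holomorphic_derivI[of _ UNIV]) auto
    \<comment> \<open>Since \<open>N\<close> and \<open>g\<close> both vanish at \<open>z0\<close>,
      \<open>M\<close> is a quotient of difference quotients and has a finite limit there.\<close>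
    have "((\<lambda>z. ((N z - N z0) / (z - z0)) / (((g z - g z0) / (z - z0)) * R z)) \<longlongrightarrow>
        deriv N z0 / (2 * of_real pi * \<i> * R z0)) (at z0)"
      using N' g' R0 holomorphic_on_imp_continuous_on[OF R_hol]
      by (intro tendsto_intros) (auto simp: has_field_derivative_iff continuous_on_eq_continuous_at isCont_def)
    also have "?this \<longleftrightarrow> (M \<longlongrightarrow> deriv N z0 / (2 * of_real pi * \<i> * R z0)) (at z0)"
    proof (rule tendsto_cong)
      have "eventually (\<lambda>z. z \<noteq> z0) (at z0)"
        by (simp add: eventually_at_filter)
      thus "eventually (\<lambda>z. ((N z - N z0) / (z - z0)) / (((g z - g z0) / (z - z0)) * R z) = M z) (at z0)"
        by eventually_elim (simp add: N0 g0 M_def th)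
    qed
    finally have lim: "(M \<longlongrightarrow> deriv N z0 / (2 * of_real pi * \<i> * R z0)) (at z0)" .
    have "M meromorphic_on {z0}"
      unfolding M_def using N_hol th_hol
      by (intro meromorphic_intros analytic_on_imp_meromorphic_on) (auto simp: analytic_on_holomorphic)
    hence "isolated_singularity_at M z0"
      by (simp add: meromorphic_at_iff)
    thus ?thesis
      unfolding E_def using lim by (rule remove_sings_analytic_at)
  qed
  have "E analytic_on {z}" for z
  proof (cases "theta z t = 0")
    case True
    then obtain m k :: int where z: "z = z0 + (of_int m + of_int k * t)"
      using theta_eq_0D[OF t] unfolding z0_def by metis
    let ?p = "of_int m + of_int k * t :: complex"
    have per: "E (w + ?p) = E w" for w
      using int_multiple_period[of E t "w + of_int m" k, OF Et] int_multiple_period[of E 1 w m, OF E1]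
      by (simp add: add_ac)
    have "E = E \<circ> (\<lambda>w. w - ?p)"
      using per[of "w - ?p" for w] by (auto simp: fun_eq_iff)
    moreover have "(E \<circ> (\<lambda>w. w - ?p)) analytic_on {z}"
      by (rule analytic_on_compose) (use E_z0 z in \<open>auto intro!: analytic_intros\<close>)
    ultimately show ?thesis
      by simp
  qed (use E_ana in auto)
  hence "E analytic_on UNIV"
    by (subst analytic_on_analytic_at) auto
  hence "E holomorphic_on UNIV"
    by (rule analytic_imp_holomorphic)
  then obtain c where c: "\<And>z. E z = c"
    using doubly_periodic_entire_constant[OF _ t E1 Et] by blast
  show ?thesis
  proof (rule that[of c])
    fix z assume z: "theta z t \<noteq> 0"
    have "M analytic_on {z}"
      unfolding M_def using z N_hol th_hol
      by (intro analytic_intros) (auto simp: analytic_on_holomorphic)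
    hence "M z = c"
      using c[of z] by (simp add: E_def)
    thus "theta (z / t) (- 1 / t) * nome (- (z\<^sup>2 / t)) = c * theta z t"
      using z by (simp add: M_def N_def t'_def field_simps)
  qed
qed

text \<open>At the half periods \<open>0\<close> and \<open>1 / 2\<close> the two products in
  \<open>theta\<close> agree, which gives a square. At \<open>z / 2\<close> they differ by the
  factor \<open>1 + 1\<close> that \<open>qprod_rec\<close> splits off \<open>qprod 1\<close>; it
  matches the square of \<open>sqrt 2\<close> in \<open>weber_f2\<close>.\<close>

lemma weber_squares_theta:
  assumes "Im z > 0"
  shows "weber_f z ^ 2 = nome (- (z / 12)) * theta 0 z"
    "weber_f1 z ^ 2 = nome (- (z / 12)) * theta (1 / 2) z"
    "weber_f2 z ^ 2 = nome (z / 6) * theta (z / 2) z"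
proof -
  let ?q = "nome z"
  have e: "exp (- (of_real pi * \<i> * z / 24)) = nome (- (z / 24))"
    "exp (of_real pi * \<i> * z / 12) = nome (z / 12)"
    by (simp_all add: nome_def)
  have p: "nome (- (z / 24)) ^ 2 = nome (- (z / 12))" "nome (z / 12) ^ 2 = nome (z / 6)"
    by (simp_all add: nome_power)
  show "weber_f z ^ 2 = nome (- (z / 12)) * theta 0 z"
    by (simp add: weber_f_qprod[OF assms] power_mult_distrib e p theta_def power2_eq_square[of "qprod _ _"])
  have "nome (z - 1) = - ?q" "nome (z + 1) = - ?q"
    by (simp_all add: nome_diff nome_add)
  thus "weber_f1 z ^ 2 = nome (- (z / 12)) * theta (1 / 2) z"
    by (simp add: weber_f1_qprod[OF assms] power_mult_distrib e p theta_def power2_eq_square[of "qprod _ _"])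
  have "theta (z / 2) z = 2 * (qprod (?q\<^sup>2) (?q\<^sup>2))\<^sup>2"
    using qprod_rec[OF norm_nome_power_less_1[OF assms], of 2 1] nome_power[of z 2]
    by (simp add: theta_def power2_eq_square[of "qprod _ _"])
  thus "weber_f2 z ^ 2 = nome (z / 6) * theta (z / 2) z"
    by (simp add: weber_f2_qprod[OF assms] power_mult_distrib e p flip: of_real_power)
qed

lemma weber_nonzero:
  assumes "Im z > 0"
  shows "weber_f z \<noteq> 0" "weber_f1 z \<noteq> 0" "weber_f2 z \<noteq> 0"
  using weber_product[OF assms] by auto

lemma weber_inversion:
  assumes t: "Im t > 0"
  obtains k where "k ^ 3 = 1" "weber_f (- 1 / t) ^ 2 = k * weber_f t ^ 2"
    "weber_f1 (- 1 / t) ^ 2 = k * weber_f2 t ^ 2" "weber_f2 (- 1 / t) ^ 2 = k * weber_f1 t ^ 2"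
proof -
  define t' where "t' = - 1 / t"
  have t0 [simp]: "t \<noteq> 0"
    using t by auto
  have t': "Im t' > 0"
    using t by (simp add: t'_def Im_divide divide_pos_pos sum_power2_gt_zero_iff)
  obtain c where c: "\<And>z. theta z t \<noteq> 0 \<Longrightarrow> theta (z / t) t' * nome (- (z\<^sup>2 / t)) = c * theta z t"
    using theta_inversion[OF t] unfolding t'_def by blast
  have nz: "theta 0 t \<noteq> 0" "theta (1 / 2) t \<noteq> 0" "theta (t / 2) t \<noteq> 0"
    using weber_nonzero[OF t] weber_squares_theta[OF t] by auto
  \<comment> \<open>\<open>k\<close> combines the unknown \<open>c\<close> with the quotient of the
    exponential prefactors at \<open>t\<close> and \<open>t'\<close>. The different prefactor of
    \<open>weber_f2\<close> is compensated by the Gaussian factor, so the same \<open>k\<close>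
    serves all three half periods.\<close>
  define k where "k = c * nome (t / 12 - t' / 12)"
  have 0: "weber_f t' ^ 2 = k * weber_f t ^ 2"
  proof -
    have "theta 0 t' = c * theta 0 t"
      using c[OF nz(1)] by simp
    hence "weber_f t' ^ 2 = c * nome (- (t' / 12)) * theta 0 t"
      by (simp add: weber_squares_theta[OF t'])
    also have "nome (- (t' / 12)) = nome (t / 12 - t' / 12) * nome (- (t / 12))"
      unfolding nome_add[symmetric] by simp
    finally show ?thesis
      by (simp add: weber_squares_theta[OF t] k_def)
  qed
  have 1: "weber_f1 t' ^ 2 = k * weber_f2 t ^ 2"
  proof -
    have "theta (1 / 2) t' * nome (- (t / 4)) = c * theta (t / 2) t"
      using c[OF nz(3)] by (simp add: power2_eq_square)
    hence "theta (1 / 2) t' = c * nome (t / 4) * theta (t / 2) t"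
      by (simp add: nome_minus field_simps)
    hence "weber_f1 t' ^ 2 = c * (nome (- (t' / 12)) * nome (t / 4)) * theta (t / 2) t"
      by (simp add: weber_squares_theta[OF t'])
    also have "nome (- (t' / 12)) * nome (t / 4) = nome (t / 12 - t' / 12) * nome (t / 6)"
      unfolding nome_add[symmetric] by (rule arg_cong[where f = nome]) simp
    finally show ?thesis
      by (simp add: weber_squares_theta[OF t] k_def)
  qed
  have 2: "weber_f2 t' ^ 2 = k * weber_f1 t ^ 2"
  proof -
    have "theta (t' / 2) t' = theta ((1 / 2) / t) t'"
      using theta_uminus[of "t' / 2" t'] by (simp add: t'_def mult.commute)
    moreover have "- ((1 / 2)\<^sup>2 / t) = t' / 4"
      by (simp add: power2_eq_square t'_def)
    ultimately have "theta (t' / 2) t' * nome (t' / 4) = c * theta (1 / 2) t"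
      using c[OF nz(2)] by (simp only:)
    hence "theta (t' / 2) t' = c * nome (- (t' / 4)) * theta (1 / 2) t"
      by (simp add: nome_minus field_simps)
    hence "weber_f2 t' ^ 2 = c * (nome (t' / 6) * nome (- (t' / 4))) * theta (1 / 2) t"
      by (simp add: weber_squares_theta[OF t'])
    also have "nome (t' / 6) * nome (- (t' / 4)) = nome (t / 12 - t' / 12) * nome (- (t / 12))"
      unfolding nome_add[symmetric] by (rule arg_cong[where f = nome]) simp
    finally show ?thesis
      by (simp add: weber_squares_theta[OF t] k_def)
  qed
  have "(weber_f t' * weber_f1 t' * weber_f2 t')\<^sup>2 = k ^ 3 * (weber_f t * weber_f1 t * weber_f2 t)\<^sup>2"
    unfolding power_mult_distrib 0 1 2 by (simp add: power3_eq_cube)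
  hence "k ^ 3 = 1"
    by (simp add: weber_product[OF t] weber_product[OF t'])
  thus ?thesis
    using 0 1 2 that unfolding t'_def by blast
qed

section \<open>Twelfth powers and their behaviour under the generators\<close>

definition wx0 :: "complex \<Rightarrow> complex" where
  "wx0 \<tau> = weber_u 0 \<tau> ^ 12"

definition wx1 :: "complex \<Rightarrow> complex" where
  "wx1 \<tau> = weber_u 1 \<tau> ^ 12"

definition wx2 :: "complex \<Rightarrow> complex" where
  "wx2 \<tau> = weber_u 2 \<tau> ^ 12"

lemma zeta_16_power_12: "zeta 16 ^ 12 = - \<i>"
proof -
  have "zeta 16 ^ 12 = exp (of_real pi * \<i> + of_real pi * \<i> / 2)"
    unfolding zeta_def exp_of_nat_mult[symmetric] by (rule arg_cong[where f = exp]) simp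
  also have "\<dots> = - \<i>"
    using nome_half by (simp only: exp_add nome_def) simp
  finally show ?thesis .
qed

text \<open>The phases \<open>- \<i>\<close> and \<open>\<i>\<close> come from
  \<open>zeta 16 ^ 12\<close>. They absorb the fourth roots of unity in the transformation of the
  bare twelfth powers, so that only signs remain.\<close>

lemma wx_weber:
  "wx0 z = weber_f z ^ 12" "wx1 z = - \<i> * weber_f1 z ^ 12" "wx2 z = \<i> * weber_f2 z ^ 12"
  by (simp_all add: wx0_def wx1_def wx2_def weber_u_def power_mult_distrib power_inverse zeta_16_power_12)

lemma wx_qprod:
  assumes "Im z > 0"
  shows "wx0 z = nome (- (z / 2)) * qprod (nome z) ((nome z)\<^sup>2) ^ 12"
    "wx1 z = - \<i> * nome (- (z / 2)) * qprod (- nome z) ((nome z)\<^sup>2) ^ 12"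
    "wx2 z = 64 * \<i> * nome z * qprod ((nome z)\<^sup>2) ((nome z)\<^sup>2) ^ 12"
proof -
  have e: "exp (- (of_real pi * \<i> * z / 24)) ^ 12 = nome (- (z / 2))"
    "exp (of_real pi * \<i> * z / 12) ^ 12 = nome z"
    unfolding nome_def exp_of_nat_mult[symmetric] by (rule arg_cong[where f = exp], simp)+
  have "of_real (sqrt 2) ^ 12 = (64 :: complex)"
  proof -
    have "sqrt 2 ^ 12 = (sqrt 2 ^ 2) ^ 6"
      by (simp only: power_mult[symmetric]) simp
    thus ?thesis
      by (simp flip: of_real_power)
  qed
  thus "wx0 z = nome (- (z / 2)) * qprod (nome z) ((nome z)\<^sup>2) ^ 12"
    "wx1 z = - \<i> * nome (- (z / 2)) * qprod (- nome z) ((nome z)\<^sup>2) ^ 12"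
    "wx2 z = 64 * \<i> * nome z * qprod ((nome z)\<^sup>2) ((nome z)\<^sup>2) ^ 12"
    by (simp_all only: wx_weber weber_f_qprod[OF assms] weber_f1_qprod[OF assms] weber_f2_qprod[OF assms]
        power_mult_distrib e) (simp_all)
qed

lemma wx_product:
  assumes "Im z > 0"
  shows "wx0 z * wx1 z * wx2 z = 64"
proof -
  have "wx0 z * wx1 z * wx2 z = (weber_f z * weber_f1 z * weber_f2 z) ^ 12"
    by (simp add: wx_weber power_mult_distrib mult_ac)
  also have "\<dots> = ((of_real (sqrt 2)) ^ 2) ^ 6"
    by (simp add: weber_product[OF assms] flip: power_mult)
  also have "\<dots> = 64"
    by (simp flip: of_real_power)
  finally show ?thesis .
qed

lemma wx_nonzero:
  assumes "Im z > 0"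
  shows "wx0 z \<noteq> 0" "wx1 z \<noteq> 0" "wx2 z \<noteq> 0"
  using wx_product[OF assms] by auto

lemma wx_T:
  assumes "Im z > 0"
  shows "wx0 (z + 1) = wx1 z" "wx1 (z + 1) = - wx0 z" "wx2 (z + 1) = - wx2 z"
proof -
  have "nome (- ((z + 1) / 2)) = - \<i> * nome (- (z / 2))"
    unfolding add_divide_distrib minus_add_distrib nome_add nome_minus[of "1 / 2"] nome_half by simp
  thus "wx0 (z + 1) = wx1 z" "wx1 (z + 1) = - wx0 z" "wx2 (z + 1) = - wx2 z"
    using assms by (simp_all add: wx_qprod nome_add)
qed

text \<open>The relations between squares are raised to the sixth power, where
  \<open>k ^ 6 = 1\<close>.\<close>

lemma wx_S:
  assumes "Im z > 0"
  shows "wx0 (- 1 / z) = wx0 z" "wx1 (- 1 / z) = - wx2 z" "wx2 (- 1 / z) = - wx1 z"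
proof -
  obtain k where k: "k ^ 3 = 1" "weber_f (- 1 / z) ^ 2 = k * weber_f z ^ 2"
    "weber_f1 (- 1 / z) ^ 2 = k * weber_f2 z ^ 2" "weber_f2 (- 1 / z) ^ 2 = k * weber_f1 z ^ 2"
    by (rule weber_inversion[OF assms])
  have p: "a ^ 12 = (a ^ 2) ^ 6" for a :: complex
    by (simp flip: power_mult)
  have "k ^ 6 = (k ^ 3) ^ 2"
    by (simp flip: power_mult)
  hence k6: "k ^ 6 = 1"
    using k by simp
  show "wx0 (- 1 / z) = wx0 z" "wx1 (- 1 / z) = - wx2 z" "wx2 (- 1 / z) = - wx1 z"
    unfolding wx_weber p k by (simp_all add: power_mult_distrib k6)
qed

lemma open_upper_half_plane: "open \<H>"
  by (rule open_halfspace_Im_gt)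

lemma connected_upper_half_plane: "connected \<H>"
  using convex_halfspace_Im_gt[of 0] by (intro convex_connected) 

lemma wx_holomorphic:
  "wx0 holomorphic_on \<H>"
  "wx1 holomorphic_on \<H>"
  "wx2 holomorphic_on \<H>"
proof -
  have *: "norm ((nome z)\<^sup>2) < 1" if "z \<in> \<H>" for z
    using that norm_nome_power_less_1[of z 2] by simp
  have "(\<lambda>t. nome (- (t / 2)) * qprod (nome t) ((nome t)\<^sup>2) ^ 12) holomorphic_on \<H>"
    using * by (intro holomorphic_intros qprod_holomorphic open_upper_half_plane; simp)
  thus "wx0 holomorphic_on \<H>"
    by (rule holomorphic_transform) (simp add: wx_qprod)
  have "(\<lambda>t. - \<i> * nome (- (t / 2)) * qprod (- nome t) ((nome t)\<^sup>2) ^ 12) holomorphic_on \<H>"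
    using * by (intro holomorphic_intros qprod_holomorphic open_upper_half_plane; simp)
  thus "wx1 holomorphic_on \<H>"
    by (rule holomorphic_transform) (simp add: wx_qprod)
  have "(\<lambda>t. 64 * \<i> * nome t * qprod ((nome t)\<^sup>2) ((nome t)\<^sup>2) ^ 12) holomorphic_on \<H>"
    using * by (intro holomorphic_intros qprod_holomorphic open_upper_half_plane; simp)
  thus "wx2 holomorphic_on \<H>"
    by (rule holomorphic_transform) (simp add: wx_qprod)
qed

section \<open>The kernel group\<close>

abbreviation (input) m11 :: "int^2^2 \<Rightarrow> int" where "m11 A \<equiv> A $ 1 $ 1"
abbreviation (input) m12 :: "int^2^2 \<Rightarrow> int" where "m12 A \<equiv> A $ 1 $ 2"
abbreviation (input) m21 :: "int^2^2 \<Rightarrow> int" where "m21 A \<equiv> A $ 2 $ 1"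
abbreviation (input) m22 :: "int^2^2 \<Rightarrow> int" where "m22 A \<equiv> A $ 2 $ 2"

section \<open>Integer matrices, their action and generators of the modular group\<close>

lemma matrix_mult_entries:
  "m11 (A ** B) = m11 A * m11 B + m12 A * m21 B" "m12 (A ** B) = m11 A * m12 B + m12 A * m22 B"
  "m21 (A ** B) = m21 A * m11 B + m22 A * m21 B" "m22 (A ** B) = m21 A * m12 B + m22 A * m22 B"
  by (simp_all add: matrix_matrix_mult_def sum_2)

lemma vector2_neq_0:
  assumes "Im z > 0" "c \<noteq> 0 \<or> d \<noteq> 0"
  shows "of_int c * z + of_int d \<noteq> 0"
proof
  assume "of_int c * z + of_int d = 0"
  hence "Im (of_int c * z + of_int d) = 0" "Re (of_int c * z + of_int d) = 0"
    by simp_all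
  thus False
    using assms by auto
qed

lemma SL2Z_iff: "A \<in> SL2 \<longleftrightarrow> m11 A * m22 A - m12 A * m21 A = 1"
  by (simp add: SL2Z_def det_2)

lemma moebius_denom_neq_0:
  assumes "A \<in> SL2" "Im z > 0"
  shows "of_int (m21 A) * z + of_int (m22 A) \<noteq> 0"
  using assms by (intro vector2_neq_0) (auto simp: SL2Z_iff)

lemma Im_moebius_act:
  assumes "A \<in> SL2"
  shows "Im (act A z) = Im z / (norm (of_int (m21 A) * z + of_int (m22 A)))\<^sup>2"
proof -
  let ?a = "real_of_int (m11 A)" and ?b = "real_of_int (m12 A)"
    and ?c = "real_of_int (m21 A)" and ?d = "real_of_int (m22 A)"
  have "real_of_int (m11 A * m22 A - m12 A * m21 A) = 1"
    using assms by (simp only: SL2Z_iff of_int_1)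
  hence det: "?a * ?d - ?b * ?c = 1"
    by simp
  have "Im (act A z) = ((?a * ?d - ?b * ?c) * Im z) / (norm (of_int (m21 A) * z + of_int (m22 A)))\<^sup>2"
    unfolding moebius_act_def Im_divide cmod_power2 by (simp add: algebra_simps)
  thus ?thesis
    by (simp add: det)
qed

lemma moebius_act_upper:
  assumes "A \<in> SL2" "Im z > 0"
  shows "Im (act A z) > 0"
  using assms moebius_denom_neq_0[OF assms] by (simp add: Im_moebius_act)

lemma SL2Z_mult: "A \<in> SL2 \<Longrightarrow> B \<in> SL2 \<Longrightarrow> A ** B \<in> SL2"
  by (simp add: SL2Z_def det_mul)

lemma moebius_act_mult:
  assumes "A \<in> SL2" "B \<in> SL2" "Im z > 0"
  shows "act (A ** B) z = act A (act B z)"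
proof -
  define u v where "u = of_int (m11 B) * z + of_int (m12 B)" and "v = of_int (m21 B) * z + of_int (m22 B)"
  have v: "v \<noteq> 0"
    unfolding v_def using moebius_denom_neq_0 assms by blast
  have eq: "of_int a * (u / v) + of_int b = (of_int a * u + of_int b * v) / v" for a b
    using v by (simp add: field_simps)
  have "act A (act B z) =
      (of_int (m11 A) * u + of_int (m12 A) * v) / (of_int (m21 A) * u + of_int (m22 A) * v)"
    unfolding moebius_act_def[of B] u_def[symmetric] v_def[symmetric]
    unfolding moebius_act_def eq using v by simp
  also have "\<dots> = act (A ** B) z"
    unfolding moebius_act_def by (rule arg_cong2[where f = divide]) (simp_all add: matrix_mult_entries u_def v_def algebra_simps)
  finally show ?thesis ..
qed

lemma moebius_act_one [simp]: "act (mat 1) z = z"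
  by (simp add: moebius_act_def mat_def)

lemma moebius_act_uminus [simp]: "act (- A) z = act A z"
proof -
  have "act (- A) z = - (of_int (m11 A) * z + of_int (m12 A)) /
      - (of_int (m21 A) * z + of_int (m22 A))"
    by (simp add: moebius_act_def)
  thus ?thesis
    by (simp only: moebius_act_def minus_divide_divide)
qed

definition mat2 :: "int \<Rightarrow> int \<Rightarrow> int \<Rightarrow> int \<Rightarrow> int^2^2" where
  "mat2 a b c d = vector [vector [a, b], vector [c, d]]"

lemma mat2_nth [simp]:
  "m11 (mat2 a b c d) = a" "m12 (mat2 a b c d) = b"
  "m21 (mat2 a b c d) = c" "m22 (mat2 a b c d) = d"
  by (simp_all add: mat2_def)

lemma mat2_eqI:
  fixes A B :: "int^2^2"
  assumes "m11 A = m11 B" "m12 A = m12 B" "m21 A = m21 B" "m22 A = m22 B"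
  shows "A = B"
  using assms by (simp add: vec_eq_iff forall_2)

lemma mat2_SL2Z [simp]: "mat2 a b c d \<in> SL2 \<longleftrightarrow> a * d - b * c = 1"
  by (simp add: SL2Z_iff)

lemma one_SL2Z [simp]: "mat 1 \<in> SL2"
  by (simp add: SL2Z_def)

definition matS :: "int^2^2" where "matS = mat2 0 (- 1) 1 0"
definition matT :: "int \<Rightarrow> int^2^2" where "matT k = mat2 1 k 0 1"

lemma matS_SL2Z [simp]: "matS \<in> SL2" and matT_SL2Z [simp]: "matT k \<in> SL2"
  by (simp_all add: matS_def matT_def)

lemma moebius_act_S: "act matS z = - 1 / z"
  and moebius_act_T: "act (matT k) z = z + of_int k"
  by (simp_all add: matS_def matT_def moebius_act_def)

lemma SL2Z_inverse:
  assumes "A \<in> SL2"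
  obtains B where "B \<in> SL2" "A ** B = mat 1" "B ** A = mat 1"
proof (rule that[of "mat2 (m22 A) (- m12 A) (- m21 A) (m11 A)"])
  let ?B = "mat2 (m22 A) (- m12 A) (- m21 A) (m11 A)"
  show "?B \<in> SL2" "A ** ?B = mat 1" "?B ** A = mat 1"
    using assms
    by (auto simp: SL2Z_iff matrix_mult_entries mat_def algebra_simps intro!: mat2_eqI)
qed

text \<open>Euclid's algorithm on the lower row: right multiplication by a power of \<open>T\<close>
  and by \<open>S\<close> replaces the lower left entry by a remainder. Both \<open>T\<close> and
  its inverse occur because the induction builds words from the generators.\<close>

lemma SL2Z_induct [consumes 1, case_names one S T T']:
  assumes "A \<in> SL2"
    and one: "P (mat 1)"
    and S: "\<And>A. A \<in> SL2 \<Longrightarrow> P A \<Longrightarrow> P (A ** matS)"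
    and T: "\<And>A. A \<in> SL2 \<Longrightarrow> P A \<Longrightarrow> P (A ** matT 1)"
    and T': "\<And>A. A \<in> SL2 \<Longrightarrow> P A \<Longrightarrow> P (A ** matT (- 1))"
  shows "P A"
proof -
  have mm: "A ** matT k ** matT l = A ** matT (k + l)" for A :: "int^2^2" and k l
    by (rule mat2_eqI) (simp_all add: matT_def matrix_mult_entries algebra_simps)
  have T0: "A ** matT 0 = A" for A :: "int^2^2"
    by (rule mat2_eqI) (simp_all add: matT_def matrix_mult_entries)
  have Tk: "P (A ** matT k)" if "A \<in> SL2" "P A" for A k
  proof (induction k rule: int_induct[where k = 0])
    case base
    show ?case using that by (simp add: T0)
  next
    case (step1 i)
    show ?case
      using T[OF _ step1(2)] that by (simp add: mm SL2Z_mult)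
  next
    case (step2 i)
    show ?case
      using T'[OF _ step2(2)] that by (simp add: mm SL2Z_mult)
  qed
  show ?thesis
    using assms(1)
  proof (induction "nat \<bar>m21 A\<bar>" arbitrary: A rule: less_induct)
    case less
    show ?case
    proof (cases "m21 A = 0")
      case True
      hence ad: "m11 A * m22 A = 1"
        using less.prems by (simp add: SL2Z_iff)
      hence "m11 A = 1 \<and> m22 A = 1 \<or> m11 A = - 1 \<and> m22 A = - 1"
        by (auto simp: zmult_eq_1_iff)
      thus ?thesis
      proof
        assume *: "m11 A = 1 \<and> m22 A = 1"
        have "A = mat 1 ** matT (m12 A)"
          by (rule mat2_eqI) (use True * in \<open>simp_all add: matT_def\<close>)
        thus ?thesis
          using Tk[OF one_SL2Z one] by metis
      next
        assume *: "m11 A = - 1 \<and> m22 A = - 1"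
        \<comment> \<open>\<open>S\<close> squared is \<open>- mat 1\<close>, which accounts for the
          diagonal \<open>- 1\<close>.\<close>
        have "A = mat 1 ** matS ** matS ** matT (- m12 A)"
          by (rule mat2_eqI) (use True * in \<open>simp_all add: matT_def matS_def matrix_mult_entries\<close>)
        moreover have "P (mat 1 ** matS ** matS ** matT (- m12 A))"
          by (intro Tk S one SL2Z_mult one_SL2Z matS_SL2Z)
        ultimately show ?thesis
          by simp
      qed
    next
      case False
      define k where "k = - (m22 A div m21 A)"
      define B where "B = A ** matT k ** matS"
      have B: "B \<in> SL2"
        unfolding B_def by (intro SL2Z_mult less.prems matT_SL2Z matS_SL2Z)
      have "m21 B = m22 A + k * m21 A"
        by (simp add: B_def matT_def matS_def matrix_mult_entries)
      also have "\<dots> = m22 A mod m21 A"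
        by (simp add: k_def minus_div_mult_eq_mod)
      finally have "\<bar>m21 B\<bar> < \<bar>m21 A\<bar>"
        using abs_mod_less[OF False] by simp
      hence "P B"
        using less.hyps[of B] B by simp
      \<comment> \<open>The fourth power of \<open>S\<close> is the identity, so three further
        factors \<open>matS\<close> undo the one contained in \<open>B\<close>.\<close>
      hence "P (B ** matS ** matS ** matS ** matT (- k))"
        by (intro Tk S B SL2Z_mult matS_SL2Z)
      also have "B ** matS ** matS ** matS ** matT (- k) = A"
        by (rule mat2_eqI) (simp_all add: B_def matT_def matS_def matrix_mult_entries)
      finally show ?thesis .
    qed
  qed
qed

text \<open>The cusps of \<open>\<Gamma>(4)\<close> correspond to the primitive vectors modulo 4 up to sign, and up to the
  sign character of \<open>PSL\<^sub>2(\<int>)\<close> the functions \<open>\<plusminus>wx0\<close>, \<open>\<plusminus>wx1\<close>, \<open>\<plusminus>wx2\<close> are permuted in the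
  same way as these six cusps.\<close>

definition wcusp :: "int \<Rightarrow> int \<Rightarrow> complex \<Rightarrow> complex" where
  "wcusp c d \<tau> =
    (if even c then if even d then 0 else if c mod 4 = 0 then wx2 \<tau> else - wx2 \<tau>
     else if even d then if d mod 4 = 0 then wx1 \<tau> else - wx1 \<tau>
     else if c mod 4 = d mod 4 then wx0 \<tau> else - wx0 \<tau>)"

lemma wcusp_simps [simp]: "wcusp 0 1 = wx2" "wcusp 1 0 = wx1" "wcusp 1 1 = wx0"
  by (auto simp: wcusp_def fun_eq_iff)

lemma wcusp_cong:
  assumes "c mod 4 = c' mod 4" "d mod 4 = d' mod 4"
  shows "wcusp c d = wcusp c' d'"
proof -
  have "even c \<longleftrightarrow> even c'" "even d \<longleftrightarrow> even d'"
    using assms by presburger+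
  thus ?thesis
    by (intro ext) (simp only: wcusp_def assms)
qed

lemma mod_4_cases: "c mod 4 \<in> {0, 1, 2, 3}" for c :: int
  by (simp; presburger)

text \<open>Both sides depend only on residues modulo 4, so sixteen pairs are checked. The value 0
  at pairs of even numbers lets the relation hold for all pairs, not just the primitive
  ones.\<close>

lemma wcusp_S:
  assumes "Im z > 0"
  shows "wcusp c d (- 1 / z) = - wcusp d (- c) z"
proof -
  have "\<forall>r\<in>{0,1,2,3}. \<forall>s\<in>{0,1,2,3}. wcusp r s (- 1 / z) = - wcusp s (- r) z"
    using assms by (simp add: wcusp_def wx_S[simplified])
  from bspec[OF bspec[OF this mod_4_cases[of c]] mod_4_cases[of d]] have "wcusp (c mod 4) (d mod 4) (- 1 / z) = - wcusp (d mod 4) (- (c mod 4)) z" .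
  moreover have "wcusp (c mod 4) (d mod 4) = wcusp c d" "wcusp (d mod 4) (- (c mod 4)) = wcusp d (- c)"
    by (rule wcusp_cong; simp add: mod_minus_eq)+
  ultimately show ?thesis
    by (simp only:)
qed

lemma wcusp_T:
  assumes "Im z > 0"
  shows "wcusp c d (z + 1) = - wcusp c (c + d) z"
proof -
  have "\<forall>r\<in>{0,1,2,3}. \<forall>s\<in>{0,1,2,3}. wcusp r s (z + 1) = - wcusp r (r + s) z"
    using assms by (simp add: wcusp_def wx_T)
  from bspec[OF bspec[OF this mod_4_cases[of c]] mod_4_cases[of d]] have "wcusp (c mod 4) (d mod 4) (z + 1) = - wcusp (c mod 4) (c mod 4 + d mod 4) z" .
  moreover have "wcusp (c mod 4) (d mod 4) = wcusp c d" "wcusp (c mod 4) (c mod 4 + d mod 4) = wcusp c (c + d)"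
    by (rule wcusp_cong; simp add: mod_add_eq)+
  ultimately show ?thesis
    by (simp only:)
qed

text \<open>The pair \<open>(c, d)\<close> is a row vector multiplied by \<open>A\<close> from the
  right, so the rule is compatible with matrix products while the signs multiply. The sign depends
  on \<open>A\<close> alone, not on the pair or on \<open>z\<close>.\<close>

lemma wcusp_moebius:
  assumes "A \<in> SL2"
  obtains s :: complex where "s = 1 \<or> s = - 1"
    "\<And>c d z. Im z > 0 \<Longrightarrow> wcusp c d (act A z) =
       s * wcusp (c * m11 A + d * m21 A) (c * m12 A + d * m22 A) z"
proof -
  define Q where "Q = (\<lambda>A. \<exists>s :: complex. (s = 1 \<or> s = - 1) \<and> (\<forall>c d z. Im z > 0 \<longrightarrow>
    wcusp c d (act A z) = s * wcusp (c * m11 A + d * m21 A) (c * m12 A + d * m22 A) z))"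
  have mult: "Q (A ** B)" if "A \<in> SL2" "Q A" "B \<in> SL2" "Q B" for A B
  proof -
    from \<open>Q A\<close> obtain s where s: "s = 1 \<or> s = - 1" "\<And>c d z. Im z > 0 \<Longrightarrow>
      wcusp c d (act A z) = s * wcusp (c * m11 A + d * m21 A) (c * m12 A + d * m22 A) z"
      unfolding Q_def by blast
    from \<open>Q B\<close> obtain t where t: "t = 1 \<or> t = - 1" "\<And>c d z. Im z > 0 \<Longrightarrow>
      wcusp c d (act B z) = t * wcusp (c * m11 B + d * m21 B) (c * m12 B + d * m22 B) z"
      unfolding Q_def by blast
    show ?thesis
      unfolding Q_def
    proof (intro exI[of _ "s * t"] conjI allI impI)
      show "s * t = 1 \<or> s * t = - 1"
        using s(1) t(1) by auto
      fix c d :: int and z :: complex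
      assume z: "Im z > 0"
      have "wcusp c d (act (A ** B) z) = wcusp c d (act A (act B z))"
        using that z by (simp add: moebius_act_mult)
      also have "\<dots> = s * (t * wcusp ((c * m11 A + d * m21 A) * m11 B + (c * m12 A + d * m22 A) * m21 B)
         ((c * m11 A + d * m21 A) * m12 B + (c * m12 A + d * m22 A) * m22 B) z)"
        using z that by (simp only: s t moebius_act_upper)
      finally show "wcusp c d (act (A ** B) z) = s * t * wcusp (c * m11 (A ** B) + d * m21 (A ** B))
          (c * m12 (A ** B) + d * m22 (A ** B)) z"
        by (simp add: matrix_mult_entries algebra_simps)
    qed
  qed
  have "Q A"
    using assms
  proof (induction rule: SL2Z_induct)
    case one
    show ?case
      unfolding Q_def moebius_act_one by (intro exI[of _ 1]) (simp add: mat_def)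
  next
    case (S A)
    have "Q matS"
      unfolding Q_def moebius_act_S by (intro exI[of _ "- 1"]) (simp add: wcusp_S[simplified] matS_def)
    with S show ?case by (intro mult) auto
  next
    case (T A)
    have "Q (matT 1)"
      unfolding Q_def moebius_act_T by (intro exI[of _ "- 1"]) (simp add: wcusp_T matT_def)
    with T show ?case by (intro mult) auto
  next
    case (T' A)
    have "wcusp c d (z - 1) = - wcusp c (d - c) z" if "Im z > 0" for c d z
      using wcusp_T[of "z - 1" c "d - c"] that by simp
    hence "Q (matT (- 1))"
      unfolding Q_def moebius_act_T by (intro exI[of _ "- 1"]) (simp add: matT_def)
    with T' show ?case by (intro mult) auto
  qed
  thus ?thesis
    unfolding Q_def using that by blast
qed

text \<open>The shift by 2 negates \<open>wx0\<close> and \<open>wx1\<close> and fixes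
  \<open>wx2\<close>, which isolates the last coefficient. The inversion then exchanges
  \<open>wx1\<close> and \<open>wx2\<close> up to sign, and the same shift separates the other
  two.\<close>

lemma wx_linear_independent:
  assumes "\<And>z. Im z > 0 \<Longrightarrow> a * wx0 z + b * wx1 z + c * wx2 z = 0"
  shows "a = 0" "b = 0" "c = 0"
proof -
  have T2: "wx0 (z + 2) = - wx0 z" "wx1 (z + 2) = - wx1 z" "wx2 (z + 2) = wx2 z" if "Im z > 0" for z
    using wx_T[of z] wx_T[of "z + 1"] that by (simp_all add: add_ac)
  have c: "c * wx2 z = 0" if "Im z > 0" for z
  proof -
    have "(a * wx0 z + b * wx1 z + c * wx2 z) + (a * wx0 (z + 2) + b * wx1 (z + 2) + c * wx2 (z + 2)) = 0"
      using that by (subst (1 2) assms) auto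
    thus ?thesis
      using that by (simp add: T2)
  qed
  show "c = 0"
    using c[of \<i>] wx_nonzero[of \<i>] by simp
  have ab: "a * wx0 z - b * wx2 z = 0" if "Im z > 0" for z
  proof -
    have "Im (- 1 / z) > 0"
      using moebius_act_upper[OF matS_SL2Z that] by (simp only: moebius_act_S)
    thus ?thesis
      using assms[of "- 1 / z"] that \<open>c = 0\<close> by (simp add: wx_S[simplified])
  qed
  have "a * wx0 z = 0" "b * wx2 z = 0" if "Im z > 0" for z
    using ab[of z] ab[of "z + 2"] that by (simp_all add: T2)
  from this[of \<i>] show "a = 0" "b = 0"
    using wx_nonzero[of \<i>] by simp_all
qed

lemma mod_add_eq_iff:
  fixes m p q r t :: int
  assumes "r mod m = q mod m"
  shows "(p + r) mod m = (q + t) mod m \<longleftrightarrow> p mod m = t mod m"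
  using mod_diff_cong[of "p + r" m "q + t" r q] mod_add_cong[of p m t r q] assms
  by (auto simp: add.commute)

text \<open>The right-hand side describes the matrices congruent to plus or minus the identity
  modulo 4. Necessity reads off residues of the rows by linear independence; for sufficiency only
  the sign has to be determined.\<close>

lemma wx_invariant_iff:
  assumes A: "A \<in> SL2"
  shows "(\<forall>z. Im z > 0 \<longrightarrow> wx0 (act A z) = wx0 z \<and> wx1 (act A z) = wx1 z
      \<and> wx2 (act A z) = wx2 z) \<longleftrightarrow>
    m12 A mod 4 = 0 \<and> m21 A mod 4 = 0 \<and> odd (m11 A) \<and> m11 A mod 4 = m22 A mod 4"
    (is "?L = ?R")
proof -
  define p q r t where "p = m11 A" and "q = m12 A" and "r = m21 A" and "t = m22 A"
  note defs = p_def[symmetric] q_def[symmetric] r_def[symmetric] t_def[symmetric]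
  have det: "p * t - q * r = 1"
    using A by (simp add: SL2Z_iff defs)
  obtain s :: complex where s: "s = 1 \<or> s = - 1" and
    wcusp: "\<And>c d z. Im z > 0 \<Longrightarrow> wcusp c d (act A z) = s * wcusp (c * p + d * r) (c * q + d * t) z"
    using wcusp_moebius[OF A] unfolding defs by metis
  have Y: "wx2 (act A z) = s * wcusp r t z" "wx1 (act A z) = s * wcusp p q z"
    "wx0 (act A z) = s * wcusp (p + r) (q + t) z" if "Im z > 0" for z
    using wcusp[OF that, of 0 1] wcusp[OF that, of 1 0] wcusp[OF that, of 1 1] by simp_all
  show ?thesis
    unfolding defs
  proof
    assume R: "q mod 4 = 0 \<and> r mod 4 = 0 \<and> odd p \<and> p mod 4 = t mod 4"
    have e: "wcusp r t = wx2" "wcusp p q = wx1" "wcusp (p + r) (q + t) = wx0"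
    proof -
      have "q mod 4 = 0" "r mod 4 = 0" "odd p" "p mod 4 = t mod 4"
        using R by auto
      hence "even q" "even r" "odd t" "(p + r) mod 4 = (q + t) mod 4"
        by (presburger, presburger, presburger, simp add: mod_add_eq_iff)
      thus "wcusp r t = wx2" "wcusp p q = wx1" "wcusp (p + r) (q + t) = wx0"
        using R by (simp_all add: wcusp_def fun_eq_iff)
    qed
    \<comment> \<open>All three functions are multiplied by the same \<open>s\<close>, while their
      product is 64 both at \<open>\<i>\<close> and at its image. A sign is determined by its
      cube.\<close>
    have "s ^ 3 * 64 = 64"
    proof -
      have i: "Im (act A \<i>) > 0"
        by (rule moebius_act_upper[OF A]) simp
      have "64 = s ^ 3 * (wx0 \<i> * wx1 \<i> * wx2 \<i>)"
        unfolding wx_product[OF i, symmetric] by (simp add: Y e power3_eq_cube)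
      thus ?thesis
        by (simp add: wx_product)
    qed
    hence "s = 1"
      using s by auto
    thus "\<forall>z. Im z > 0 \<longrightarrow> wx0 (act A z) = wx0 z \<and> wx1 (act A z) = wx1 z
      \<and> wx2 (act A z) = wx2 z"
      by (simp add: Y e)
  next
    assume "\<forall>z. Im z > 0 \<longrightarrow> wx0 (act A z) = wx0 z \<and> wx1 (act A z) = wx1 z
      \<and> wx2 (act A z) = wx2 z"
    hence L: "s * wcusp r t z = wx2 z" "s * wcusp p q z = wx1 z" "s * wcusp (p + r) (q + t) z = wx0 z" if "Im z > 0" for z
      using that Y by auto
    have ss: "s * s = 1"
      using s by auto
    have L': "wcusp r t z = s * wx2 z" "wcusp p q z = s * wx1 z" "wcusp (p + r) (q + t) z = s * wx0 z" if "Im z > 0" for z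
      using L[OF that, symmetric] ss by (simp_all add: mult.assoc[symmetric])
    have s0: "s \<noteq> 0"
      using s by auto
    \<comment> \<open>Written as a linear combination with coefficients given by residues,
      \<open>wcusp\<close> becomes accessible to \<open>wx_linear_independent\<close>.\<close>
    have wYe: "\<exists>a b e. (\<forall>z. wcusp c d z = a * wx0 z + b * wx1 z + e * wx2 z) \<and>
        (a = (if odd c \<and> odd d then if c mod 4 = d mod 4 then 1 else - 1 else 0)) \<and>
        (b = (if odd c \<and> even d then if d mod 4 = 0 then 1 else - 1 else 0)) \<and>
        (e = (if even c \<and> odd d then if c mod 4 = 0 then 1 else - 1 else 0))" for c d
      by (auto simp: wcusp_def)
    have c2: "even r \<and> odd t \<and> s = (if r mod 4 = 0 then 1 else - 1)"
    proof -
      obtain a b e where w: "\<And>z. wcusp r t z = a * wx0 z + b * wx1 z + e * wx2 z" and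
        abe: "e = (if even r \<and> odd t then if r mod 4 = 0 then 1 else - 1 else 0)"
        using wYe[of r t] by blast
      have "a * wx0 z + b * wx1 z + (e - s) * wx2 z = 0" if "Im z > 0" for z
        using L'(1)[OF that] by (simp add: w algebra_simps)
      from wx_linear_independent(3)[OF this] show ?thesis
        using s0 by (auto simp: abe split: if_splits)
    qed
    have c1: "odd p \<and> even q \<and> s = (if q mod 4 = 0 then 1 else - 1)"
    proof -
      obtain a b e where w: "\<And>z. wcusp p q z = a * wx0 z + b * wx1 z + e * wx2 z" and
        abe: "b = (if odd p \<and> even q then if q mod 4 = 0 then 1 else - 1 else 0)"
        using wYe[of p q] by blast
      have "a * wx0 z + (b - s) * wx1 z + e * wx2 z = 0" if "Im z > 0" for z
        using L'(2)[OF that] by (simp add: w algebra_simps)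
      from wx_linear_independent(2)[OF this] show ?thesis
        using s0 by (auto simp: abe split: if_splits)
    qed
    have c0: "s = (if (p + r) mod 4 = (q + t) mod 4 then 1 else - 1)"
    proof -
      obtain a b e where w: "\<And>z. wcusp (p + r) (q + t) z = a * wx0 z + b * wx1 z + e * wx2 z" and
        abe: "a = (if odd (p + r) \<and> odd (q + t) then if (p + r) mod 4 = (q + t) mod 4 then 1 else - 1 else 0)"
        using wYe[of "p + r" "q + t"] by blast
      have "(a - s) * wx0 z + b * wx1 z + e * wx2 z = 0" if "Im z > 0" for z
        using L'(3)[OF that] by (simp add: w algebra_simps)
      from wx_linear_independent(1)[OF this] show ?thesis
        using s0 by (auto simp: abe split: if_splits)
    qed
    \<comment> \<open>For \<open>s = - 1\<close> the off-diagonal entries would be 2 and the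
      diagonal entries 1 and 3 in some order modulo 4, so the determinant would be 3 modulo
      4.\<close>
    have "s \<noteq> - 1"
    proof
      assume "s = - 1"
      hence m: "r mod 4 \<noteq> 0" "q mod 4 \<noteq> 0" "(p + r) mod 4 \<noteq> (q + t) mod 4"
        using c0 c1 c2 by (auto split: if_splits)
      have rq: "r mod 4 = 2" "q mod 4 = 2"
        using m(1) m(2) conjunct1[OF c2] conjunct1[OF conjunct2[OF c1]] by presburger+
      hence "p mod 4 \<noteq> t mod 4"
        using m(3) by (simp add: mod_add_eq_iff)
      hence "(p mod 4 = 1 \<and> t mod 4 = 3) \<or> (p mod 4 = 3 \<and> t mod 4 = 1)"
        using conjunct1[OF c1] conjunct1[OF conjunct2[OF c2]] by presburger
      moreover note rq
      moreover have "(p * t - q * r) mod 4 = ((p mod 4) * (t mod 4) - (q mod 4) * (r mod 4)) mod 4"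
        by (intro mod_diff_cong mod_mult_cong) simp_all
      ultimately have "(p * t - q * r) mod 4 = 3"
        by auto
      thus False
        by (simp add: det)
    qed
    hence "r mod 4 = 0" "q mod 4 = 0" "(p + r) mod 4 = (q + t) mod 4"
      using s c0 c1 c2 by (auto split: if_splits)
    moreover from this have "p mod 4 = t mod 4"
      by (simp add: mod_add_eq_iff)
    ultimately show "q mod 4 = 0 \<and> r mod 4 = 0 \<and> odd p \<and> p mod 4 = t mod 4"
      using c1 by auto
  qed
qed

section \<open>Cosets of plus or minus the identity and the kernel\<close>

lemma PSL2Z_coset: "{mat 1, - mat 1} #>\<^bsub>SL2Z\<^esub> A = {A, - A}"
proof -
  have "- mat 1 ** A = - A"
    by (rule mat2_eqI) (simp_all add: matrix_mult_entries mat_def)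
  thus ?thesis
    by (auto simp: r_coset_def SL2Z_def)
qed

lemma carrier_PSL2Z: "carrier PSL2Z = (\<lambda>A. {A, - A}) ` SL2"
  by (auto simp: PSL2Z_def FactGroup_def RCOSETS_def PSL2Z_coset)

abbreviation (input) \<Gamma>4 :: "(int^2^2) set set" where
  "\<Gamma>4 \<equiv> principal_congruence_PSL2Z 4"

lemma weber_kernel_2: "weber_kernel 2 = \<Gamma>4"
proof (intro equalityI subsetI)
  fix g assume g: "g \<in> weber_kernel 2"
  then obtain A where A: "A \<in> SL2" "g = {A, - A}"
    by (auto simp: weber_kernel_def carrier_PSL2Z)
  have "\<forall>z. Im z > 0 \<longrightarrow> wx0 (act A z) = wx0 z \<and> wx1 (act A z) = wx1 z
      \<and> wx2 (act A z) = wx2 z"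
    using g A(2) by (auto simp: weber_kernel_def wx0_def wx1_def wx2_def)
  hence R: "m12 A mod 4 = 0" "m21 A mod 4 = 0" "odd (m11 A)" "m11 A mod 4 = m22 A mod 4"
    using wx_invariant_iff[OF A(1)] by blast+
  have mA: "- A \<in> SL2"
    using A(1) by (simp add: SL2Z_iff)
  have "m11 A mod 4 = 1 \<or> m11 A mod 4 = 3"
    using R(3) by presburger
  \<comment> \<open>Passing to \<open>- A\<close>, which represents the same \<open>g\<close>, turns
    the diagonal residue 3 into 1.\<close>
  hence "A \<in> principal_congruence_SL2Z 4 \<or> - A \<in> principal_congruence_SL2Z 4"
  proof
    assume "m11 A mod 4 = 1"
    thus ?thesis
      using R A(1) by (auto simp: principal_congruence_SL2Z_def forall_2 cong_def mat_def)
  next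
    assume "m11 A mod 4 = 3"
    hence "(- (m11 A)) mod 4 = 1" "(- (m22 A)) mod 4 = 1" "(- (m12 A)) mod 4 = 0" "(- (m21 A)) mod 4 = 0"
      using R by presburger+
    thus ?thesis
      using mA by (auto simp: principal_congruence_SL2Z_def forall_2 cong_def mat_def)
  qed
  thus "g \<in> \<Gamma>4"
    unfolding principal_congruence_PSL2Z_def PSL2Z_coset A(2)
    by (metis (no_types, lifting) image_eqI insert_commute minus_minus)
next
  fix g assume "g \<in> \<Gamma>4"
  then obtain A where A: "A \<in> principal_congruence_SL2Z 4" "g = {A, - A}"
    by (auto simp: principal_congruence_PSL2Z_def PSL2Z_coset)
  hence A': "A \<in> SL2"
    by (simp add: principal_congruence_SL2Z_def)
  have c: "m11 A mod 4 = 1" "m12 A mod 4 = 0" "m21 A mod 4 = 0" "m22 A mod 4 = 1"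
    using A(1) by (simp_all add: principal_congruence_SL2Z_def forall_2 cong_def mat_def)
  hence "odd (m11 A)"
    by presburger
  hence "\<forall>z. Im z > 0 \<longrightarrow> wx0 (act A z) = wx0 z \<and> wx1 (act A z) = wx1 z
      \<and> wx2 (act A z) = wx2 z"
    using wx_invariant_iff[OF A'] c by simp
  thus "g \<in> weber_kernel 2"
    using A' by (auto simp: weber_kernel_def carrier_PSL2Z wx0_def wx1_def wx2_def A(2))
qed

section \<open>Modular functions of level one\<close>

text \<open>The neighbourhoods of \<open>\<i>\<infinity>\<close>, uniform in the real part.\<close>

definition cusp :: "complex filter" where
  "cusp = filtercomap Im at_top"

lemma eventually_cusp: "eventually P cusp \<longleftrightarrow> (\<exists>y. \<forall>z. Im z > y \<longrightarrow> P z)"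
  by (simp add: cusp_def eventually_filtercomap_at_top_dense)

lemma eventually_cusp_gt: "eventually (\<lambda>z. Im z > y) cusp"
  unfolding eventually_cusp by blast

lemma nome_tendsto_cusp: "((\<lambda>z. nome z) \<longlongrightarrow> 0) cusp"
proof -
  have "filterlim Im at_top cusp"
    unfolding cusp_def by (rule filterlim_filtercomap)
  moreover have "((\<lambda>x. exp (- pi * x)) \<longlongrightarrow> 0) at_top"
    by real_asymp
  ultimately have "((\<lambda>z. exp (- pi * Im z)) \<longlongrightarrow> 0) cusp"
    by (rule filterlim_compose[rotated])
  thus ?thesis
    by (subst tendsto_norm_zero_iff[symmetric]) (simp add: norm_nome)
qed

lemma cusp_not_bot: "cusp \<noteq> bot"
proof
  assume "cusp = bot"
  hence "eventually (\<lambda>_. False) cusp"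
    by simp
  then obtain y where "\<And>z :: complex. \<not> Im z > y"
    unfolding eventually_cusp by blast
  from this[of "\<i> * of_real (y + 1)"] show False
    by simp
qed

lemma holomorphic_on_ball_isCont: "f holomorphic_on ball 0 1 \<Longrightarrow> isCont f 0"
  by (intro field_differentiable_imp_continuous_at holomorphic_on_imp_differentiable_at[of _ "ball 0 1"]) auto

text \<open>Two branches of the logarithm, slit along opposite rays, cover the punctured disc;
  period 1 makes them define one function \<open>F\<close>. Boundedness near the cusp makes 0 a
  removable singularity.\<close>

lemma q_expansion:
  assumes hol: "c holomorphic_on \<H>"
    and per: "\<And>t. Im t > 0 \<Longrightarrow> c (t + 1) = c t"
    and bdd: "eventually (\<lambda>t. norm (c t) \<le> B) cusp"
  obtains g where "g holomorphic_on ball 0 1" "\<And>t. Im t > 0 \<Longrightarrow> c t = g ((nome t)\<^sup>2)"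
proof -
  have eq: "c t = c t'" if "nome (2 * t) = nome (2 * t')" "Im t > 0" "Im t' > 0" for t t'
  proof -
    define c' where "c' = (\<lambda>t. if Im t > 0 then c t else 0)"
    have "c' (z + 1) = c' z" for z
      using per by (auto simp: c'_def)
    note per' = int_multiple_period[of c' 1, OF this]
    from that(1) obtain n where n: "of_real pi * \<i> * (2 * t) = of_real pi * \<i> * (2 * t') + (of_int (2 * n) * pi) * \<i>"
      unfolding nome_def exp_eq by blast
    have "(2 * of_real pi * \<i>) * t = (2 * of_real pi * \<i>) * (t' + of_int n * 1)"
      using n by (simp add: algebra_simps)
    hence "t = t' + of_int n * 1"
      by (subst (asm) mult_cancel_left) simp
    hence "c' t = c' t'"
      using per' by metis
    thus ?thesis
      using that by (simp add: c'_def)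
  qed
  define L where "L = (\<lambda>w. Ln w / (2 * of_real pi * \<i>))"
  \<comment> \<open>This branch is slit along the nonnegative reals; the summand
    \<open>1 / 2\<close> compensates for the sign inside \<open>Ln\<close>.\<close>
  define L' where "L' = (\<lambda>w. Ln (- w) / (2 * of_real pi * \<i>) + 1 / 2)"
  define F where "F = (\<lambda>w. c (L w))"
  have nome_L: "nome (2 * L w) = w" if "w \<noteq> 0" for w
    using that by (simp add: nome_def L_def)
  have nome_L': "nome (2 * L' w) = w" if "w \<noteq> 0" for w
  proof -
    have "nome (2 * L' w) = nome (2 * (Ln (- w) / (2 * of_real pi * \<i>))) * nome 1"
      unfolding nome_add[symmetric] by (simp add: L'_def ring_distribs)
    thus ?thesis
      using that by (simp add: nome_def)
  qed
  have Im_L: "Im (L w) = - ln (norm w) / (2 * pi)" "Im (L' w) = - ln (norm w) / (2 * pi)" if "w \<noteq> 0" for w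
    using that by (simp_all add: L_def L'_def Im_divide power2_eq_square field_simps)
  have Im_L_pos: "Im (L w) > 0" "Im (L' w) > 0" if "w \<in> ball 0 1 - {0}" for w
    using that by (auto simp: Im_L divide_neg_pos)
  have "F holomorphic_on (ball 0 1 - \<real>\<^sub>\<le>\<^sub>0) \<union> (ball 0 1 - \<real>\<^sub>\<ge>\<^sub>0)"
  proof (rule holomorphic_on_Un)
    have "(c \<circ> L) holomorphic_on (ball 0 1 - \<real>\<^sub>\<le>\<^sub>0)"
    proof (rule holomorphic_on_compose)
      show "L holomorphic_on (ball 0 1 - \<real>\<^sub>\<le>\<^sub>0)"
        unfolding L_def by (intro holomorphic_intros) auto
      show "c holomorphic_on L ` (ball 0 1 - \<real>\<^sub>\<le>\<^sub>0)"
        by (rule holomorphic_on_subset[OF hol]) (use Im_L_pos in \<open>force\<close>)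
    qed
    thus "F holomorphic_on (ball 0 1 - \<real>\<^sub>\<le>\<^sub>0)"
      by (simp add: F_def o_def)
    have "(c \<circ> L') holomorphic_on (ball 0 1 - \<real>\<^sub>\<ge>\<^sub>0)"
    proof (rule holomorphic_on_compose)
      show "L' holomorphic_on (ball 0 1 - \<real>\<^sub>\<ge>\<^sub>0)"
        unfolding L'_def by (intro holomorphic_intros) (auto simp: uminus_nonneg_Reals_iff[symmetric])
      show "c holomorphic_on L' ` (ball 0 1 - \<real>\<^sub>\<ge>\<^sub>0)"
        by (rule holomorphic_on_subset[OF hol]) (use Im_L_pos in \<open>force\<close>)
    qed
    thus "F holomorphic_on (ball 0 1 - \<real>\<^sub>\<ge>\<^sub>0)"
    proof (rule holomorphic_transform)
      fix w :: complex assume w: "w \<in> ball 0 1 - \<real>\<^sub>\<ge>\<^sub>0"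
      hence "w \<noteq> 0"
        by auto
      hence "c (L w) = c (L' w)"
        using w Im_L_pos[of w] by (intro eq) (simp_all add: nome_L nome_L')
      thus "(c \<circ> L') w = F w"
        by (simp add: F_def)
    qed
  qed (auto intro: open_Diff)
  also have "(ball 0 1 - \<real>\<^sub>\<le>\<^sub>0) \<union> (ball 0 1 - \<real>\<^sub>\<ge>\<^sub>0) = ball 0 1 - {0 :: complex}"
    by (auto simp: complex_nonpos_Reals_iff complex_nonneg_Reals_iff complex_eq_iff)
  finally have F: "F holomorphic_on ball 0 1 - {0}" .
  obtain y where y: "\<And>t. Im t > y \<Longrightarrow> norm (c t) \<le> B"
    using bdd unfolding eventually_cusp by blast
  have "eventually (\<lambda>w. norm (F w) \<le> B) (at 0)"
  proof -
    have "eventually (\<lambda>w :: complex. w \<in> ball 0 (exp (- 2 * pi * y)) - {0}) (at 0)"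
      by (rule eventually_at_in_open) auto
    thus ?thesis
    proof eventually_elim
      case (elim w)
      hence "ln (norm w) < ln (exp (- 2 * pi * y))"
        by (subst ln_less_cancel_iff) auto
      hence "Im (L w) > y"
        using elim by (simp add: Im_L field_simps)
      thus ?case
        using y by (simp add: F_def)
    qed
  qed
  hence "\<exists>g. g holomorphic_on ball 0 1 \<and> (\<forall>z\<in>ball 0 1 - {0}. g z = F z)"
    using holomorphic_on_extend_bounded[OF F] by auto
  then obtain g where g: "g holomorphic_on ball 0 1" "\<And>z. z \<in> ball 0 1 - {0} \<Longrightarrow> g z = F z"
    by blast
  show ?thesis
  proof (rule that[OF g(1)])
    fix t :: complex assume t: "Im t > 0"
    have n: "(nome t)\<^sup>2 \<in> ball 0 1 - {0}" 
      using norm_nome_power_less_1[OF t, of 2] by simp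
    have "c t = c (L ((nome t)\<^sup>2))"
      using t Im_L_pos(1)[OF n] by (intro eq) (simp_all add: nome_L nome_power)
    thus "c t = g ((nome t)\<^sup>2)"
      using g(2)[OF n] by (simp add: F_def)
  qed
qed

text \<open>The region is larger than the usual fundamental domain, which makes termination easy:
  after a translation, \<open>Im z < 1 / 2\<close> implies that the squared norm is at most
  \<open>1 / 2\<close>, so the inversion at least doubles the imaginary part. The induction runs
  over the number \<open>k\<close> of doublings.\<close>

lemma SL2Z_reduce:
  assumes "Im z > 0"
  obtains A where "A \<in> SL2" "\<bar>Re (act A z)\<bar> \<le> 1 / 2" "Im (act A z) \<ge> 1 / 2"
proof -
  have shift: "\<exists>A\<in>SL2. \<bar>Re (act A z)\<bar> \<le> 1 / 2 \<and> Im (act A z) = Im z" for z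
  proof (intro bexI conjI)
    show "\<bar>Re (act (matT (- round (Re z))) z)\<bar> \<le> 1 / 2"
      using of_int_round_abs_le[of "Re z"] by (simp add: moebius_act_T abs_minus_commute)
  qed (simp_all add: moebius_act_T)
  have "\<exists>A\<in>SL2. \<bar>Re (act A z)\<bar> \<le> 1 / 2 \<and> Im (act A z) \<ge> 1 / 2"
    if "Im z > 0" "2 ^ k * Im z \<ge> 1 / 2" for k z
    using that
  proof (induction k arbitrary: z)
    case 0
    thus ?case
      using shift[of z] by auto
  next
    case (Suc k)
    obtain A where A: "A \<in> SL2" "\<bar>Re (act A z)\<bar> \<le> 1 / 2" "Im (act A z) = Im z"
      using shift by blast
    show ?case
    proof (cases "Im z \<ge> 1 / 2")
      case True
      thus ?thesis
        using A by auto
    next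
      case False
      define z1 where "z1 = act A z"
      define z2 where "z2 = act matS z1"
      have z1: "Im z1 > 0"
        using A Suc.prems by (simp add: z1_def)
      have z2: "Im z2 > 0"
        unfolding z2_def by (intro moebius_act_upper z1 matS_SL2Z)
      have "(Re z1)\<^sup>2 \<le> (1 / 2)\<^sup>2"
        using A(2) by (intro power2_le_iff_abs_le[THEN iffD2]) (auto simp: z1_def)
      moreover have "(Im z1)\<^sup>2 \<le> (1 / 2)\<^sup>2"
        using False A z1 by (intro power_mono) (auto simp: z1_def)
      ultimately have le: "(norm z1)\<^sup>2 \<le> 1 / 2"
        unfolding cmod_power2 by (simp add: power2_eq_square)
      have pos: "(norm z1)\<^sup>2 > 0"
        using z1 by auto
      have "Im z2 = Im z / (norm z1)\<^sup>2"
        unfolding z2_def Im_moebius_act[OF matS_SL2Z] using A(3) by (simp add: matS_def z1_def)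
      also have "\<dots> \<ge> Im z / (1 / 2)"
        using le pos Suc.prems by (intro divide_left_mono) auto
      finally have "2 ^ k * (2 * Im z) \<le> 2 ^ k * Im z2"
        by (intro mult_left_mono) auto
      moreover have "2 ^ Suc k * Im z = 2 ^ k * (2 * Im z)"
        by simp
      ultimately have "2 ^ k * Im z2 \<ge> 1 / 2"
        using Suc.prems(2) by linarith
      from Suc.IH[OF z2 this] obtain B where B: "B \<in> SL2"
        "\<bar>Re (act B z2)\<bar> \<le> 1 / 2" "Im (act B z2) \<ge> 1 / 2"
        by blast
      have "act B z2 = act (B ** (matS ** A)) z"
        using A B Suc.prems by (simp add: moebius_act_mult SL2Z_mult z2_def z1_def)
      thus ?thesis
        using A B by (intro bexI[of _ "B ** (matS ** A)"]) (auto intro!: SL2Z_mult)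
    qed
  qed
  moreover obtain k where "(1 / 2) / Im z < 2 ^ k"
    using real_arch_pow[of 2 "(1 / 2) / Im z"] by auto
  hence "2 ^ k * Im z \<ge> 1 / 2"
    using assms by (simp add: field_simps)
  ultimately show ?thesis
    using assms that by blast
qed

text \<open>Suppose \<open>c t\<close> is nonzero. Values near the cusp are smaller than
  \<open>norm (c t)\<close>, so the modulus of \<open>c\<close> attains its maximum over the whole
  half-plane in a compact part \<open>K\<close> of the reduced region. By the maximum principle
  \<open>c\<close> is constant, which contradicts the smaller values near the cusp.\<close>

lemma level_one_tendsto_0:
  assumes hol: "c holomorphic_on \<H>"
    and inv: "\<And>A t. A \<in> SL2 \<Longrightarrow> Im t > 0 \<Longrightarrow> c (act A t) = c t"
    and lim: "(c \<longlongrightarrow> 0) cusp"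
    and "Im t > 0"
  shows "c t = 0"
proof (rule ccontr)
  assume nz: "c t \<noteq> 0"
  have "eventually (\<lambda>z. norm (c z) < norm (c t)) cusp"
    using order_tendstoD(2)[OF tendsto_norm[OF lim], of "norm (c t)"] nz by simp
  then obtain y where y: "\<And>z. Im z > y \<Longrightarrow> norm (c z) < norm (c t)"
    unfolding eventually_cusp by blast
  define K where "K = cbox (Complex (- 1 / 2) (1 / 2)) (Complex (1 / 2) y)"
  have K: "z \<in> K \<longleftrightarrow> \<bar>Re z\<bar> \<le> 1 / 2 \<and> Im z \<ge> 1 / 2 \<and> Im z \<le> y" for z
    by (auto simp: K_def in_cbox_complex_iff)
  have in_K: "\<exists>w\<in>K. c w = c z" if "Im z > 0" "norm (c z) \<ge> norm (c t)" for z
  proof -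
    obtain A where A: "A \<in> SL2" "\<bar>Re (act A z)\<bar> \<le> 1 / 2" "Im (act A z) \<ge> 1 / 2"
      using SL2Z_reduce[OF \<open>Im z > 0\<close>] .
    have "c (act A z) = c z"
      by (rule inv) fact+
    moreover from this have "Im (act A z) \<le> y"
      using that y[of "act A z"] by force
    ultimately show ?thesis
      using A K by blast
  qed
  have "K \<subseteq> \<H>"
    using K by auto
  hence "continuous_on K (\<lambda>z. norm (c z))"
    using hol by (intro continuous_on_norm holomorphic_on_imp_continuous_on) (rule holomorphic_on_subset)
  moreover have "compact K" "K \<noteq> {}"
    using in_K[of t] assms by (auto simp: K_def)
  ultimately obtain p where p: "p \<in> K" "\<And>z. z \<in> K \<Longrightarrow> norm (c z) \<le> norm (c p)"
    using continuous_attains_sup by metis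
  have p_ge: "norm (c t) \<le> norm (c p)"
    using in_K[of t] assms p by force
  have "c constant_on \<H>"
  proof (rule maximum_modulus_principle[OF hol open_upper_half_plane connected_upper_half_plane open_upper_half_plane order_refl])
    show "p \<in> \<H>"
      using p \<open>K \<subseteq> \<H>\<close> by blast
    fix z assume "z \<in> \<H>"
    show "norm (c z) \<le> norm (c p)"
    proof (cases "norm (c z) \<ge> norm (c t)")
      case True
      then obtain w where "w \<in> K" "c w = c z"
        using in_K \<open>z \<in> \<H>\<close> by auto
      thus ?thesis
        using p by force
    qed (use p_ge in auto)
  qed
  then obtain d where d: "\<And>z. Im z > 0 \<Longrightarrow> c z = d"
    unfolding constant_on_def by auto
  have "c (Complex 0 (max 1 (y + 1))) = c t"
    using d[of "Complex 0 (max 1 (y + 1))"] d[OF \<open>Im t > 0\<close>] by simp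
  thus False
    using y[of "Complex 0 (max 1 (y + 1))"] by (simp add: less_max_iff_disj)
qed

text \<open>Even powers are insensitive to the signs in the action, but the sum of squares is the
  constant 48; hence fourth powers. Classically this function is \<open>2 * j + 768\<close> for
  Klein's invariant \<open>j\<close>, since the squares of the three functions are the roots of
  \<open>(X - 16) ^ 3 = j * X\<close>.\<close>

definition wJ :: "complex \<Rightarrow> complex" where
  "wJ \<tau> = wx0 \<tau> ^ 4 + wx1 \<tau> ^ 4 + wx2 \<tau> ^ 4"

lemma wJ_invariant:
  assumes "A \<in> SL2" "Im z > 0"
  shows "wJ (act A z) = wJ z"
  using assms
proof (induction arbitrary: z rule: SL2Z_induct)
  case (S A)
  have "Im (act matS z) > 0"
    using S by (intro moebius_act_upper) auto
  moreover have "wJ (act matS z) = wJ z"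
    unfolding moebius_act_S wJ_def using S by (simp only: wx_S) simp
  ultimately show ?case
    using S by (simp add: moebius_act_mult)
next
  case (T A)
  have "wJ (act (matT 1) z) = wJ z"
    unfolding moebius_act_T wJ_def using T by (simp add: wx_T)
  thus ?case
    using T by (simp add: moebius_act_mult moebius_act_upper)
next
  case (T' A)
  have "wJ (act (matT (- 1)) z) = wJ z"
    unfolding moebius_act_T wJ_def using T' wx_T[of "z - 1"] by simp
  thus ?case
    using T' by (simp add: moebius_act_mult moebius_act_upper)
qed simp

lemma wJ_holomorphic: "wJ holomorphic_on \<H>"
  unfolding wJ_def by (intro holomorphic_intros wx_holomorphic)

text \<open>After multiplication by the square of the nome, \<open>wJ\<close> becomes a function
  \<open>H\<close> of \<open>nome z\<close> that is holomorphic at 0; \<open>wx0\<close> and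
  \<open>wx1\<close> each contribute 1 to the value there.\<close>

lemma wJ_cusp: "((\<lambda>z. (nome z)\<^sup>2 * wJ z) \<longlongrightarrow> 2) cusp"
proof -
  define H where "H = (\<lambda>Q :: complex. qprod Q (Q\<^sup>2) ^ 48 + qprod (- Q) (Q\<^sup>2) ^ 48 + 64 ^ 4 * Q ^ 6 * qprod (Q\<^sup>2) (Q\<^sup>2) ^ 48)"
  have "norm (Q\<^sup>2) < 1" if "Q \<in> ball 0 1" for Q :: complex
    using that by (simp add: norm_power power_less_one_iff)
  hence "H holomorphic_on ball 0 1"
    unfolding H_def by (intro holomorphic_intros qprod_holomorphic) auto
  hence "isCont H 0"
    by (rule holomorphic_on_ball_isCont)
  hence "((\<lambda>z. H (nome z)) \<longlongrightarrow> H 0) cusp"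
    using nome_tendsto_cusp by (rule isCont_tendsto_compose)
  moreover have "H 0 = 2"
    by (simp add: H_def qprod_def)
  moreover have "eventually (\<lambda>z. H (nome z) = (nome z)\<^sup>2 * wJ z) cusp"
    using eventually_cusp_gt[of 0]
  proof eventually_elim
    case (elim z)
    have "nome (- (z / 2)) ^ 4 = inverse ((nome z)\<^sup>2)"
      by (simp add: nome_power nome_minus[symmetric])
    hence *: "(nome z)\<^sup>2 * nome (- (z / 2)) ^ 4 = 1"
      by simp
    have "(nome z)\<^sup>2 * wJ z = ((nome z)\<^sup>2 * nome (- (z / 2)) ^ 4) * qprod (nome z) ((nome z)\<^sup>2) ^ 48
        + ((nome z)\<^sup>2 * nome (- (z / 2)) ^ 4) * qprod (- nome z) ((nome z)\<^sup>2) ^ 48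
        + 64 ^ 4 * nome z ^ 6 * qprod ((nome z)\<^sup>2) ((nome z)\<^sup>2) ^ 48"
      unfolding wJ_def wx_qprod[OF elim] power_mult_distrib power_mult[symmetric]
      by (simp add: ring_distribs power_mult[symmetric] power_add[symmetric] mult_ac)
    thus ?case
      unfolding H_def by (simp only: *) simp
  qed
  ultimately show ?thesis
    using Lim_transform_eventually by fastforce
qed

text \<open>Induction on the pole order: a multiple of \<open>wJ ^ Suc m\<close> cancels the leading
  coefficient. In the base case the function minus its value at the cusp tends to 0 and therefore
  vanishes.\<close>

lemma level_one_polynomial_wJ:
  assumes "c holomorphic_on \<H>"
    and "\<And>A z. A \<in> SL2 \<Longrightarrow> Im z > 0 \<Longrightarrow> c (act A z) = c z"
    and "eventually (\<lambda>z. norm ((nome z)\<^sup>2 ^ m * c z) \<le> B) cusp"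
  shows "\<exists>p. \<forall>z. Im z > 0 \<longrightarrow> c z = poly p (wJ z)"
  using assms
proof (induction m arbitrary: c B)
  case 0
  have per: "c (z + 1) = c z" if "Im z > 0" for z
    using 0(2)[of "matT 1" z] that by (simp add: moebius_act_T)
  obtain g where g: "g holomorphic_on ball 0 1" "\<And>z. Im z > 0 \<Longrightarrow> c z = g ((nome z)\<^sup>2)"
    by (rule q_expansion[OF 0(1) per, of B]) (use 0(3) in auto)
  have "isCont g 0"
    using g(1) by (rule holomorphic_on_ball_isCont)
  moreover have "((\<lambda>z. (nome z)\<^sup>2) \<longlongrightarrow> 0) cusp"
    using tendsto_power[OF nome_tendsto_cusp, of 2] by simp
  ultimately have "((\<lambda>z. g ((nome z)\<^sup>2)) \<longlongrightarrow> g 0) cusp"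
    by (rule isCont_tendsto_compose)
  also have "?this \<longleftrightarrow> (c \<longlongrightarrow> g 0) cusp"
    by (rule tendsto_cong) (use eventually_cusp_gt[of 0] in eventually_elim, simp add: g)
  finally have "((\<lambda>z. c z - g 0) \<longlongrightarrow> 0) cusp"
    by (simp add: LIM_zero_iff tendsto_eq_intros)
  hence "c z - g 0 = 0" if "Im z > 0" for z
    using that 0 by (intro level_one_tendsto_0[of "\<lambda>z. c z - g 0"]) (auto intro!: holomorphic_intros)
  thus ?case
    by (intro exI[of _ "[:g 0:]"]) auto
next
  case (Suc m)
  have per: "c (z + 1) = c z" "wJ (z + 1) = wJ z" if "Im z > 0" for z
    using Suc(3)[of "matT 1" z] wJ_invariant[of "matT 1" z] that by (simp_all add: moebius_act_T)
  have nper: "(nome (z + 1))\<^sup>2 = (nome z)\<^sup>2" for z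
    by (simp add: nome_add)
  have nhol: "nome holomorphic_on \<H>"
    using nome_holomorphic[of "\<lambda>x. x"] by simp
  obtain g where g: "g holomorphic_on ball 0 1"
      "\<And>z. Im z > 0 \<Longrightarrow> (nome z)\<^sup>2 ^ Suc m * c z = g ((nome z)\<^sup>2)"
    by (rule q_expansion[of "\<lambda>z. (nome z)\<^sup>2 ^ Suc m * c z" B])
       (use Suc.prems nhol in \<open>auto intro!: holomorphic_intros simp: per nper\<close>)
  have "eventually (\<lambda>z. norm ((nome z)\<^sup>2 * wJ z) \<le> 3) cusp"
    using order_tendstoD(2)[OF tendsto_norm[OF wJ_cusp], of 3] by (auto elim: eventually_mono)
  then obtain h where h: "h holomorphic_on ball 0 1" "\<And>z. Im z > 0 \<Longrightarrow> (nome z)\<^sup>2 * wJ z = h ((nome z)\<^sup>2)"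
    by (rule q_expansion[of "\<lambda>z. (nome z)\<^sup>2 * wJ z" 3, rotated 2])
       (use wJ_holomorphic nhol in \<open>auto intro!: holomorphic_intros simp: per nper\<close>)
  have lim0: "((\<lambda>z. (nome z)\<^sup>2) \<longlongrightarrow> 0) cusp"
    using tendsto_power[OF nome_tendsto_cusp, of 2] by simp
  have h0: "h 0 = 2"
  proof -
    have "isCont h 0"
      using h(1) by (rule holomorphic_on_ball_isCont)
    hence "((\<lambda>z. h ((nome z)\<^sup>2)) \<longlongrightarrow> h 0) cusp"
      using lim0 by (rule isCont_tendsto_compose)
    also have "?this \<longleftrightarrow> ((\<lambda>z. (nome z)\<^sup>2 * wJ z) \<longlongrightarrow> h 0) cusp"
      by (rule tendsto_cong) (use eventually_cusp_gt[of 0] in eventually_elim, simp add: h)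
    finally show ?thesis
      using wJ_cusp tendsto_unique[OF cusp_not_bot] by blast
  qed
  \<comment> \<open>By \<open>h0\<close> the leading coefficient of \<open>wJ\<close> is 2, hence
    the denominator; this choice gives \<open>k 0 = 0\<close>.\<close>
  define a where "a = g 0 / 2 ^ Suc m"
  define c' where "c' = (\<lambda>z. c z - a * wJ z ^ Suc m)"
  define k where "k = (\<lambda>w. g w - a * h w ^ Suc m)"
  have k: "k holomorphic_on ball 0 1" "k 0 = 0"
    unfolding k_def by (auto intro!: holomorphic_intros g h simp: h0 a_def)
  have kc: "(nome z)\<^sup>2 ^ Suc m * c' z = k ((nome z)\<^sup>2)" if "Im z > 0" for z
    unfolding c'_def k_def g(2)[OF that, symmetric] h(2)[OF that, symmetric]
    by (simp only: right_diff_distrib power_mult_distrib mult.left_commute)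
  have "(k has_field_derivative deriv k 0) (at 0)"
    using k by (intro holomorphic_derivI[of _ "ball 0 1"]) auto
  \<comment> \<open>Because \<open>k\<close> vanishes at 0, one power of the local parameter can be
    divided off, and the pole order drops from \<open>Suc m\<close> to \<open>m\<close>.\<close>
  hence "((\<lambda>w. k w / w) \<longlongrightarrow> deriv k 0) (at 0)"
    by (simp add: has_field_derivative_iff k)
  hence "eventually (\<lambda>w. norm (k w / w) < norm (deriv k 0) + 1) (at 0)"
    by (intro order_tendstoD(2)[OF tendsto_norm]) auto
  moreover have "filterlim (\<lambda>z. (nome z)\<^sup>2) (at 0) cusp"
    using lim0 by (auto simp: filterlim_at)
  ultimately have "eventually (\<lambda>z. norm (k ((nome z)\<^sup>2) / (nome z)\<^sup>2) < norm (deriv k 0) + 1) cusp"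
    by (rule eventually_compose_filterlim)
  hence bdd: "eventually (\<lambda>z. norm ((nome z)\<^sup>2 ^ m * c' z) \<le> norm (deriv k 0) + 1) cusp"
    using eventually_cusp_gt[of 0]
  proof eventually_elim
    case (elim z)
    have "k ((nome z)\<^sup>2) / (nome z)\<^sup>2 = (nome z)\<^sup>2 ^ m * c' z"
      by (simp add: kc[OF elim(2), symmetric])
    thus ?case
      using elim(1) by simp
  qed
  have "\<exists>p. \<forall>z. Im z > 0 \<longrightarrow> c' z = poly p (wJ z)"
  proof (rule Suc.IH[OF _ _ bdd])
    show "c' holomorphic_on \<H>"
      unfolding c'_def by (intro holomorphic_intros wJ_holomorphic Suc.prems)
    show "c' (act A z) = c' z" if "A \<in> SL2" "Im z > 0" for A z
      using that by (simp add: c'_def Suc.prems wJ_invariant)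
  qed
  then obtain p where p: "\<And>z. Im z > 0 \<Longrightarrow> c' z = poly p (wJ z)"
    by blast
  have "c z = poly (p + monom a (Suc m)) (wJ z)" if "Im z > 0" for z
    using p[OF that] by (simp add: c'_def poly_monom algebra_simps)
  thus ?case
    by blast
qed

section \<open>Forms on the Weber curve\<close>

definition monom4 :: "(4 \<Rightarrow> nat) \<Rightarrow> complex^4 \<Rightarrow> complex" where
  "monom4 m v = (\<Prod>i\<in>UNIV. (v $ i) ^ m i)"

lemma finite_exponents: "finite {m :: 4 \<Rightarrow> nat. (\<Sum>i\<in>UNIV. m i) = d}"
proof (rule finite_subset)
  show "{m :: 4 \<Rightarrow> nat. (\<Sum>i\<in>UNIV. m i) = d} \<subseteq> UNIV \<rightarrow>\<^sub>E {..d}"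
    by (auto simp: member_le_sum)
  show "finite ((UNIV :: 4 set) \<rightarrow>\<^sub>E {..d})"
    by (rule finite_PiE) auto
qed

lemma is_formE:
  assumes "is_form d F"
  obtains a where "F = (\<lambda>v. \<Sum>m | (\<Sum>i\<in>UNIV. m i) = d. a m * monom4 m v)"
  using assms unfolding is_form_def monom4_def by blast

lemma is_form_add:
  assumes "is_form d F" "is_form d G"
  shows "is_form d (\<lambda>v. F v + G v)"
proof -
  from assms obtain a b where "F = (\<lambda>v. \<Sum>m | (\<Sum>i\<in>UNIV. m i) = d. a m * monom4 m v)"
    "G = (\<lambda>v. \<Sum>m | (\<Sum>i\<in>UNIV. m i) = d. b m * monom4 m v)"
    by (elim is_formE)
  thus ?thesis
    unfolding is_form_def by (intro exI[of _ "\<lambda>m. a m + b m"]) (simp add: monom4_def sum.distrib ring_distribs)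
qed

lemma is_form_monom4:
  assumes "(\<Sum>i\<in>UNIV. m i) = d"
  shows "is_form d (\<lambda>v. c * monom4 m v)"
  unfolding is_form_def
proof (intro exI[of _ "\<lambda>m'. if m' = m then c else 0"] ext)
  fix v :: "complex^4"
  have "(\<Sum>m' | (\<Sum>i\<in>UNIV. m' i) = d. (if m' = m then c else 0) * (\<Prod>i\<in>UNIV. (v $ i) ^ m' i))
      = (\<Sum>m' | (\<Sum>i\<in>UNIV. m' i) = d. if m = m' then c * monom4 m v else 0)"
    by (intro sum.cong) (auto simp: monom4_def)
  also have "\<dots> = c * monom4 m v"
    using finite_exponents assms by (subst sum.delta') auto
  finally show "c * monom4 m v = (\<Sum>m' | (\<Sum>i\<in>UNIV. m' i) = d. (if m' = m then c else 0) * (\<Prod>i\<in>UNIV. (v $ i) ^ m' i))" ..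
qed

lemma is_form_0: "is_form d (\<lambda>_. 0)"
  unfolding is_form_def by (intro exI[of _ "\<lambda>_. 0"]) simp

lemma is_form_sum:
  assumes "\<And>i. i \<in> I \<Longrightarrow> is_form d (F i)"
  shows "is_form d (\<lambda>v. \<Sum>i\<in>I. F i v)"
  using assms by (induction I rule: infinite_finite_induct) (auto intro: is_form_0 is_form_add)

lemma is_form_mult:
  assumes "is_form d F" "is_form e G"
  shows "is_form (d + e) (\<lambda>v. F v * G v)"
proof -
  from assms obtain a b where ab: "F = (\<lambda>v. \<Sum>m | (\<Sum>i\<in>UNIV. m i) = d. a m * monom4 m v)"
    "G = (\<lambda>v. \<Sum>m | (\<Sum>i\<in>UNIV. m i) = e. b m * monom4 m v)"
    by (elim is_formE)
  have eq: "(\<lambda>v. F v * G v) = (\<lambda>v. \<Sum>m | (\<Sum>i\<in>UNIV. m i) = d. \<Sum>m' | (\<Sum>i\<in>UNIV. m' i) = e.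
      (a m * b m') * monom4 (\<lambda>i. m i + m' i) v)"
    unfolding ab by (simp add: sum_product monom4_def prod.distrib power_add mult_ac)
  show ?thesis
    unfolding eq by (intro is_form_sum is_form_monom4) (simp add: sum.distrib)
qed

lemma is_form_const: "is_form 0 (\<lambda>_. c)"
  using is_form_monom4[of "\<lambda>_. 0" 0 c] by (simp add: monom4_def)

lemma is_form_coord: "is_form 1 (\<lambda>v. v $ i)"
proof -
  have "monom4 (\<lambda>j. if j = i then 1 else 0) v = v $ i" for v
  proof -
    have "monom4 (\<lambda>j. if j = i then 1 else 0) v = (\<Prod>j\<in>UNIV. if j = i then v $ j else 1)"
      unfolding monom4_def by (intro prod.cong) auto
    thus ?thesis
      by simp
  qed
  thus ?thesis
    using is_form_monom4[of "\<lambda>j. if j = i then 1 else 0" 1 1] by simp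
qed

lemma is_form_coord_power: "is_form k (\<lambda>v. (v $ i) ^ k)"
proof (induction k)
  case (Suc k)
  show ?case
    using is_form_mult[OF is_form_coord[of i] Suc] by simp
qed (simp add: is_form_const)

lemma is_form_diff:
  assumes "is_form d F" "is_form d G"
  shows "is_form d (\<lambda>v. F v - G v)"
  using is_form_add[OF assms(1) is_form_mult[OF is_form_const[of "- 1"] assms(2), simplified]] by simp

lemma is_form_scale:
  assumes "is_form d F"
  shows "F (c *s v) = c ^ d * F v"
proof -
  obtain a where a: "F = (\<lambda>v. \<Sum>m | (\<Sum>i\<in>UNIV. m i) = d. a m * monom4 m v)"
    using assms by (elim is_formE)
  have "monom4 m (c *s v) = c ^ (\<Sum>i\<in>UNIV. m i) * monom4 m v" for m
    by (simp add: monom4_def power_mult_distrib prod.distrib power_sum)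
  thus ?thesis
    by (simp add: a sum_distrib_left mult_ac)
qed

section \<open>The parametrised curve and the forms restricted to it\<close>

abbreviation wpoint :: "complex \<Rightarrow> complex^4" where
  "wpoint \<equiv> weber_coords 2"

lemma vector_4 [simp]:
  "(vector [a, b, c, d] :: ('a :: zero)^4) $ 1 = a" "(vector [a, b, c, d] :: ('a :: zero)^4) $ 2 = b"
  "(vector [a, b, c, d] :: ('a :: zero)^4) $ 3 = c" "(vector [a, b, c, d] :: ('a :: zero)^4) $ 4 = d"
  unfolding vector_def by simp_all

lemma wpoint: "wpoint z = vector [wx0 z, wx1 z, wx2 z, 1]"
  by (simp add: weber_coords_def wx0_def wx1_def wx2_def)

lemma wpoint_nonzero: "wpoint z \<noteq> 0"
proof
  assume "wpoint z = 0"
  hence "wpoint z $ 4 = 0"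
    by simp
  thus False
    by (simp add: wpoint)
qed

text \<open>An induction principle for forms in the chart where the last coordinate is 1. It serves
  both for holomorphy on the half-plane and for meromorphy in the local parameter at a cusp.\<close>

lemma form_on_curve_closure:
  fixes P :: "(complex \<Rightarrow> complex) \<Rightarrow> bool"
  assumes "is_form d F"
    and const: "\<And>c. P (\<lambda>_. c)" and add: "\<And>f g. P f \<Longrightarrow> P g \<Longrightarrow> P (\<lambda>x. f x + g x)"
    and mult: "\<And>f g. P f \<Longrightarrow> P g \<Longrightarrow> P (\<lambda>x. f x * g x)"
    and coord: "P z0" "P z1" "P z2"
  shows "P (\<lambda>x. F (vector [z0 x, z1 x, z2 x, 1]))"
proof -
  obtain a where a: "F = (\<lambda>v. \<Sum>m | (\<Sum>i\<in>UNIV. m i) = d. a m * monom4 m v)"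
    using assms(1) by (elim is_formE)
  have power: "P (\<lambda>x. f x ^ n)" if "P f" for f n
    by (induction n) (use that const[of 1] mult in auto)
  have sum: "P (\<lambda>x. \<Sum>m\<in>M. f m x)" if "\<And>m. P (f m)" for f :: "(4 \<Rightarrow> nat) \<Rightarrow> complex \<Rightarrow> complex" and M
    by (induction M rule: infinite_finite_induct) (use that const[of 0] add in auto)
  have "P (\<lambda>x. a m * (z0 x ^ m 1 * z1 x ^ m 2 * z2 x ^ m 3))" for m
    by (intro mult power const coord)
  moreover have "monom4 m (vector [z0 x, z1 x, z2 x, 1]) = z0 x ^ m 1 * z1 x ^ m 2 * z2 x ^ m 3" for m x
    unfolding monom4_def UNIV_4 by (simp add: mult.assoc)
  ultimately show ?thesis
    unfolding a by (intro sum) simp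
qed

lemma form_wpoint_holomorphic:
  assumes "is_form d F"
  shows "(\<lambda>z. F (wpoint z)) holomorphic_on \<H>"
  unfolding wpoint
  by (rule form_on_curve_closure[OF assms, where P = "\<lambda>f. f holomorphic_on \<H>"])
     (auto intro!: holomorphic_intros wx_holomorphic)

abbreviation (input) W2 :: "(complex^4) set set" where
  "W2 \<equiv> weber_curve 2"

text \<open>By its definition the Zariski closure imposes no new condition on forms, and homogeneity
  takes care of the choice of coordinate vectors. All vanishing conditions thus become statements
  about functions of \<open>z\<close>.\<close>

lemma vanishes_on_weber_curve:
  assumes F: "is_form d F"
  shows "vanishes_on F (weber_curve 2) \<longleftrightarrow> (\<forall>z. Im z > 0 \<longrightarrow> F (wpoint z) = 0)"
proof -
  let ?S = "(\<lambda>z. proj_point (wpoint z)) ` \<H>"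
  have S: "vanishes_on F ?S \<longleftrightarrow> (\<forall>z. Im z > 0 \<longrightarrow> F (wpoint z) = 0)"
  proof
    assume L: "vanishes_on F ?S"
    show "\<forall>z. Im z > 0 \<longrightarrow> F (wpoint z) = 0"
    proof (intro allI impI)
      fix z :: complex assume "Im z > 0"
      moreover have "wpoint z \<in> proj_point (wpoint z)"
        unfolding proj_point_def by (auto intro!: exI[of _ 1])
      ultimately show "F (wpoint z) = 0"
        using L unfolding vanishes_on_def by blast
    qed
  qed (auto simp: vanishes_on_def proj_point_def is_form_scale[OF F])
  have "?S \<subseteq> proj3"
    using wpoint_nonzero by (auto simp: proj3_def)
  hence "?S \<subseteq> weber_curve 2"
    unfolding weber_curve_def zariski_closure_def by (auto simp: vanishes_on_def)
  moreover have "vanishes_on F (weber_curve 2)" if "vanishes_on F ?S"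
    using F that unfolding weber_curve_def zariski_closure_def by (auto simp: vanishes_on_def)
  ultimately show ?thesis
    unfolding S[symmetric] by (auto simp: vanishes_on_def)
qed

section \<open>The identity theorem and equality up to isolated points\<close>

lemma holomorphic_eventually_nonzero:
  assumes "f holomorphic_on \<H>" "\<not> (\<forall>\<tau>. Im \<tau> > 0 \<longrightarrow> f \<tau> = 0)" "Im z > 0"
  shows "eventually (\<lambda>w. f w \<noteq> 0) (at z)"
proof -
  from assms(2) obtain \<tau> where "Im \<tau> > 0" "f \<tau> \<noteq> 0"
    by blast
  thus ?thesis
    using non_zero_neighbour_alt[OF assms(1) open_upper_half_plane connected_upper_half_plane, of z \<tau>] assms(3)
    by (auto elim: eventually_mono)
qed

lemma eventually_upper: "Im z > 0 \<Longrightarrow> eventually (\<lambda>w. Im w > 0) (at z)"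
  using eventually_at_in_open'[OF open_upper_half_plane, of z] by simp

text \<open>The holomorphic functions on the connected half-plane form an integral domain; this
  takes the place of irreducibility of the curve.\<close>

lemma holomorphic_mult_eq_0:
  assumes "f holomorphic_on \<H>" "g holomorphic_on \<H>"
    and "\<And>z. Im z > 0 \<Longrightarrow> f z * g z = 0"
    and "\<not> (\<forall>z. Im z > 0 \<longrightarrow> f z = 0)"
  shows "\<forall>z. Im z > 0 \<longrightarrow> g z = 0"
proof (rule ccontr)
  assume "\<not> (\<forall>z. Im z > 0 \<longrightarrow> g z = 0)"
  hence "eventually (\<lambda>w. g w \<noteq> 0) (at \<i>)"
    using assms by (intro holomorphic_eventually_nonzero) auto
  moreover have "eventually (\<lambda>w. f w \<noteq> 0) (at \<i>)"
    using assms by (intro holomorphic_eventually_nonzero) auto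
  moreover have "eventually (\<lambda>w. Im w > 0) (at \<i>)"
    by (rule eventually_upper) simp
  ultimately have "eventually (\<lambda>_. False) (at \<i>)"
    by eventually_elim (use assms(3) in auto)
  thus False
    by simp
qed

text \<open>Equality of meromorphic functions: values at isolated points, such as poles or zeros of
  denominators, are ignored.\<close>

definition gen_eq :: "(complex \<Rightarrow> complex) \<Rightarrow> (complex \<Rightarrow> complex) \<Rightarrow> bool" where
  "gen_eq f g \<longleftrightarrow> (\<forall>z. Im z > 0 \<longrightarrow> eventually (\<lambda>w. f w = g w) (at z))"

lemma gen_eqI: "(\<And>z. Im z > 0 \<Longrightarrow> f z = g z) \<Longrightarrow> gen_eq f g"
  unfolding gen_eq_def using eventually_upper by (blast intro: eventually_mono)

lemma gen_eq_sym: "gen_eq f g \<Longrightarrow> gen_eq g f"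
  by (simp add: gen_eq_def eq_commute)

lemma gen_eq_trans [trans]:
  assumes "gen_eq f g" "gen_eq g h"
  shows "gen_eq f h"
  unfolding gen_eq_def
proof (intro allI impI)
  fix z :: complex assume "Im z > 0"
  hence "eventually (\<lambda>w. f w = g w) (at z)" "eventually (\<lambda>w. g w = h w) (at z)"
    using assms by (simp_all add: gen_eq_def)
  thus "eventually (\<lambda>w. f w = h w) (at z)"
    by eventually_elim simp
qed

lemma gen_eq_op:
  assumes "gen_eq f f'" "gen_eq g g'"
  shows "gen_eq (\<lambda>z. h (f z) (g z)) (\<lambda>z. h (f' z) (g' z))"
  unfolding gen_eq_def
proof (intro allI impI)
  fix z :: complex assume "Im z > 0"
  hence "eventually (\<lambda>w. f w = f' w) (at z)" "eventually (\<lambda>w. g w = g' w) (at z)"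
    using assms by (simp_all add: gen_eq_def)
  thus "eventually (\<lambda>w. h (f w) (g w) = h (f' w) (g' w)) (at z)"
    by eventually_elim simp
qed

lemma gen_eq_imp_normalize_eq: "gen_eq f g \<Longrightarrow> normalize_mero f = normalize_mero g"
  unfolding gen_eq_def normalize_mero_def by (auto simp: fun_eq_iff intro: remove_sings_cong)

lemma gen_eq_normalize:
  assumes "f meromorphic_on \<H>"
  shows "gen_eq (normalize_mero f) f"
  unfolding gen_eq_def
proof (intro allI impI)
  fix z :: complex assume z: "Im z > 0"
  have "f meromorphic_on {z}"
    using assms by (rule meromorphic_on_subset) (use z in auto)
  hence "isolated_singularity_at f z"
    by (simp add: meromorphic_at_iff)
  hence "eventually (\<lambda>w. remove_sings f w = f w) (at z)"
    by (rule eventually_remove_sings_eq_at)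
  thus "eventually (\<lambda>w. normalize_mero f w = f w) (at z)"
    using eventually_upper[OF z] by eventually_elim (simp add: normalize_mero_def)
qed

lemma nicely_meromorphic_on_cong:
  assumes "open A" "\<And>z. z \<in> A \<Longrightarrow> f z = g z" "f nicely_meromorphic_on A"
  shows "g nicely_meromorphic_on A"
proof -
  have ev: "eventually (\<lambda>w. f w = g w) (at z)" if "z \<in> A" for z
    using eventually_at_in_open'[OF assms(1) that] by eventually_elim (use assms in auto)
  have "g meromorphic_on A \<longleftrightarrow> f meromorphic_on A"
    using ev by (intro meromorphic_on_cong) (auto simp: eq_commute)
  moreover have "is_pole g z \<and> g z = 0 \<or> g \<midarrow>z\<rightarrow> g z" if z: "z \<in> A" for z
  proof -
    have "is_pole f z \<longleftrightarrow> is_pole g z"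
      using ev[OF z] by (intro is_pole_cong) auto
    moreover have "f \<midarrow>z\<rightarrow> f z \<longleftrightarrow> g \<midarrow>z\<rightarrow> g z"
      using ev[OF z] assms(2)[OF z] tendsto_cong[OF ev[OF z]] by simp
    ultimately show ?thesis
      using assms z unfolding nicely_meromorphic_on_def by auto
  qed
  ultimately show ?thesis
    using assms by (simp add: nicely_meromorphic_on_def)
qed

lemma normalize_nicely_meromorphic:
  assumes "f meromorphic_on \<H>"
  shows "normalize_mero f nicely_meromorphic_on \<H>"
  by (rule nicely_meromorphic_on_cong[OF open_upper_half_plane _ remove_sings_nicely_meromorphic[OF assms]])
     (simp add: normalize_mero_def)

lemma normalize_nicely_meromorphic_id:
  assumes "f nicely_meromorphic_on \<H>" "\<And>z. \<not> Im z > 0 \<Longrightarrow> f z = 0"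
  shows "normalize_mero f = f"
proof
  fix z
  show "normalize_mero f z = f z"
  proof (cases "Im z > 0")
    case True
    hence "is_pole f z \<and> f z = 0 \<or> f \<midarrow>z\<rightarrow> f z"
      using assms(1) by (auto simp: nicely_meromorphic_on_def)
    thus ?thesis
      using True by (auto simp: normalize_mero_def)
  qed (use assms in \<open>auto simp: normalize_mero_def\<close>)
qed

section \<open>The Moebius action and normalised meromorphic functions\<close>

lemma moebius_act_holomorphic:
  assumes "A \<in> SL2"
  shows "act A holomorphic_on \<H>"
  unfolding moebius_act_def using moebius_denom_neq_0[OF assms] by (intro holomorphic_intros) auto

lemma moebius_act_isCont:
  assumes "A \<in> SL2" "Im z > 0"
  shows "isCont (act A) z"
  using holomorphic_on_imp_continuous_on[OF moebius_act_holomorphic[OF assms(1)]] assms(2)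
  by (simp add: continuous_on_eq_continuous_at[OF open_upper_half_plane])

lemma filterlim_moebius_act:
  assumes "A \<in> SL2" "Im z > 0"
  shows "filterlim (act A) (at (act A z)) (at z)"
proof -
  obtain B where B: "B \<in> SL2" "B ** A = mat 1"
    using SL2Z_inverse[OF assms(1)] by blast
  have inj: "w = z" if "Im w > 0" "act A w = act A z" for w
    using moebius_act_mult[OF B(1) assms(1) that(1)] moebius_act_mult[OF B(1) assms]
    by (simp add: B(2) that(2))
  have "eventually (\<lambda>w. w \<noteq> z) (at z)"
    by (simp add: eventually_at_filter)
  hence "eventually (\<lambda>w. act A w \<noteq> act A z) (at z)"
    using eventually_upper[OF assms(2)] by eventually_elim (use inj in blast)
  thus ?thesis
    using moebius_act_isCont[OF assms] by (auto simp: filterlim_at isCont_def)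
qed

text \<open>The inverse matrix provides a local inverse, so punctured neighbourhoods correspond
  exactly. This lets the removal of singularities commute with the action.\<close>

lemma filtermap_moebius_act:
  assumes "A \<in> SL2" "Im z > 0"
  shows "filtermap (act A) (at z) = at (act A z)"
proof -
  obtain B where B: "B \<in> SL2" "A ** B = mat 1" "B ** A = mat 1"
    using SL2Z_inverse[OF assms(1)] .
  have Az: "Im (act A z) > 0"
    by (rule moebius_act_upper[OF assms])
  have "act B (act A z) = z"
    using moebius_act_mult[OF B(1) assms] by (simp add: B)
  hence "filterlim (act B) (at z) (at (act A z))"
    using filterlim_moebius_act[OF B(1) Az] by simp
  moreover have "eventually (\<lambda>w. act A (act B w) = w) (at (act A z))"
    using eventually_upper[OF Az]
  proof eventually_elim
    case (elim w)
    thus ?case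
      using moebius_act_mult[OF assms(1) B(1) elim] by (simp add: B)
  qed
  ultimately show ?thesis
    using filterlim_moebius_act[OF assms] by (intro filtermap_fun_inverse)
qed

lemma normalize_moebius_act:
  assumes "A \<in> SL2" "Im \<tau> > 0"
  shows "normalize_mero f (act A \<tau>) = normalize_mero (\<lambda>z. f (act A z)) \<tau>"
  using remove_sings_compose[OF filtermap_moebius_act[OF assms], of f] assms moebius_act_upper[OF assms]
  by (simp add: normalize_mero_def o_def)

text \<open>Each conjugate is, up to sign, one of the three functions themselves, and these have
  product expansions in \<open>nome (z / 2) = exp (2 pi i z / 4)\<close>, the local parameter at a
  cusp of width 4.\<close>

lemma wx_moebius_meromorphic_at_cusp:
  assumes "A \<in> SL2"
  obtains Z0 Z1 Z2 where "Z0 meromorphic_on {0}" "Z1 meromorphic_on {0}" "Z2 meromorphic_on {0}"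
    "\<And>z. Im z > 0 \<Longrightarrow> wx0 (act A z) = Z0 (nome (z / 2))"
    "\<And>z. Im z > 0 \<Longrightarrow> wx1 (act A z) = Z1 (nome (z / 2))"
    "\<And>z. Im z > 0 \<Longrightarrow> wx2 (act A z) = Z2 (nome (z / 2))"
proof -
  have n: "norm (w ^ 4) < 1" if "w \<in> ball 0 1" for w :: complex
    using that by (simp add: norm_power power_less_one_iff)
  have qm: "(\<lambda>w. qprod (c * w ^ k) (w ^ 4)) meromorphic_on {0}" for c k
  proof -
    have "(\<lambda>w. qprod (c * w ^ k) (w ^ 4)) holomorphic_on ball 0 1"
      using n by (intro qprod_holomorphic holomorphic_intros) auto
    thus ?thesis
      by (intro analytic_on_imp_meromorphic_on holomorphic_on_imp_analytic_at[of _ "ball 0 1"]) auto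
  qed
  have X: "\<exists>Z. Z meromorphic_on {0} \<and> (\<forall>z. Im z > 0 \<longrightarrow> f z = Z (nome (z / 2)))" if "f \<in> {wx0, wx1, wx2}" for f
  proof -
    have e: "wx0 z = inverse (nome (z / 2)) * qprod (1 * nome (z / 2) ^ 2) (nome (z / 2) ^ 4) ^ 12"
      "wx1 z = - \<i> * inverse (nome (z / 2)) * qprod (- 1 * nome (z / 2) ^ 2) (nome (z / 2) ^ 4) ^ 12"
      "wx2 z = 64 * \<i> * nome (z / 2) ^ 2 * qprod (1 * nome (z / 2) ^ 4) (nome (z / 2) ^ 4) ^ 12"
      if "Im z > 0" for z
    proof -
      have "nome z = nome (z / 2) ^ 2" "(nome z)\<^sup>2 = nome (z / 2) ^ 4"
        by (simp_all add: nome_power)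
      thus "wx0 z = inverse (nome (z / 2)) * qprod (1 * nome (z / 2) ^ 2) (nome (z / 2) ^ 4) ^ 12"
        "wx1 z = - \<i> * inverse (nome (z / 2)) * qprod (- 1 * nome (z / 2) ^ 2) (nome (z / 2) ^ 4) ^ 12"
        "wx2 z = 64 * \<i> * nome (z / 2) ^ 2 * qprod (1 * nome (z / 2) ^ 4) (nome (z / 2) ^ 4) ^ 12"
        by (simp_all only: wx_qprod[OF that] nome_minus mult_1 mult_minus1)
    qed
    show ?thesis
      using that
    proof (elim insertE emptyE)
      assume [simp]: "f = wx0"
      show ?thesis
        by (intro exI[of _ "\<lambda>w. inverse w * qprod (1 * w ^ 2) (w ^ 4) ^ 12"] conjI allI impI meromorphic_intros qm)
           (simp_all only: e \<open>f = _\<close>)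
    next
      assume [simp]: "f = wx1"
      show ?thesis
        by (intro exI[of _ "\<lambda>w. - \<i> * inverse w * qprod (- 1 * w ^ 2) (w ^ 4) ^ 12"] conjI allI impI meromorphic_intros qm)
           (simp_all only: e \<open>f = _\<close>)
    next
      assume [simp]: "f = wx2"
      show ?thesis
        by (intro exI[of _ "\<lambda>w. 64 * \<i> * w ^ 2 * qprod (1 * w ^ 4) (w ^ 4) ^ 12"] conjI allI impI meromorphic_intros qm)
           (simp_all only: e \<open>f = _\<close>)
    qed
  qed
  have Y: "\<exists>Z. Z meromorphic_on {0} \<and> (\<forall>z. Im z > 0 \<longrightarrow> s * wcusp c d z = Z (nome (z / 2)))" for s c d
  proof -
    have "wcusp c d = (if even c then if even d then (\<lambda>_. 0) else if c mod 4 = 0 then wx2 else (\<lambda>z. - wx2 z)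
     else if even d then if d mod 4 = 0 then wx1 else (\<lambda>z. - wx1 z)
     else if c mod 4 = d mod 4 then wx0 else (\<lambda>z. - wx0 z))"
      by (rule ext) (simp add: wcusp_def)
    hence "wcusp c d \<in> {\<lambda>_. 0, \<lambda>z. 1 * wx0 z, \<lambda>z. - 1 * wx0 z, \<lambda>z. 1 * wx1 z, \<lambda>z. - 1 * wx1 z,
        \<lambda>z. 1 * wx2 z, \<lambda>z. - 1 * wx2 z}"
      by (simp split: if_split_asm)
    hence "wcusp c d = (\<lambda>_. 0) \<or> (\<exists>f\<in>{wx0, wx1, wx2}. \<exists>t. wcusp c d = (\<lambda>z. t * f z))"
      by blast
    thus ?thesis
    proof
      assume "wcusp c d = (\<lambda>_. 0)"
      thus ?thesis
        by (intro exI[of _ "\<lambda>_. 0"]) auto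
    next
      assume "\<exists>f\<in>{wx0, wx1, wx2}. \<exists>t. wcusp c d = (\<lambda>z. t * f z)"
      then obtain f t where f: "f \<in> {wx0, wx1, wx2}" "wcusp c d = (\<lambda>z. t * f z)"
        by blast
      then obtain Z where "Z meromorphic_on {0}" "\<And>z. Im z > 0 \<Longrightarrow> f z = Z (nome (z / 2))"
        using X by blast
      thus ?thesis
        by (intro exI[of _ "\<lambda>w. s * (t * Z w)"]) (auto intro!: meromorphic_intros simp: f)
    qed
  qed
  obtain s where "\<And>c d z. Im z > 0 \<Longrightarrow> wcusp c d (act A z) =
       s * wcusp (c * m11 A + d * m21 A) (c * m12 A + d * m22 A) z"
    using wcusp_moebius[OF assms] by metis
  hence "\<exists>Z. Z meromorphic_on {0} \<and> (\<forall>z. Im z > 0 \<longrightarrow> wcusp c d (act A z) = Z (nome (z / 2)))" for c d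
    using Y by simp
  from this[of 1 1] this[of 1 0] this[of 0 1] show ?thesis
    using that by auto
qed

text \<open>The value of \<open>weber_pullback 2\<close> computed from a given representative,
  before passing to classes.\<close>

definition pullback :: "(complex^4 \<Rightarrow> complex) \<Rightarrow> (complex^4 \<Rightarrow> complex) \<Rightarrow> complex \<Rightarrow> complex" where
  "pullback F G = normalize_mero (\<lambda>\<tau>. F (wpoint \<tau>) / G (wpoint \<tau>))"

lemma quotient_meromorphic:
  assumes "is_form d F" "is_form e G"
  shows "(\<lambda>z. F (wpoint z) / G (wpoint z)) meromorphic_on \<H>"
  using form_wpoint_holomorphic[OF assms(1)] form_wpoint_holomorphic[OF assms(2)]
  by (intro meromorphic_intros analytic_on_imp_meromorphic_on) (simp_all add: analytic_on_open open_upper_half_plane)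

lemma pullback_modular_function:
  assumes "is_form d F" "is_form e G"
  shows "is_modular_function (\<Gamma>4) (pullback F G)"
  unfolding is_modular_function_def
proof (intro conjI ballI allI impI)
  show "pullback F G nicely_meromorphic_on \<H>"
    unfolding pullback_def by (intro normalize_nicely_meromorphic quotient_meromorphic[OF assms])
  show "pullback F G t = 0" if "t \<notin> \<H>" for t
    using that by (simp add: pullback_def normalize_mero_def)
  show "pullback F G (act A t) = pullback F G t"
    if g: "g \<in> \<Gamma>4" and A: "A \<in> g" and t: "t \<in> \<H>" for g A t
  proof -
    have "g \<in> weber_kernel 2"
      using g by (simp add: weber_kernel_2)
    hence A': "A \<in> SL2" and inv: "\<And>z. Im z > 0 \<Longrightarrow> wx0 (act A z) = wx0 z"
      "\<And>z. Im z > 0 \<Longrightarrow> wx1 (act A z) = wx1 z" "\<And>z. Im z > 0 \<Longrightarrow> wx2 (act A z) = wx2 z"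
      using A by (auto simp: weber_kernel_def carrier_PSL2Z wx0_def wx1_def wx2_def SL2Z_iff)
    have "pullback F G (act A t) = normalize_mero (\<lambda>z. F (wpoint (act A z)) / G (wpoint (act A z))) t"
      unfolding pullback_def using t by (simp add: normalize_moebius_act[OF A'])
    also have "normalize_mero (\<lambda>z. F (wpoint (act A z)) / G (wpoint (act A z))) = pullback F G"
      unfolding pullback_def by (intro gen_eq_imp_normalize_eq gen_eqI) (simp add: wpoint inv)
    finally show ?thesis .
  qed
  show "meromorphic_at_ioo (\<lambda>t. pullback F G (act A t))" if A: "A \<in> SL2" for A
  proof -
    obtain Z0 Z1 Z2 where Z: "Z0 meromorphic_on {0}" "Z1 meromorphic_on {0}" "Z2 meromorphic_on {0}"
      "\<And>t. Im t > 0 \<Longrightarrow> wx0 (act A t) = Z0 (nome (t / 2))"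
      "\<And>t. Im t > 0 \<Longrightarrow> wx1 (act A t) = Z1 (nome (t / 2))"
      "\<And>t. Im t > 0 \<Longrightarrow> wx2 (act A t) = Z2 (nome (t / 2))"
      by (rule wx_moebius_meromorphic_at_cusp[OF A]) blast
    define Q where "Q = (\<lambda>w. F (vector [Z0 w, Z1 w, Z2 w, 1]) / G (vector [Z0 w, Z1 w, Z2 w, 1]))"
    have "(\<lambda>w. F (vector [Z0 w, Z1 w, Z2 w, 1])) meromorphic_on {0}"
      by (rule form_on_curve_closure[OF assms(1), where P = "\<lambda>f. f meromorphic_on {0}"])
         (auto intro!: meromorphic_intros Z)
    moreover have "(\<lambda>w. G (vector [Z0 w, Z1 w, Z2 w, 1])) meromorphic_on {0}"
      by (rule form_on_curve_closure[OF assms(2), where P = "\<lambda>f. f meromorphic_on {0}"])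
         (auto intro!: meromorphic_intros Z)
    ultimately have Q: "Q meromorphic_on {0}"
      unfolding Q_def by (intro meromorphic_intros)
    \<comment> \<open>On this punctured disc \<open>Q\<close> has no poles, so normalisation changes
      no value and the equality with \<open>Q\<close> holds at every point close to the
      cusp.\<close>
    then obtain r where r: "r > 0" "Q analytic_on ball 0 r - {0}"
      unfolding meromorphic_at_iff isolated_singularity_at_def by blast
    have eq: "F (wpoint (act A t)) / G (wpoint (act A t)) = Q (nome (t / 2))" if "Im t > 0" for t
      using that by (simp add: wpoint Z Q_def)
    have nt: "((\<lambda>t. nome (t / 2)) \<longlongrightarrow> 0) cusp"
    proof -
      have "filterlim (\<lambda>t :: complex. t / 2) cusp cusp"
        unfolding filterlim_iff
      proof (intro allI impI)
        fix P :: "complex \<Rightarrow> bool" assume "eventually P cusp"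
        then obtain y where "\<And>t. Im t > y \<Longrightarrow> P t"
          unfolding eventually_cusp by blast
        thus "eventually (\<lambda>t. P (t / 2)) cusp"
          unfolding eventually_cusp by (intro exI[of _ "2 * y"]) auto
      qed
      thus ?thesis
        by (rule filterlim_compose[OF nome_tendsto_cusp])
    qed
    hence "eventually (\<lambda>t. nome (t / 2) \<in> ball 0 r) cusp"
      using r(1) by (intro topological_tendstoD) auto
    then obtain y where y: "\<And>t. Im t > y \<Longrightarrow> nome (t / 2) \<in> ball 0 r"
      unfolding eventually_cusp by blast
    have "pullback F G (act A t) = Q (exp (2 * of_real pi * \<i> * t / of_nat 4))" if t: "Im t > max 0 y" for t
    proof -
      have "pullback F G (act A t) = normalize_mero (\<lambda>z. F (wpoint (act A z)) / G (wpoint (act A z))) t"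
        unfolding pullback_def using t by (simp add: normalize_moebius_act[OF A])
      also have "\<dots> = normalize_mero (\<lambda>z. Q (nome (z / 2))) t"
        by (intro fun_cong[OF gen_eq_imp_normalize_eq] gen_eqI) (simp add: eq)
      also have "\<dots> = Q (nome (t / 2))"
      proof -
        have "(Q \<circ> (\<lambda>z. nome (z / 2))) analytic_on {t}"
        proof (rule analytic_on_compose)
          show "(\<lambda>z. nome (z / 2)) analytic_on {t}"
            unfolding nome_def by (intro analytic_intros) auto
          show "Q analytic_on (\<lambda>z. nome (z / 2)) ` {t}"
            by (rule analytic_on_subset[OF r(2)]) (use y t in auto)
        qed
        thus ?thesis
          using t by (simp add: normalize_mero_def o_def)
      qed
      also have "nome (t / 2) = exp (2 * of_real pi * \<i> * t / of_nat 4)"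
        unfolding nome_def by (rule arg_cong[where f = exp]) simp
      finally show ?thesis .
    qed
    thus ?thesis
      unfolding meromorphic_at_ioo_def using Q by (intro exI[of _ 4] conjI exI[of _ Q] exI[of _ "max 0 y"]) auto
  qed
qed

section \<open>The function field and the pullback homomorphism\<close>

lemma form_fractions_iff:
  "(F, G) \<in> form_fractions W2 \<longleftrightarrow>
     (\<exists>d. is_form d F \<and> is_form d G) \<and> \<not> (\<forall>z. Im z > 0 \<longrightarrow> G (wpoint z) = 0)"
  unfolding form_fractions_def using vanishes_on_weber_curve by auto

lemma fraction_rel_iff:
  "((F, G), (F', G')) \<in> fraction_rel W2 \<longleftrightarrow>
     (F, G) \<in> form_fractions W2 \<and> (F', G') \<in> form_fractions W2 \<and>
     (\<forall>z. Im z > 0 \<longrightarrow> F (wpoint z) * G' (wpoint z) = F' (wpoint z) * G (wpoint z))"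
proof -
  have "vanishes_on (\<lambda>v. F v * G' v - F' v * G v) (weber_curve 2) \<longleftrightarrow>
      (\<forall>z. Im z > 0 \<longrightarrow> F (wpoint z) * G' (wpoint z) = F' (wpoint z) * G (wpoint z))"
    if ff: "(F, G) \<in> form_fractions W2" "(F', G') \<in> form_fractions W2"
  proof -
    obtain d e where "is_form d F" "is_form d G" "is_form e F'" "is_form e G'"
      using ff unfolding form_fractions_iff by blast
    hence "is_form (d + e) (\<lambda>v. F v * G' v)" "is_form (d + e) (\<lambda>v. F' v * G v)"
      using is_form_mult[of d F e G'] is_form_mult[of e F' d G] by (simp_all add: add.commute)
    hence "is_form (d + e) (\<lambda>v. F v * G' v - F' v * G v)"
      by (rule is_form_diff)
    thus ?thesis
      by (simp add: vanishes_on_weber_curve)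
  qed
  thus ?thesis
    by (auto simp: fraction_rel_def)
qed

lemma pullback_gen_eq:
  assumes "(F, G) \<in> form_fractions W2"
  shows "gen_eq (pullback F G) (\<lambda>z. F (wpoint z) / G (wpoint z))"
proof -
  obtain d where "is_form d F" "is_form d G"
    using assms unfolding form_fractions_iff by blast
  thus ?thesis
    unfolding pullback_def by (rule gen_eq_normalize[OF quotient_meromorphic])
qed

lemma denominator_eventually_nonzero:
  assumes "(F, G) \<in> form_fractions W2" "Im z > 0"
  shows "eventually (\<lambda>w. G (wpoint w) \<noteq> 0) (at z)"
  using assms by (auto simp: form_fractions_iff intro!: holomorphic_eventually_nonzero form_wpoint_holomorphic)

text \<open>Cross-multiplication is legitimate away from the zeros of the denominators, which are
  isolated. In the converse direction the identity theorem extends the relation to the whole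
  half-plane.\<close>

lemma pullback_eq_iff:
  assumes FG: "(F, G) \<in> form_fractions W2" "(F', G') \<in> form_fractions W2"
  shows "pullback F G = pullback F' G' \<longleftrightarrow> ((F, G), (F', G')) \<in> fraction_rel W2"
proof
  assume "((F, G), (F', G')) \<in> fraction_rel W2"
  hence eq: "\<And>t. Im t > 0 \<Longrightarrow> F (wpoint t) * G' (wpoint t) = F' (wpoint t) * G (wpoint t)"
    by (simp add: fraction_rel_iff)
  have "gen_eq (\<lambda>t. F (wpoint t) / G (wpoint t)) (\<lambda>t. F' (wpoint t) / G' (wpoint t))"
    unfolding gen_eq_def
  proof (intro allI impI)
    fix z :: complex assume z: "Im z > 0"
    show "eventually (\<lambda>t. F (wpoint t) / G (wpoint t) = F' (wpoint t) / G' (wpoint t)) (at z)"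
      using eventually_upper[OF z] denominator_eventually_nonzero[OF FG(1) z] denominator_eventually_nonzero[OF FG(2) z]
      by eventually_elim (use eq in \<open>auto simp: field_simps\<close>)
  qed
  thus "pullback F G = pullback F' G'"
    unfolding pullback_def by (rule gen_eq_imp_normalize_eq)
next
  assume "pullback F G = pullback F' G'"
  hence "gen_eq (pullback F G) (\<lambda>t. F' (wpoint t) / G' (wpoint t))"
    using pullback_gen_eq[OF FG(2)] by simp
  hence gen_eq: "gen_eq (\<lambda>t. F (wpoint t) / G (wpoint t)) (\<lambda>t. F' (wpoint t) / G' (wpoint t))"
    by (rule gen_eq_trans[OF gen_eq_sym[OF pullback_gen_eq[OF FG(1)]]])
  obtain d e where forms: "is_form d F" "is_form d G" "is_form e F'" "is_form e G'"
    using FG unfolding form_fractions_iff by blast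
  let ?h = "\<lambda>t. F (wpoint t) * G' (wpoint t) - F' (wpoint t) * G (wpoint t)"
  have "\<forall>t. Im t > 0 \<longrightarrow> ?h t = 0"
  proof (rule ccontr)
    assume "\<not> (\<forall>t. Im t > 0 \<longrightarrow> ?h t = 0)"
    hence "eventually (\<lambda>t. ?h t \<noteq> 0) (at \<i>)"
      using forms by (intro holomorphic_eventually_nonzero holomorphic_intros form_wpoint_holomorphic) auto
    moreover have "eventually (\<lambda>t. F (wpoint t) / G (wpoint t) = F' (wpoint t) / G' (wpoint t)) (at \<i>)"
      using gen_eq by (simp add: gen_eq_def)
    moreover have "eventually (\<lambda>t. G (wpoint t) \<noteq> 0) (at \<i>)" "eventually (\<lambda>t. G' (wpoint t) \<noteq> 0) (at \<i>)"
      using FG by (auto intro: denominator_eventually_nonzero)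
    ultimately have "eventually (\<lambda>_. False) (at \<i>)"
      by eventually_elim (auto simp: field_simps)
    thus False
      by simp
  qed
  thus "((F, G), (F', G')) \<in> fraction_rel W2"
    using FG by (simp add: fraction_rel_iff)
qed

text \<open>On fractions the relation is equality of pullbacks, so symmetry and transitivity are
  inherited from equality of functions.\<close>

lemma equiv_fraction_rel: "equiv (form_fractions W2) (fraction_rel W2)"
proof (rule equivI)
  have iff: "(x, y) \<in> fraction_rel W2 \<longleftrightarrow> x \<in> form_fractions W2 \<and>
      y \<in> form_fractions W2 \<and> pullback (fst x) (snd x) = pullback (fst y) (snd y)" for x y
    using pullback_eq_iff[of "fst x" "snd x" "fst y" "snd y"] by (cases x; cases y) (auto simp: fraction_rel_def)
  show "fraction_rel W2 \<subseteq> form_fractions W2 \<times> form_fractions W2"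
    using iff by auto
  show "refl_on (form_fractions W2) (fraction_rel W2)"
    by (rule refl_onI) (use iff in auto)
  show "sym (fraction_rel W2)"
    by (rule symI) (use iff in auto)
  show "trans (fraction_rel W2)"
    by (rule transI) (use iff in auto)
qed

abbreviation frac_class :: "(complex^4 \<Rightarrow> complex) \<Rightarrow> (complex^4 \<Rightarrow> complex) \<Rightarrow> fraction set" where
  "frac_class F G \<equiv> fraction_rel W2 `` {(F, G)}"

lemma frac_class_memD:
  assumes "(F', G') \<in> frac_class F G"
  shows "(F', G') \<in> form_fractions W2" "frac_class F' G' = frac_class F G" "pullback F' G' = pullback F G"
  using assms equiv_class_eq[OF equiv_fraction_rel, of "(F, G)" "(F', G')"] pullback_eq_iff[of F G F' G']
  by (auto simp: fraction_rel_iff)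

lemma frac_class_self: "(F, G) \<in> form_fractions W2 \<Longrightarrow> (F, G) \<in> frac_class F G"
  by (rule equiv_class_self[OF equiv_fraction_rel])

lemma weber_pullback_frac_class:
  assumes "(F, G) \<in> form_fractions W2"
  shows "weber_pullback 2 (frac_class F G) = pullback F G"
proof -
  define x where "x = (SOME x. x \<in> frac_class F G)"
  have "x \<in> frac_class F G"
    unfolding x_def using frac_class_self[OF assms] by (rule someI)
  hence "pullback (fst x) (snd x) = pullback F G"
    using frac_class_memD(3)[of "fst x" "snd x"] by simp
  thus ?thesis
    unfolding weber_pullback_def x_def[symmetric] by (simp add: pullback_def case_prod_beta)
qed

lemma form_fractions_mult:
  assumes "(F, G) \<in> form_fractions W2" "(F', G') \<in> form_fractions W2"
  shows "((\<lambda>v. F v * F' v), (\<lambda>v. G v * G' v)) \<in> form_fractions W2"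
    "((\<lambda>v. F v * G' v + F' v * G v), (\<lambda>v. G v * G' v)) \<in> form_fractions W2"
proof -
  obtain d e where forms: "is_form d F" "is_form d G" "is_form e F'" "is_form e G'"
    using assms unfolding form_fractions_iff by blast
  have nz: "\<not> (\<forall>z. Im z > 0 \<longrightarrow> G (wpoint z) * G' (wpoint z) = 0)"
    using holomorphic_mult_eq_0[OF form_wpoint_holomorphic[OF forms(2)] form_wpoint_holomorphic[OF forms(4)]] assms
    by (auto simp: form_fractions_iff)
  have "is_form (d + e) (\<lambda>v. F v * G' v)" "is_form (d + e) (\<lambda>v. F' v * G v)"
    using is_form_mult[of d F e G'] is_form_mult[of e F' d G] forms by (simp_all add: add.commute)
  hence "is_form (d + e) (\<lambda>v. F v * G' v + F' v * G v)"
    by (rule is_form_add)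
  moreover have "is_form (d + e) (\<lambda>v. F v * F' v)" "is_form (d + e) (\<lambda>v. G v * G' v)"
    using forms by (auto intro: is_form_mult)
  ultimately show "((\<lambda>v. F v * F' v), (\<lambda>v. G v * G' v)) \<in> form_fractions W2"
    "((\<lambda>v. F v * G' v + F' v * G v), (\<lambda>v. G v * G' v)) \<in> form_fractions W2"
    using nz by (auto simp: form_fractions_iff)
qed

lemma pullback_mult:
  assumes "(F, G) \<in> form_fractions W2" "(F', G') \<in> form_fractions W2"
  shows "pullback (\<lambda>v. F v * F' v) (\<lambda>v. G v * G' v) = normalize_mero (\<lambda>z. pullback F G z * pullback F' G' z)"
proof -
  have "gen_eq (\<lambda>z. pullback F G z * pullback F' G' z) (\<lambda>z. (F (wpoint z) / G (wpoint z)) * (F' (wpoint z) / G' (wpoint z)))"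
    by (rule gen_eq_op[of _ _ _ _ "(*)"]) (intro pullback_gen_eq assms)+
  hence "normalize_mero (\<lambda>z. pullback F G z * pullback F' G' z)
      = normalize_mero (\<lambda>z. (F (wpoint z) / G (wpoint z)) * (F' (wpoint z) / G' (wpoint z)))"
    by (rule gen_eq_imp_normalize_eq)
  thus ?thesis
    by (simp add: pullback_def)
qed

lemma pullback_add:
  assumes "(F, G) \<in> form_fractions W2" "(F', G') \<in> form_fractions W2"
  shows "pullback (\<lambda>v. F v * G' v + F' v * G v) (\<lambda>v. G v * G' v) = normalize_mero (\<lambda>t. pullback F G t + pullback F' G' t)"
proof -
  have "gen_eq (\<lambda>t. pullback F G t + pullback F' G' t) (\<lambda>t. (F (wpoint t) / G (wpoint t)) + (F' (wpoint t) / G' (wpoint t)))"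
    by (rule gen_eq_op[of _ _ _ _ "(+)"]) (intro pullback_gen_eq assms)+
  also have "gen_eq \<dots> (\<lambda>t. (F (wpoint t) * G' (wpoint t) + F' (wpoint t) * G (wpoint t)) / (G (wpoint t) * G' (wpoint t)))"
    unfolding gen_eq_def
  proof (intro allI impI)
    fix z :: complex assume z: "Im z > 0"
    show "eventually (\<lambda>t. F (wpoint t) / G (wpoint t) + F' (wpoint t) / G' (wpoint t) =
        (F (wpoint t) * G' (wpoint t) + F' (wpoint t) * G (wpoint t)) / (G (wpoint t) * G' (wpoint t))) (at z)"
      using denominator_eventually_nonzero[OF assms(1) z] denominator_eventually_nonzero[OF assms(2) z]
      by eventually_elim (auto simp: field_simps)
  qed
  finally show ?thesis
    unfolding pullback_def by (intro gen_eq_imp_normalize_eq[symmetric])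
qed

text \<open>The unions in \<open>function_field\<close> range over representatives; they collapse
  once the result is independent of the choice.\<close>

lemma UN_pair_const:
  assumes "r \<noteq> {}" "s \<noteq> {}" "\<And>F G F' G'. (F, G) \<in> r \<Longrightarrow> (F', G') \<in> s \<Longrightarrow> h F G F' G' = c"
  shows "(\<Union>(F, G)\<in>r. \<Union>(F', G')\<in>s. h F G F' G') = c"
proof (rule SUP_eq_const[OF assms(1)])
  fix x assume "x \<in> r"
  moreover have "(\<Union>y\<in>s. case y of (F', G') \<Rightarrow> h (fst x) (snd x) F' G') = c" if "x \<in> r"
  proof (rule SUP_eq_const[OF assms(2)])
    fix y assume "y \<in> s"
    thus "(case y of (F', G') \<Rightarrow> h (fst x) (snd x) F' G') = c"
      using that assms(3)[of "fst x" "snd x" "fst y" "snd y"] by (simp add: case_prod_beta)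
  qed
  ultimately show "(case x of (F, G) \<Rightarrow> \<Union>(F', G')\<in>s. h F G F' G') = c"
    by (simp add: case_prod_beta)
qed

lemma frac_class_eqI:
  assumes "(F, G) \<in> form_fractions W2" "(F', G') \<in> form_fractions W2" "pullback F G = pullback F' G'"
  shows "frac_class F G = frac_class F' G'"
  using assms equiv_class_eq[OF equiv_fraction_rel] pullback_eq_iff by blast

lemma function_field_ops:
  assumes "(F, G) \<in> form_fractions W2" "(F', G') \<in> form_fractions W2"
  shows "frac_class F G \<otimes>\<^bsub>function_field W2\<^esub> frac_class F' G' = frac_class (\<lambda>v. F v * F' v) (\<lambda>v. G v * G' v)"
    "frac_class F G \<oplus>\<^bsub>function_field W2\<^esub> frac_class F' G' =
       frac_class (\<lambda>v. F v * G' v + F' v * G v) (\<lambda>v. G v * G' v)"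
proof -
  have ne: "frac_class F G \<noteq> {}" "frac_class F' G' \<noteq> {}"
    using assms frac_class_self by blast+
  have eq: "frac_class (\<lambda>v. F1 v * F2 v) (\<lambda>v. G1 v * G2 v) = frac_class (\<lambda>v. F v * F' v) (\<lambda>v. G v * G' v)"
    "frac_class (\<lambda>v. F1 v * G2 v + F2 v * G1 v) (\<lambda>v. G1 v * G2 v) = frac_class (\<lambda>v. F v * G' v + F' v * G v) (\<lambda>v. G v * G' v)"
    if "(F1, G1) \<in> frac_class F G" "(F2, G2) \<in> frac_class F' G'" for F1 G1 F2 G2
    using frac_class_memD[OF that(1)] frac_class_memD[OF that(2)] assms
    by - (rule frac_class_eqI; simp add: form_fractions_mult pullback_mult pullback_add)+
  show "frac_class F G \<otimes>\<^bsub>function_field W2\<^esub> frac_class F' G' = frac_class (\<lambda>v. F v * F' v) (\<lambda>v. G v * G' v)"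
    unfolding function_field_def by simp (rule UN_pair_const[OF ne eq(1)])
  show "frac_class F G \<oplus>\<^bsub>function_field W2\<^esub> frac_class F' G' =
       frac_class (\<lambda>v. F v * G' v + F' v * G v) (\<lambda>v. G v * G' v)"
    unfolding function_field_def by simp (rule UN_pair_const[OF ne eq(2)])
qed

text \<open>Injectivity and compatibility with the operations come from
  \<open>pullback_eq_iff\<close> and the rules for sums and products, so surjectivity is the
  remaining content.\<close>

lemma weber_curve_is_modular_curveI:
  assumes surj: "\<And>f. is_modular_function (\<Gamma>4) f \<Longrightarrow>
    \<exists>F G. (F, G) \<in> form_fractions W2 \<and> pullback F G = f"
  shows "weber_curve_is_modular_curve 2 (\<Gamma>4)"
proof -
  let ?W = "function_field W2" and ?M = "modular_function_field (\<Gamma>4)"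
  have carrier: "\<exists>F G. (F, G) \<in> form_fractions W2 \<and> r = frac_class F G" if "r \<in> carrier ?W" for r
    using that by (auto simp: function_field_def elim!: quotientE)
  have in_carrier: "frac_class F G \<in> carrier ?W" if "(F, G) \<in> form_fractions W2" for F G
    using that by (simp add: function_field_def quotientI)
  have one: "((\<lambda>_. 1), (\<lambda>_. 1)) \<in> form_fractions W2"
    unfolding form_fractions_iff by (auto intro!: is_form_const exI[of _ \<i>])
  have "weber_pullback 2 \<in> ring_hom ?W ?M"
  proof (rule ring_hom_memI)
    fix r assume "r \<in> carrier ?W"
    then obtain F G where r: "(F, G) \<in> form_fractions W2" "r = frac_class F G"
      using carrier by blast
    thus "weber_pullback 2 r \<in> carrier ?M"
      by (auto simp: weber_pullback_frac_class modular_function_field_def form_fractions_iff intro: pullback_modular_function)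
    fix s assume "s \<in> carrier ?W"
    then obtain F' G' where s: "(F', G') \<in> form_fractions W2" "s = frac_class F' G'"
      using carrier by blast
    show "weber_pullback 2 (r \<otimes>\<^bsub>?W\<^esub> s) = weber_pullback 2 r \<otimes>\<^bsub>?M\<^esub> weber_pullback 2 s"
      using r s form_fractions_mult[OF r(1) s(1)]
      by (simp add: function_field_ops weber_pullback_frac_class pullback_mult modular_function_field_def)
    show "weber_pullback 2 (r \<oplus>\<^bsub>?W\<^esub> s) = weber_pullback 2 r \<oplus>\<^bsub>?M\<^esub> weber_pullback 2 s"
      using r s form_fractions_mult[OF r(1) s(1)]
      by (simp add: function_field_ops weber_pullback_frac_class pullback_add modular_function_field_def)
  next
    show "weber_pullback 2 \<one>\<^bsub>?W\<^esub> = \<one>\<^bsub>?M\<^esub>"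
      using weber_pullback_frac_class[OF one] by (simp add: function_field_def modular_function_field_def pullback_def)
  qed
  moreover have "bij_betw (weber_pullback 2) (carrier ?W) (carrier ?M)"
    unfolding bij_betw_def
  proof
    show "inj_on (weber_pullback 2) (carrier ?W)"
    proof (rule inj_onI)
      fix r s assume rs: "r \<in> carrier ?W" "s \<in> carrier ?W" and eq: "weber_pullback 2 r = weber_pullback 2 s"
      obtain F G where r: "(F, G) \<in> form_fractions W2" "r = frac_class F G"
        using carrier[OF rs(1)] by blast
      obtain F' G' where s: "(F', G') \<in> form_fractions W2" "s = frac_class F' G'"
        using carrier[OF rs(2)] by blast
      have "pullback F G = pullback F' G'"
        using eq unfolding r(2) s(2) weber_pullback_frac_class[OF r(1)] weber_pullback_frac_class[OF s(1)] .
      thus "r = s"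
        unfolding r(2) s(2) by (rule frac_class_eqI[OF r(1) s(1)])
    qed
    show "weber_pullback 2 ` carrier ?W = carrier ?M"
    proof (intro equalityI subsetI)
      fix f assume "f \<in> weber_pullback 2 ` carrier ?W"
      thus "f \<in> carrier ?M"
        using \<open>weber_pullback 2 \<in> ring_hom ?W ?M\<close> by (auto dest: ring_hom_closed)
    next
      fix f assume "f \<in> carrier ?M"
      hence "is_modular_function (\<Gamma>4) f"
        by (simp add: modular_function_field_def)
      then obtain F G where FG: "(F, G) \<in> form_fractions W2" "pullback F G = f"
        using surj by blast
      thus "f \<in> weber_pullback 2 ` carrier ?W"
        using weber_pullback_frac_class[OF FG(1)] in_carrier[OF FG(1)] by (intro image_eqI[of _ _ "frac_class F G"]) auto
    qed
  qed
  ultimately show ?thesis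
    unfolding weber_curve_is_modular_curve_def ring_iso_def by blast
qed

section \<open>Conjugates and poles of modular functions\<close>

text \<open>At most a pole at the cusp, expressed as a growth bound. Laurent expansions of different
  functions may use different denominators \<open>N\<close>, whereas such bounds can be added and
  multiplied directly.\<close>

definition moderate :: "(complex \<Rightarrow> complex) \<Rightarrow> bool" where
  "moderate c \<longleftrightarrow> (\<exists>m B. eventually (\<lambda>\<tau>. norm ((nome \<tau>)\<^sup>2 ^ m * c \<tau>) \<le> B) cusp)"

lemma moderate_raise:
  assumes "eventually (\<lambda>z. norm ((nome z)\<^sup>2 ^ m * c z) \<le> B) cusp" "m \<le> n"
  shows "eventually (\<lambda>z. norm ((nome z)\<^sup>2 ^ n * c z) \<le> B) cusp"
  using assms(1) eventually_cusp_gt[of 0]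
proof eventually_elim
  case (elim z)
  have "norm ((nome z)\<^sup>2 ^ n * c z) = norm ((nome z)\<^sup>2) ^ (n - m) * norm ((nome z)\<^sup>2 ^ m * c z)"
    using assms(2) by (simp add: norm_mult norm_power power_add[symmetric])
  also have "\<dots> \<le> 1 * B"
    using elim norm_nome_power_less_1[of z 2] by (intro mult_mono power_le_one) auto
  finally show ?case
    by simp
qed

lemma moderate_const: "moderate (\<lambda>_. c)"
  unfolding moderate_def by (intro exI[of _ 0] exI[of _ "norm c"]) simp

lemma moderate_add:
  assumes "moderate c" "moderate d"
  shows "moderate (\<lambda>z. c z + d z)"
proof -
  from assms obtain m B n C where "eventually (\<lambda>z. norm ((nome z)\<^sup>2 ^ m * c z) \<le> B) cusp"
    "eventually (\<lambda>z. norm ((nome z)\<^sup>2 ^ n * d z) \<le> C) cusp"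
    unfolding moderate_def by blast
  hence "eventually (\<lambda>z. norm ((nome z)\<^sup>2 ^ max m n * c z) \<le> B) cusp"
    "eventually (\<lambda>z. norm ((nome z)\<^sup>2 ^ max m n * d z) \<le> C) cusp"
    by (auto intro: moderate_raise)
  hence "eventually (\<lambda>z. norm ((nome z)\<^sup>2 ^ max m n * (c z + d z)) \<le> B + C) cusp"
    by eventually_elim (simp only: ring_distribs, rule norm_triangle_mono)
  thus ?thesis
    unfolding moderate_def by blast
qed

lemma moderate_mult:
  assumes "moderate c" "moderate d"
  shows "moderate (\<lambda>z. c z * d z)"
proof -
  from assms obtain m B n C where "eventually (\<lambda>z. norm ((nome z)\<^sup>2 ^ m * c z) \<le> B) cusp"
    "eventually (\<lambda>z. norm ((nome z)\<^sup>2 ^ n * d z) \<le> C) cusp"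
    unfolding moderate_def by blast
  hence "eventually (\<lambda>z. norm ((nome z)\<^sup>2 ^ (m + n) * (c z * d z)) \<le> B * C) cusp"
  proof eventually_elim
    case (elim z)
    have "norm ((nome z)\<^sup>2 ^ (m + n) * (c z * d z)) =
        norm ((nome z)\<^sup>2 ^ m * c z) * norm ((nome z)\<^sup>2 ^ n * d z)"
      unfolding norm_mult[symmetric] power_add by (simp only: mult_ac)
    also have "\<dots> \<le> B * C"
      using elim by (intro mult_mono) (auto intro: order_trans[OF norm_ge_zero])
    finally show ?case .
  qed
  thus ?thesis
    unfolding moderate_def by blast
qed

lemma moderate_cong:
  assumes "eventually (\<lambda>z. c z = d z) cusp" "moderate c"
  shows "moderate d"
proof -
  obtain m B where "eventually (\<lambda>z. norm ((nome z)\<^sup>2 ^ m * c z) \<le> B) cusp"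
    using assms(2) unfolding moderate_def by blast
  hence "eventually (\<lambda>z. norm ((nome z)\<^sup>2 ^ m * d z) \<le> B) cusp"
    using assms(1) by eventually_elim simp
  thus ?thesis
    unfolding moderate_def by blast
qed

lemma meromorphic_at_0_bounded:
  assumes "F meromorphic_on {0}"
  obtains n B where "eventually (\<lambda>w. norm (w ^ n * F w) \<le> B) (at 0)"
proof (cases "is_pole F 0")
  case True
  obtain r where r: "r > 0" "F analytic_on ball 0 r - {0}"
    using assms unfolding meromorphic_at_iff isolated_singularity_at_def by blast
  hence "F holomorphic_on ball 0 r - {0}"
    by (intro analytic_imp_holomorphic)
  from zorder_exist_pole[OF this _ _ True] r obtain s where s: "s > 0" "zor_poly F 0 holomorphic_on cball 0 s"
    "\<And>w. w \<in> cball 0 s - {0} \<Longrightarrow> F w = zor_poly F 0 w / w ^ nat (- zorder F 0)"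
    by auto
  have "bounded (zor_poly F 0 ` cball 0 s)"
    by (intro compact_imp_bounded compact_continuous_image holomorphic_on_imp_continuous_on s compact_cball)
  then obtain B where B: "\<And>w. w \<in> cball 0 s \<Longrightarrow> norm (zor_poly F 0 w) \<le> B"
    unfolding bounded_iff by (metis imageI)
  have "eventually (\<lambda>w. w \<in> ball 0 s - {0}) (at 0)"
    using s(1) by (intro eventually_at_in_open) auto
  hence "eventually (\<lambda>w. norm (w ^ nat (- zorder F 0) * F w) \<le> B) (at 0)"
    by eventually_elim (use s(3) B in simp)
  thus ?thesis
    by (rule that)
next
  case False
  then obtain c where "F \<midarrow>0\<rightarrow> c"
    using assms unfolding meromorphic_at_iff not_essential_def by blast
  hence "eventually (\<lambda>w. norm (F w) < norm c + 1) (at 0)"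
    by (intro order_tendstoD(2)[OF tendsto_norm]) auto
  hence "eventually (\<lambda>w. norm (w ^ 0 * F w) \<le> norm c + 1) (at 0)"
    by eventually_elim simp
  thus ?thesis
    by (rule that)
qed

lemma meromorphic_at_ioo_imp:
  assumes "meromorphic_at_ioo f"
  shows "moderate f" "eventually (\<lambda>t. f analytic_on {t}) cusp"
proof -
  obtain N F y where N: "N > 0" "F meromorphic_on {0}"
    "\<And>t. Im t > y \<Longrightarrow> f t = F (exp (2 * of_real pi * \<i> * t / of_nat N))"
    using assms unfolding meromorphic_at_ioo_def by blast
  define w where "w = (\<lambda>t. exp (2 * of_real pi * \<i> * t / of_nat N))"
  have wN: "w t ^ N = (nome t)\<^sup>2" for t
  proof -
    have "of_nat N * (2 * of_real pi * \<i> * t / of_nat N) = of_nat 2 * (of_real pi * \<i> * t)"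
      using N(1) by simp
    thus ?thesis
      unfolding w_def nome_def exp_of_nat_mult[symmetric] by (rule arg_cong)
  qed
  have norm_w: "norm (w t) = exp (- (2 * pi / N) * Im t)" for t
    using N(1) by (simp add: w_def Re_divide_of_nat)
  have "filterlim w (at 0) cusp"
  proof -
    have "((\<lambda>x. exp (- (2 * pi / N) * x)) \<longlongrightarrow> 0) at_top"
      using N(1) by real_asymp
    moreover have "filterlim Im at_top cusp"
      unfolding cusp_def by (rule filterlim_filtercomap)
    ultimately have "((\<lambda>t. exp (- (2 * pi / N) * Im t)) \<longlongrightarrow> 0) cusp"
      by (rule filterlim_compose)
    hence "(w \<longlongrightarrow> 0) cusp"
      by (subst tendsto_norm_zero_iff[symmetric]) (simp add: norm_w)
    thus ?thesis
      by (auto simp: filterlim_at w_def)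
  qed
  note lim = eventually_compose_filterlim[OF _ this]
  obtain n B where "eventually (\<lambda>w. norm (w ^ n * F w) \<le> B) (at 0)"
    using meromorphic_at_0_bounded[OF N(2)] .
  hence "eventually (\<lambda>t. norm (w t ^ n * F (w t)) \<le> B) cusp"
    by (rule lim)
  hence "eventually (\<lambda>t. norm ((nome t)\<^sup>2 ^ n * f t) \<le> B) cusp"
    using eventually_cusp_gt[of "max 0 y"]
  proof eventually_elim
    case (elim t)
    \<comment> \<open>\<open>w t ^ N\<close> is the square of the nome, so its \<open>n\<close>-th
      power is \<open>w t ^ (N * n)\<close>; the surplus exponent keeps the bound because
      \<open>norm (w t)\<close> is at most 1.\<close>
    have "n \<le> N * n"
      using N(1) by simp
    hence "norm ((nome t)\<^sup>2 ^ n * f t) = norm (w t) ^ (N * n - n) * norm (w t ^ n * F (w t))"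
      using elim(2) N(3)[of t]
      by (simp add: wN[symmetric] norm_mult norm_power w_def power_mult[symmetric] power_add[symmetric])
    also have "\<dots> \<le> 1 * B"
      using elim N(1) by (intro mult_mono power_le_one) (auto simp: norm_w)
    finally show ?case
      by simp
  qed
  thus "moderate f"
    unfolding moderate_def by blast
  obtain r where r: "r > 0" "F analytic_on ball 0 r - {0}"
    using N(2) unfolding meromorphic_at_iff isolated_singularity_at_def by blast
  have "eventually (\<lambda>w. w \<in> ball 0 r - {0}) (at 0)"
    using r(1) by (intro eventually_at_in_open) auto
  hence "eventually (\<lambda>t. w t \<in> ball 0 r - {0}) cusp"
    by (rule lim)
  thus "eventually (\<lambda>t. f analytic_on {t}) cusp"
    using eventually_cusp_gt[of y]
  proof eventually_elim
    case (elim t)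
    have "(F \<circ> w) analytic_on {t}"
    proof (rule analytic_on_compose)
      show "w analytic_on {t}"
        unfolding w_def using N(1) by (intro analytic_intros) auto
      show "F analytic_on w ` {t}"
        by (rule analytic_on_subset[OF r(2)]) (use elim in auto)
    qed
    also have "(F \<circ> w) analytic_on {t} \<longleftrightarrow> f analytic_on {t}"
    proof (rule analytic_at_cong)
      have "open {z. Im z > y}"
        by (rule open_halfspace_Im_gt)
      hence "eventually (\<lambda>z. z \<in> {z. Im z > y}) (nhds t)"
        using elim by (intro eventually_nhds_in_open) auto
      thus "eventually (\<lambda>z. (F \<circ> w) z = f z) (nhds t)"
        by eventually_elim (simp add: N(3) w_def)
    qed simp
    finally show ?case .
  qed
qed

text \<open>The slash action of weight zero. The value 0 off the half-plane makes conjugates that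
  agree on the half-plane equal as functions, so that they can be collected in a finite set.\<close>

definition slash :: "(complex \<Rightarrow> complex) \<Rightarrow> int^2^2 \<Rightarrow> complex \<Rightarrow> complex" where
  "slash f A = (\<lambda>\<tau>. if Im \<tau> > 0 then f (act A \<tau>) else 0)"

lemma slash_mult:
  assumes "A \<in> SL2" "B \<in> SL2"
  shows "slash (slash f A) B = slash f (A ** B)"
  using assms by (auto simp: slash_def fun_eq_iff moebius_act_mult moebius_act_upper)

definition Gamma4_invariant :: "(complex \<Rightarrow> complex) \<Rightarrow> bool" where
  "Gamma4_invariant f \<longleftrightarrow> (\<forall>g\<in>\<Gamma>4. \<forall>A\<in>g. \<forall>\<tau>. Im \<tau> > 0 \<longrightarrow> f (act A \<tau>) = f \<tau>)"

text \<open>The coefficients 1, 3, 9 make the digits of balanced ternary notation visible, so that the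
  24 conjugates of this function under the modular group are distinct.\<close>

definition wy :: "complex \<Rightarrow> complex" where
  "wy \<tau> = wx0 \<tau> + 3 * wx1 \<tau> + 9 * wx2 \<tau>"

lemma wy_moebius:
  assumes "A \<in> SL2"
  obtains s :: complex where "s = 1 \<or> s = - 1"
    "\<And>z. Im z > 0 \<Longrightarrow> wx0 (act A z) = s * wcusp (m11 A + m21 A) (m12 A + m22 A) z"
    "\<And>z. Im z > 0 \<Longrightarrow> wx1 (act A z) = s * wcusp (m11 A) (m12 A) z"
    "\<And>z. Im z > 0 \<Longrightarrow> wx2 (act A z) = s * wcusp (m21 A) (m22 A) z"
proof -
  obtain s :: complex where s: "s = 1 \<or> s = - 1" and
    wcusp: "\<And>c d z. Im z > 0 \<Longrightarrow> wcusp c d (act A z) = s * wcusp (c * m11 A + d * m21 A) (c * m12 A + d * m22 A) z"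
    using wcusp_moebius[OF assms] by metis
  show ?thesis
    using wcusp[of _ 1 1] wcusp[of _ 1 0] wcusp[of _ 0 1] by (intro that[OF s]) simp_all
qed

lemma wcusp_coefficients:
  obtains a b e :: int where "\<And>z. wcusp c d z = of_int a * wx0 z + of_int b * wx1 z + of_int e * wx2 z"
    "\<bar>a\<bar> \<le> 1" "\<bar>b\<bar> \<le> 1" "\<bar>e\<bar> \<le> 1"
proof (rule that)
  let ?a = "if odd c \<and> odd d then if c mod 4 = d mod 4 then 1 else - 1 else 0 :: int"
  let ?b = "if odd c \<and> even d then if d mod 4 = 0 then 1 else - 1 else 0 :: int"
  let ?e = "if even c \<and> odd d then if c mod 4 = 0 then 1 else - 1 else 0 :: int"
  show "wcusp c d z = of_int ?a * wx0 z + of_int ?b * wx1 z + of_int ?e * wx2 z" for z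
    by (auto simp: wcusp_def)
  show "\<bar>?a\<bar> \<le> 1" "\<bar>?b\<bar> \<le> 1" "\<bar>?e\<bar> \<le> 1"
    by auto
qed

text \<open>The last digits agree because a multiple of 3 of absolute value at most 2 is 0; after
  division by 3 the argument repeats.\<close>

lemma balanced_ternary_unique:
  fixes x y z u v w :: int
  assumes eq: "x + 3 * y + 9 * z = u + 3 * v + 9 * w"
    and "\<bar>x\<bar> \<le> 1" "\<bar>y\<bar> \<le> 1" "\<bar>u\<bar> \<le> 1" "\<bar>v\<bar> \<le> 1"
  shows "x = u \<and> y = v \<and> z = w"
proof -
  have 0: "k = 0" if "d = 3 * k" "\<bar>d\<bar> \<le> 2" for d k :: int
    using that by linarith
  have "x - u = 3 * (v - y + 3 * (w - z))" "\<bar>x - u\<bar> \<le> 2"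
    using assms by (simp_all add: algebra_simps)
  hence 1: "v - y + 3 * (w - z) = 0"
    by (rule 0)
  hence "v - y = 3 * (z - w)" "\<bar>v - y\<bar> \<le> 2"
    using assms by (simp_all add: algebra_simps)
  hence "z - w = 0"
    by (rule 0)
  with 1 show ?thesis
    using eq by auto
qed

lemma wy_invariant_imp:
  assumes A: "A \<in> SL2" and inv: "\<And>z. Im z > 0 \<Longrightarrow> wy (act A z) = wy z"
  shows "{A, - A} \<in> \<Gamma>4"
proof -
  obtain s' :: complex where s': "s' = 1 \<or> s' = - 1"
    "\<And>z. Im z > 0 \<Longrightarrow> wx0 (act A z) = s' * wcusp (m11 A + m21 A) (m12 A + m22 A) z"
    "\<And>z. Im z > 0 \<Longrightarrow> wx1 (act A z) = s' * wcusp (m11 A) (m12 A) z"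
    "\<And>z. Im z > 0 \<Longrightarrow> wx2 (act A z) = s' * wcusp (m21 A) (m22 A) z"
    using wy_moebius[OF A] by metis
  obtain s :: int where s: "s = 1 \<or> s = - 1" "s' = of_int s"
    using s'(1) by (metis of_int_1 of_int_minus)
  obtain a0 b0 e0 :: int where 0: "\<And>z. wcusp (m11 A + m21 A) (m12 A + m22 A) z = of_int a0 * wx0 z + of_int b0 * wx1 z + of_int e0 * wx2 z"
    "\<bar>a0\<bar> \<le> 1" "\<bar>b0\<bar> \<le> 1" "\<bar>e0\<bar> \<le> 1"
    using wcusp_coefficients[of "m11 A + m21 A" "m12 A + m22 A"] by blast
  obtain a1 b1 e1 :: int where 1: "\<And>z. wcusp (m11 A) (m12 A) z = of_int a1 * wx0 z + of_int b1 * wx1 z + of_int e1 * wx2 z"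
    "\<bar>a1\<bar> \<le> 1" "\<bar>b1\<bar> \<le> 1" "\<bar>e1\<bar> \<le> 1"
    using wcusp_coefficients[of "m11 A" "m12 A"] by blast
  obtain a2 b2 e2 :: int where 2: "\<And>z. wcusp (m21 A) (m22 A) z = of_int a2 * wx0 z + of_int b2 * wx1 z + of_int e2 * wx2 z"
    "\<bar>a2\<bar> \<le> 1" "\<bar>b2\<bar> \<le> 1" "\<bar>e2\<bar> \<le> 1"
    using wcusp_coefficients[of "m21 A" "m22 A"] by blast
  have lin: "of_int (s * (a0 + 3 * a1 + 9 * a2) - 1) * wx0 z + of_int (s * (b0 + 3 * b1 + 9 * b2) - 3) * wx1 z
      + of_int (s * (e0 + 3 * e1 + 9 * e2) - 9) * wx2 z = 0" if "Im z > 0" for z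
    using inv[OF that] unfolding wy_def s'(2-4)[OF that] 0(1) 1(1) 2(1) s(2) by (simp add: algebra_simps)
  \<comment> \<open>Linear independence compares the coefficients with 1, 3 and 9. Multiplied by
    \<open>s\<close>, each right-hand side has a single nonzero ternary digit, so the signed
    permutation within \<open>wcusp\<close> is \<open>s\<close> times the identity; the outer factor
    \<open>s'\<close> cancels it.\<close>
  have "s * (a0 + 3 * a1 + 9 * a2) = 1" "s * (b0 + 3 * b1 + 9 * b2) = 3" "s * (e0 + 3 * e1 + 9 * e2) = 9"
    using wx_linear_independent[OF lin] unfolding of_int_eq_0_iff by simp_all
  hence "a0 + 3 * a1 + 9 * a2 = s" "b0 + 3 * b1 + 9 * b2 = 3 * s" "e0 + 3 * e1 + 9 * e2 = 9 * s"
    using s(1) by auto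
  hence "a0 = s \<and> a1 = 0 \<and> a2 = 0" "b0 = 0 \<and> b1 = s \<and> b2 = 0" "e0 = 0 \<and> e1 = 0 \<and> e2 = s"
    using s(1) 0(2-4) 1(2-4) by (intro balanced_ternary_unique; force)+
  moreover have "s' * s' = 1"
    using s'(1) by auto
  ultimately have "wx0 (act A z) = wx0 z" "wx1 (act A z) = wx1 z" "wx2 (act A z) = wx2 z"
    if "Im z > 0" for z
    unfolding s'(2-4)[OF that] 0(1) 1(1) 2(1) by (simp_all add: mult.assoc[symmetric] s(2)[symmetric])
  hence "{A, - A} \<in> weber_kernel 2"
    using A by (auto simp: weber_kernel_def carrier_PSL2Z wx0_def wx1_def wx2_def)
  thus ?thesis
    by (simp add: weber_kernel_2)
qed

text \<open>The quotient \<open>C\<close> of \<open>A\<close> by \<open>B\<close> fixes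
  \<open>wy\<close> and hence lies in the group that fixes \<open>f\<close>. So the conjugates of
  \<open>wy\<close> can serve as labels for the conjugates of any invariant function.\<close>

lemma slash_wy_eq_imp:
  assumes A: "A \<in> SL2" and B: "B \<in> SL2"
    and eq: "slash wy A = slash wy B" and f: "Gamma4_invariant f"
  shows "slash f A = slash f B"
proof -
  obtain B' where B': "B' \<in> SL2" "B ** B' = mat 1" "B' ** B = mat 1"
    using SL2Z_inverse[OF B] .
  define C where "C = A ** B'"
  have C: "C \<in> SL2"
    unfolding C_def by (intro SL2Z_mult A B')
  have CB: "C ** B = A"
    by (simp add: C_def matrix_mul_assoc[symmetric] B')
  have "slash wy C = slash wy (mat 1)"
    using slash_mult[OF A B'(1), of wy] slash_mult[OF B B'(1), of wy] eq by (simp add: C_def B')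
  hence "wy (act C z) = wy z" if "Im z > 0" for z
    using that by (auto simp: slash_def fun_eq_iff split: if_splits)
  hence "{C, - C} \<in> \<Gamma>4"
    by (rule wy_invariant_imp[OF C])
  hence inv: "f (act C z) = f z" if "Im z > 0" for z
    using f that unfolding Gamma4_invariant_def by blast
  show ?thesis
    unfolding slash_def fun_eq_iff
    using inv[OF moebius_act_upper[OF B]] moebius_act_mult[OF C B] by (simp add: CB)
qed

text \<open>A conjugate is determined by a sign and the entries of the matrix modulo 4, so a finite
  parameter set covers all of them.\<close>

lemma finite_slash_wy: "finite (slash wy ` SL2)"
proof -
  define G where "G = (\<lambda>(s :: complex, p :: int, q, r, t) z. if Im z > 0 then
    s * wcusp (p + r) (q + t) z + 3 * (s * wcusp p q z) + 9 * (s * wcusp r t z) else 0)"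
  have "slash wy ` SL2 \<subseteq> G ` ({1, - 1} \<times> {0,1,2,3} \<times> {0,1,2,3} \<times> {0,1,2,3} \<times> {0,1,2,3})"
  proof
    fix \<theta> assume "\<theta> \<in> slash wy ` SL2"
    then obtain A where A: "A \<in> SL2" "\<theta> = slash wy A"
      by blast
    obtain s :: complex where s: "s = 1 \<or> s = - 1"
      "\<And>z. Im z > 0 \<Longrightarrow> wx0 (act A z) = s * wcusp (m11 A + m21 A) (m12 A + m22 A) z"
      "\<And>z. Im z > 0 \<Longrightarrow> wx1 (act A z) = s * wcusp (m11 A) (m12 A) z"
      "\<And>z. Im z > 0 \<Longrightarrow> wx2 (act A z) = s * wcusp (m21 A) (m22 A) z"
      using wy_moebius[OF A(1)] by metis
    have m: "wcusp (m11 A) (m12 A) = wcusp (m11 A mod 4) (m12 A mod 4)" "wcusp (m21 A) (m22 A) = wcusp (m21 A mod 4) (m22 A mod 4)"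
      "wcusp (m11 A + m21 A) (m12 A + m22 A) = wcusp (m11 A mod 4 + m21 A mod 4) (m12 A mod 4 + m22 A mod 4)"
      by (rule wcusp_cong; simp add: mod_add_eq)+
    have "\<theta> = G (s, m11 A mod 4, m12 A mod 4, m21 A mod 4, m22 A mod 4)"
      unfolding A(2) G_def slash_def wy_def fun_eq_iff by (simp add: s(2-4) m)
    moreover have "(s, m11 A mod 4, m12 A mod 4, m21 A mod 4, m22 A mod 4) \<in>
        {1, - 1} \<times> {0,1,2,3} \<times> {0,1,2,3} \<times> {0,1,2,3} \<times> {0,1,2,3}"
      using s(1) mod_4_cases by blast
    ultimately show "\<theta> \<in> G ` ({1, - 1} \<times> {0,1,2,3} \<times> {0,1,2,3} \<times> {0,1,2,3} \<times> {0,1,2,3})"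
      by (rule image_eqI)
  qed
  thus ?thesis
    by (rule finite_subset) (intro finite_imageI finite_cartesian_product finite.intros)
qed

lemma slash_factors_through_wy:
  assumes "Gamma4_invariant f"
  obtains F where "\<And>A. A \<in> SL2 \<Longrightarrow> slash f A = F (slash wy A)"
proof (rule that)
  fix A assume A: "A \<in> SL2"
  let ?F = "\<lambda>\<theta>. slash f (SOME B. B \<in> SL2 \<and> slash wy B = \<theta>)"
  have *: "(SOME B. B \<in> SL2 \<and> slash wy B = slash wy A) \<in> SL2 \<and>
      slash wy (SOME B. B \<in> SL2 \<and> slash wy B = slash wy A) = slash wy A"
    by (rule someI[of _ A]) (use A in auto)
  show "slash f A = ?F (slash wy A)"
    by (rule slash_wy_eq_imp[OF A conjunct1[OF *] conjunct2[OF *, symmetric] assms])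
qed

lemma finite_slash:
  assumes "Gamma4_invariant f"
  shows "finite (slash f ` SL2)"
proof -
  obtain F where "\<And>A. A \<in> SL2 \<Longrightarrow> slash f A = F (slash wy A)"
    by (rule slash_factors_through_wy[OF assms]) blast
  hence "slash f ` SL2 = F ` (slash wy ` SL2)"
    by (auto simp: image_image)
  thus ?thesis
    using finite_slash_wy by simp
qed

text \<open>The quotient \<open>j w / (w - z)\<close> has a finite limit, so \<open>j ^ m\<close>
  absorbs a pole of order at most \<open>m\<close>. The claim is made for all large \<open>m\<close>
  so that finitely many poles can share one exponent.\<close>

lemma pole_cancel:
  assumes \<phi>: "\<phi> meromorphic_on {z}" and j: "(j has_field_derivative j') (at z)" "j z = 0"
  shows "eventually (\<lambda>m. \<exists>l. ((\<lambda>w. j w ^ m * \<phi> w) \<longlongrightarrow> l) (at z)) sequentially"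
proof (cases "is_pole \<phi> z")
  case True
  obtain r where r: "r > 0" "\<phi> analytic_on ball z r - {z}"
    using \<phi> unfolding meromorphic_at_iff isolated_singularity_at_def by blast
  hence "\<phi> holomorphic_on ball z r - {z}"
    by (intro analytic_imp_holomorphic)
  define n g where "n = nat (- zorder \<phi> z)" and "g = zor_poly \<phi> z"
  from zorder_exist_pole[OF \<open>\<phi> holomorphic_on _\<close> _ _ True] r obtain s where s: "s > 0" "g holomorphic_on cball z s"
    "\<And>w. w \<in> cball z s - {z} \<Longrightarrow> \<phi> w = g w / (w - z) ^ n"
    unfolding n_def g_def by auto
  have "isCont g z"
    using s(1,2) by (intro field_differentiable_imp_continuous_at holomorphic_on_imp_differentiable_at[of g "ball z s"])
      (auto intro: holomorphic_on_subset)
  hence g: "(g \<longlongrightarrow> g z) (at z)"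
    by (simp add: isCont_def)
  have jl: "(j \<longlongrightarrow> 0) (at z)"
    using DERIV_isCont[OF j(1)] j(2) by (simp add: isCont_def)
  have jd: "((\<lambda>w. j w / (w - z)) \<longlongrightarrow> j') (at z)"
    using j by (simp add: has_field_derivative_iff)
  have ev: "eventually (\<lambda>w. w \<in> ball z s - {z}) (at z)"
    using s(1) by (intro eventually_at_in_open) auto
  have "\<exists>l. ((\<lambda>w. j w ^ m * \<phi> w) \<longlongrightarrow> l) (at z)" if "m \<ge> n" for m
  proof -
    have "((\<lambda>w. (j w / (w - z)) ^ n * j w ^ (m - n) * g w) \<longlongrightarrow> j' ^ n * 0 ^ (m - n) * g z) (at z)"
      by (intro tendsto_intros g jl jd)
    moreover have "eventually (\<lambda>w. (j w / (w - z)) ^ n * j w ^ (m - n) * g w = j w ^ m * \<phi> w) (at z)"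
      using ev
    proof eventually_elim
      case (elim w)
      have "j w ^ m = j w ^ n * j w ^ (m - n)"
        using that by (simp add: power_add[symmetric])
      thus ?case
        using elim s(3)[of w] by (simp add: power_divide)
    qed
    ultimately show ?thesis
      by (intro exI) (rule Lim_transform_eventually)
  qed
  thus ?thesis
    unfolding eventually_sequentially by blast
next
  case False
  then obtain c where "(\<phi> \<longlongrightarrow> c) (at z)"
    using \<phi> unfolding meromorphic_at_iff not_essential_def by blast
  hence "((\<lambda>w. j w ^ m * \<phi> w) \<longlongrightarrow> 0 ^ m * c) (at z)" for m
    using DERIV_isCont[OF j(1)] j(2) by (intro tendsto_intros) (simp_all add: isCont_def)
  thus ?thesis
    by (intro always_eventually allI exI)
qed

lemma wJ_has_derivative: "Im z > 0 \<Longrightarrow> (wJ has_field_derivative deriv wJ z) (at z)"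
  using wJ_holomorphic open_upper_half_plane by (intro holomorphic_derivI) auto

text \<open>No conjugate of \<open>f\<close> has poles near the cusp, so those in the reduced region
  lie in a compact set and are finite in number. The multiplier is a polynomial in
  \<open>wJ\<close>, hence of level one, and its effect in the reduced region carries over to every
  point.\<close>

lemma modular_function_clear_poles:
  assumes "is_modular_function (\<Gamma>4) f"
  obtains S n where "finite S" "S \<subseteq> \<H>"
    "\<And>z. Im z > 0 \<Longrightarrow> \<exists>l. ((\<lambda>w. (\<Prod>s\<in>S. (wJ w - wJ s) ^ n) * f w) \<longlongrightarrow> l) (at z)"
proof -
  have f: "f meromorphic_on \<H>" "Gamma4_invariant f"
    "\<And>A. A \<in> SL2 \<Longrightarrow> meromorphic_at_ioo (\<lambda>t. f (act A t))"
    using assms by (auto simp: is_modular_function_def Gamma4_invariant_def nicely_meromorphic_on_def)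
  define \<Phi> where "\<Phi> = slash f ` SL2"
  have fin: "finite \<Phi>"
    unfolding \<Phi>_def by (rule finite_slash[OF f(2)])
  have mero: "\<phi> meromorphic_on \<H>" if \<phi>: "\<phi> \<in> \<Phi>" for \<phi>
  proof -
    obtain A where A: "A \<in> SL2" "\<phi> = slash f A"
      using \<phi> unfolding \<Phi>_def by blast
    have "(\<lambda>t. f (act A t)) meromorphic_on \<H>"
      using moebius_act_holomorphic[OF A(1)] moebius_act_upper[OF A(1)]
      by (intro meromorphic_on_compose[OF f(1)]) (auto simp: analytic_on_open open_upper_half_plane)
    also have "?this \<longleftrightarrow> \<phi> meromorphic_on \<H>"
    proof (rule meromorphic_on_cong)
      fix z assume "z \<in> \<H>"
      hence "eventually (\<lambda>w. Im w > 0) (at z)"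
        by (intro eventually_upper) auto
      thus "eventually (\<lambda>w. f (act A w) = \<phi> w) (at z)"
        by eventually_elim (simp add: A slash_def)
    qed simp
    finally show ?thesis .
  qed
  have "eventually (\<lambda>t. \<not> is_pole \<phi> t) cusp" if \<phi>: "\<phi> \<in> \<Phi>" for \<phi>
  proof -
    obtain A where A: "A \<in> SL2" "\<phi> = slash f A"
      using \<phi> unfolding \<Phi>_def by blast
    show ?thesis
      using meromorphic_at_ioo_imp(2)[OF f(3)[OF A(1)]] eventually_cusp_gt[of 0]
    proof eventually_elim
      case (elim t)
      have "is_pole \<phi> t \<longleftrightarrow> is_pole (\<lambda>t. f (act A t)) t"
        using eventually_upper[OF elim(2)] by (intro is_pole_cong) (auto simp: A slash_def elim: eventually_mono)
      thus ?case
        using analytic_at_imp_no_pole[OF elim(1)] by simp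
    qed
  qed
  hence "eventually (\<lambda>t. \<forall>\<phi>\<in>\<Phi>. \<not> is_pole \<phi> t) cusp"
    using fin by (intro eventually_ball_finite) auto
  then obtain y where y: "\<And>t \<phi>. Im t > y \<Longrightarrow> \<phi> \<in> \<Phi> \<Longrightarrow> \<not> is_pole \<phi> t"
    unfolding eventually_cusp by blast
  define K where "K = cbox (Complex (- 1 / 2) (1 / 2)) (Complex (1 / 2) y)"
  have K: "z \<in> K \<longleftrightarrow> \<bar>Re z\<bar> \<le> 1 / 2 \<and> Im z \<ge> 1 / 2 \<and> Im z \<le> y" for z
    by (auto simp: K_def in_cbox_complex_iff)
  have K_sub: "K \<subseteq> \<H>"
    using K by auto
  define P where "P = (\<lambda>\<phi> :: complex \<Rightarrow> complex. K \<inter> {z. is_pole \<phi> z})"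
  have finP: "finite (P \<phi>)" if "\<phi> \<in> \<Phi>" for \<phi>
    unfolding P_def
  proof (rule sparse_in_compact_finite)
    have "eventually (\<lambda>z. \<not> is_pole \<phi> z) (cosparse K)"
      by (intro meromorphic_on_imp_not_pole_cosparse meromorphic_on_subset[OF mero[OF that] K_sub])
    thus "{z. is_pole \<phi> z} sparse_in K"
      by (simp add: eventually_cosparse)
  qed (simp add: K_def)
  define S where "S = (\<Union>\<phi>\<in>\<Phi>. P \<phi>)"
  have S: "finite S"
    unfolding S_def using fin finP by (rule finite_UN_I)
  have S_sub: "S \<subseteq> \<H>"
    using K_sub by (auto simp: S_def P_def)
  have "eventually (\<lambda>m. \<forall>x\<in>\<Phi> \<times> S. \<exists>l. ((\<lambda>w. (wJ w - wJ (snd x)) ^ m * fst x w) \<longlongrightarrow> l) (at (snd x))) sequentially"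
  proof (intro eventually_ball_finite ballI)
    fix x assume x: "x \<in> \<Phi> \<times> S"
    hence z: "Im (snd x) > 0" "fst x \<in> \<Phi>"
      using S_sub by auto
    show "eventually (\<lambda>m. \<exists>l. ((\<lambda>w. (wJ w - wJ (snd x)) ^ m * fst x w) \<longlongrightarrow> l) (at (snd x))) sequentially"
    proof (rule pole_cancel)
      show "fst x meromorphic_on {snd x}"
        by (rule meromorphic_on_subset[OF mero[OF z(2)]]) (use z in auto)
      show "((\<lambda>w. wJ w - wJ (snd x)) has_field_derivative (deriv wJ (snd x) - 0)) (at (snd x))"
        by (intro DERIV_diff wJ_has_derivative z DERIV_const)
    qed simp
  qed (use fin S in auto)
  then obtain n where n: "\<And>\<phi> s. \<phi> \<in> \<Phi> \<Longrightarrow> s \<in> S \<Longrightarrow> \<exists>l. ((\<lambda>w. (wJ w - wJ s) ^ n * \<phi> w) \<longlongrightarrow> l) (at s)"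
    unfolding eventually_sequentially by fastforce
  define g where "g = (\<lambda>w. \<Prod>s\<in>S. (wJ w - wJ s) ^ n)"
  have wJ_lim: "(wJ \<longlongrightarrow> wJ z) (at z)" if "Im z > 0" for z
    using DERIV_isCont[OF wJ_has_derivative[OF that]] by (simp add: isCont_def)
  have red: "\<exists>l. ((\<lambda>w. g w * \<phi> w) \<longlongrightarrow> l) (at z)" if \<phi>: "\<phi> \<in> \<Phi>" and z': "\<bar>Re z\<bar> \<le> 1 / 2" "Im z \<ge> 1 / 2" for \<phi> z
  proof (cases "is_pole \<phi> z")
    case True
    hence zS: "z \<in> S"
      using y[of z \<phi>] \<phi> z' True K by (force simp: S_def P_def)
    have z: "Im z > 0"
      using z' by linarith
    obtain l where l: "((\<lambda>w. (wJ w - wJ z) ^ n * \<phi> w) \<longlongrightarrow> l) (at z)"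
      using n[OF \<phi> zS] by blast
    have "((\<lambda>w. (\<Prod>s\<in>S - {z}. (wJ w - wJ s) ^ n) * ((wJ w - wJ z) ^ n * \<phi> w)) \<longlongrightarrow>
        (\<Prod>s\<in>S - {z}. (wJ z - wJ s) ^ n) * l) (at z)"
      by (intro tendsto_intros l wJ_lim z)
    also have "(\<lambda>w. (\<Prod>s\<in>S - {z}. (wJ w - wJ s) ^ n) * ((wJ w - wJ z) ^ n * \<phi> w)) = (\<lambda>w. g w * \<phi> w)"
      unfolding g_def by (rule ext, subst prod.remove[OF S zS]) (simp add: mult_ac)
    finally show ?thesis
      by blast
  next
    case False
    have z: "Im z > 0"
      using z' by linarith
    have "\<phi> meromorphic_on {z}"
      by (rule meromorphic_on_subset[OF mero[OF \<phi>]]) (use z in auto)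
    then obtain c where "(\<phi> \<longlongrightarrow> c) (at z)"
      using False unfolding meromorphic_at_iff not_essential_def by blast
    hence "((\<lambda>w. g w * \<phi> w) \<longlongrightarrow> (\<Prod>s\<in>S. (wJ z - wJ s) ^ n) * c) (at z)"
      unfolding g_def by (intro tendsto_intros wJ_lim z)
    thus ?thesis
      by blast
  qed
  have "\<exists>l. ((\<lambda>w. g w * f w) \<longlongrightarrow> l) (at z)" if z: "Im z > 0" for z
  proof -
    obtain A where A: "A \<in> SL2" "\<bar>Re (act A z)\<bar> \<le> 1 / 2" "Im (act A z) \<ge> 1 / 2"
      using SL2Z_reduce[OF z] .
    obtain B where B: "B \<in> SL2" "A ** B = mat 1" "B ** A = mat 1"
      using SL2Z_inverse[OF A(1)] .
    \<comment> \<open>The conjugate of \<open>f\<close> by the inverse of \<open>A\<close>, taken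
      near \<open>act A z\<close>, reproduces \<open>f\<close> near \<open>z\<close>; so the limit
      in the reduced region can be transported back.\<close>
    obtain l where "((\<lambda>w. g w * slash f B w) \<longlongrightarrow> l) (at (act A z))"
      using red[of "slash f B" "act A z"] A B by (auto simp: \<Phi>_def)
    from filterlim_compose[OF this filterlim_moebius_act[OF A(1) z]]
    have "((\<lambda>w. g (act A w) * slash f B (act A w)) \<longlongrightarrow> l) (at z)" .
    moreover have "eventually (\<lambda>w. g (act A w) * slash f B (act A w) = g w * f w) (at z)"
      using eventually_upper[OF z]
    proof eventually_elim
      case (elim w)
      have "slash f B (act A w) = f w"
        using moebius_act_upper[OF A(1) elim] moebius_act_mult[OF B(1) A(1) elim] by (simp add: slash_def B)
      moreover have "g (act A w) = g w"
        using elim by (simp add: g_def wJ_invariant[OF A(1)])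
      ultimately show ?case
        by simp
    qed
    ultimately show ?thesis
      by (intro exI) (rule Lim_transform_eventually)
  qed
  thus ?thesis
    using that[OF S S_sub] unfolding g_def by blast
qed

section \<open>Surjectivity of the pullback\<close>

text \<open>The analytic hypotheses of \<open>level_one_polynomial_wJ\<close>, bundled because they
  are stable under ring operations.\<close>

definition tame :: "(complex \<Rightarrow> complex) \<Rightarrow> bool" where
  "tame f \<longleftrightarrow> f holomorphic_on \<H> \<and> moderate f"

lemma tame_const: "tame (\<lambda>_. c)"
  by (simp add: tame_def moderate_const)

lemma tame_add: "tame f \<Longrightarrow> tame g \<Longrightarrow> tame (\<lambda>z. f z + g z)"
  by (auto simp: tame_def intro!: holomorphic_intros moderate_add)

lemma tame_mult: "tame f \<Longrightarrow> tame g \<Longrightarrow> tame (\<lambda>z. f z * g z)"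
  by (auto simp: tame_def intro!: holomorphic_intros moderate_mult)

lemma tame_uminus: "tame f \<Longrightarrow> tame (\<lambda>z. - f z)"
  using tame_mult[OF tame_const[of "- 1"]] by simp

lemma tame_sum: "(\<And>i. i \<in> I \<Longrightarrow> tame (f i)) \<Longrightarrow> tame (\<lambda>z. \<Sum>i\<in>I. f i z)"
  by (induction I rule: infinite_finite_induct) (auto intro: tame_const tame_add)

lemma tame_prod: "(\<And>i. i \<in> I \<Longrightarrow> tame (f i)) \<Longrightarrow> tame (\<lambda>z. \<Prod>i\<in>I. f i z)"
  by (induction I rule: infinite_finite_induct) (auto intro: tame_const tame_mult)

lemma tame_cong:
  assumes "\<And>z. Im z > 0 \<Longrightarrow> f z = g z" "tame f"
  shows "tame g"
proof -
  have "g holomorphic_on \<H>"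
    using assms by (auto simp: tame_def elim!: holomorphic_transform)
  moreover have "eventually (\<lambda>z. f z = g z) cusp"
    using eventually_cusp_gt[of 0] by eventually_elim (use assms in auto)
  hence "moderate g"
    using assms(2) by (auto simp: tame_def intro: moderate_cong)
  ultimately show ?thesis
    by (simp add: tame_def)
qed

lemma tame_level_one:
  assumes "tame c" "\<And>A z. A \<in> SL2 \<Longrightarrow> Im z > 0 \<Longrightarrow> c (act A z) = c z"
  shows "\<exists>p. \<forall>z. Im z > 0 \<longrightarrow> c z = poly p (wJ z)"
  using assms level_one_polynomial_wJ[of c] unfolding tame_def moderate_def by blast

lemma tame_slash:
  assumes A: "A \<in> SL2" and f: "f holomorphic_on \<H>" "moderate (\<lambda>z. f (act A z))"
  shows "tame (slash f A)"
proof (rule tame_cong)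
  have "(f \<circ> act A) holomorphic_on \<H>"
    using moebius_act_upper[OF A]
    by (intro holomorphic_on_compose moebius_act_holomorphic[OF A] holomorphic_on_subset[OF f(1)]) auto
  thus "tame (\<lambda>z. f (act A z))"
    using f(2) by (simp add: tame_def o_def)
qed (simp add: slash_def)

lemma tame_slash_wy:
  assumes A: "A \<in> SL2"
  shows "tame (slash wy A)"
proof (rule tame_slash[OF A])
  show "wy holomorphic_on \<H>"
    unfolding wy_def by (intro holomorphic_intros wx_holomorphic)
  obtain Z0 Z1 Z2 where Z: "Z0 meromorphic_on {0}" "Z1 meromorphic_on {0}" "Z2 meromorphic_on {0}"
      "\<And>z. Im z > 0 \<Longrightarrow> wx0 (act A z) = Z0 (nome (z / 2))"
      "\<And>z. Im z > 0 \<Longrightarrow> wx1 (act A z) = Z1 (nome (z / 2))"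
      "\<And>z. Im z > 0 \<Longrightarrow> wx2 (act A z) = Z2 (nome (z / 2))"
    by (rule wx_moebius_meromorphic_at_cusp[OF A]) blast
  have e: "exp (2 * of_real pi * \<i> * z / of_nat 4) = nome (z / 2)" for z
    unfolding nome_def by (rule arg_cong[where f = exp]) simp
  have "(\<lambda>w. Z0 w + 3 * Z1 w + 9 * Z2 w) meromorphic_on {0}"
    by (intro meromorphic_intros Z)
  hence "meromorphic_at_ioo (\<lambda>z. wy (act A z))"
    unfolding meromorphic_at_ioo_def
    by (intro exI[of _ 4] exI[of _ "\<lambda>w. Z0 w + 3 * Z1 w + 9 * Z2 w"] exI[of _ 0] conjI allI impI)
       (simp_all only: e, simp_all add: wy_def Z)
  thus "moderate (\<lambda>z. wy (act A z))"
    by (rule meromorphic_at_ioo_imp)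
qed

text \<open>Interpolation yields a polynomial that varies with \<open>\<tau>\<close>; its
  coefficients are the functions to which the level-one result is applied.\<close>

definition tame_poly :: "(complex \<Rightarrow> complex poly) \<Rightarrow> bool" where
  "tame_poly p \<longleftrightarrow> (\<forall>k. tame (\<lambda>\<tau>. coeff (p \<tau>) k))"

lemma tame_poly_linear:
  assumes "tame f"
  shows "tame_poly (\<lambda>z. [:- f z, 1:])"
  unfolding tame_poly_def
proof
  fix k
  consider "k = 0" | "k = 1" | j where "k = Suc (Suc j)"
    by (metis One_nat_def not0_implies_Suc)
  thus "tame (\<lambda>z. coeff [:- f z, 1:] k)"
    using assms by cases (simp_all add: tame_const tame_uminus)
qed

lemma tame_poly_smult: "tame f \<Longrightarrow> tame_poly p \<Longrightarrow> tame_poly (\<lambda>z. smult (f z) (p z))"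
  unfolding tame_poly_def by (auto intro: tame_mult)

lemma tame_poly_mult: "tame_poly p \<Longrightarrow> tame_poly q \<Longrightarrow> tame_poly (\<lambda>z. p z * q z)"
  unfolding tame_poly_def coeff_mult by (intro allI tame_sum tame_mult) blast+

lemma tame_poly_prod:
  "(\<And>i. i \<in> I \<Longrightarrow> tame_poly (p i)) \<Longrightarrow> tame_poly (\<lambda>z. \<Prod>i\<in>I. p i z)"
proof (induction I rule: infinite_finite_induct)
  case (insert i I)
  thus ?case
    by (auto intro: tame_poly_mult)
qed (auto simp: tame_poly_def intro: tame_const)

lemma tame_poly_sum:
  "(\<And>i. i \<in> I \<Longrightarrow> tame_poly (p i)) \<Longrightarrow> tame_poly (\<lambda>z. \<Sum>i\<in>I. p i z)"
  unfolding tame_poly_def coeff_sum by (auto intro: tame_sum)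

definition wOmega :: "(complex \<Rightarrow> complex) set" where
  "wOmega = slash wy ` SL2"

text \<open>Up to sign, the discriminant of the polynomial whose roots are the conjugates of
  \<open>wy\<close>.\<close>

definition wD :: "complex \<Rightarrow> complex" where
  "wD \<tau> = (\<Prod>a\<in>wOmega. \<Prod>b\<in>wOmega - {a}. a \<tau> - b \<tau>)"

lemma finite_wOmega: "finite wOmega"
  unfolding wOmega_def by (rule finite_slash_wy)

lemma wOmega_bij:
  assumes B: "B \<in> SL2"
  shows "bij_betw (\<lambda>\<theta>. slash \<theta> B) wOmega wOmega"
proof -
  obtain B' where B': "B' \<in> SL2" "B ** B' = mat 1" "B' ** B = mat 1"
    using SL2Z_inverse[OF B] .
  show ?thesis
  proof (rule bij_betw_byWitness[of _ "\<lambda>\<theta>. slash \<theta> B'"])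
    show "\<forall>\<theta>\<in>wOmega. slash (slash \<theta> B) B' = \<theta>" "\<forall>\<theta>\<in>wOmega. slash (slash \<theta> B') B = \<theta>"
      using B B' by (auto simp: wOmega_def slash_mult SL2Z_mult matrix_mul_assoc[symmetric])
    show "(\<lambda>\<theta>. slash \<theta> B) ` wOmega \<subseteq> wOmega" "(\<lambda>\<theta>. slash \<theta> B') ` wOmega \<subseteq> wOmega"
      using B B' by (auto simp: wOmega_def slash_mult intro: SL2Z_mult)
  qed
qed

text \<open>Lagrange interpolation in the nodes \<open>wOmega\<close>, with the denominators cleared by \<open>wD\<close>.\<close>

lemma lagrange_level_one:
  assumes hol: "h holomorphic_on \<H>" and inv: "Gamma4_invariant h"
    and mod: "\<And>A. A \<in> SL2 \<Longrightarrow> moderate (\<lambda>z. h (act A z))"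
  shows "\<exists>(M :: nat) C. \<forall>z. Im z > 0 \<longrightarrow> h z * wD z = (\<Sum>k\<le>M. poly (C k) (wJ z) * wy z ^ k)"
proof -
  obtain F where F: "\<And>A. A \<in> SL2 \<Longrightarrow> slash h A = F (slash wy A)"
    by (rule slash_factors_through_wy[OF inv]) blast
  \<comment> \<open>\<open>E \<theta>\<close> is \<open>wD\<close> without the factors
    \<open>\<theta> - b\<close>, so \<open>N\<close> is \<open>wD\<close> times the usual Lagrange
    polynomial and contains no division.\<close>
  define E where "E = (\<lambda>\<theta> z. \<Prod>a\<in>wOmega - {\<theta>}. \<Prod>b\<in>wOmega - {a}. (a z - b z :: complex))"
  define L where "L = (\<lambda>\<theta> z. \<Prod>\<theta>'\<in>wOmega - {\<theta>}. [:- \<theta>' z, 1 :: complex:])"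
  define N where "N = (\<lambda>z. \<Sum>\<theta>\<in>wOmega. smult (F \<theta> z * E \<theta> z) (L \<theta> z))"
  have tame_\<theta>: "tame \<theta>" if "\<theta> \<in> wOmega" for \<theta>
    using that by (auto simp: wOmega_def intro: tame_slash_wy)
  have tame_F: "tame (F \<theta>)" if "\<theta> \<in> wOmega" for \<theta>
  proof -
    obtain A where "A \<in> SL2" "\<theta> = slash wy A"
      using \<open>\<theta> \<in> wOmega\<close> unfolding wOmega_def by blast
    thus ?thesis
      using F tame_slash[OF _ hol mod] by metis
  qed
  have "tame_poly N"
    unfolding N_def E_def L_def diff_conv_add_uminus
    by (intro tame_poly_sum tame_poly_smult tame_poly_prod tame_poly_linear tame_mult tame_prod tame_add tame_uminus) (auto intro: tame_\<theta> tame_F)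
  \<comment> \<open>A matrix permutes the nodes, and by \<open>FB\<close> it permutes the prescribed
    values in the same way, so the sum is merely reindexed.\<close>
  moreover have N_inv: "N (act B z) = N z" if B: "B \<in> SL2" and z: "Im z > 0" for B z
  proof -
    define \<sigma> where "\<sigma> = (\<lambda>\<theta>. slash \<theta> B)"
    have bij: "bij_betw \<sigma> wOmega wOmega"
      unfolding \<sigma>_def by (rule wOmega_bij[OF B])
    have bij': "bij_betw \<sigma> (wOmega - {a}) (wOmega - {\<sigma> a})" if "a \<in> wOmega" for a
      using bij that by (auto simp: bij_betw_def inj_on_def)
    have \<theta>B: "\<theta> (act B z) = \<sigma> \<theta> z" for \<theta>
      using z by (simp add: \<sigma>_def slash_def)
    have FB: "F \<theta> (act B z) = F (\<sigma> \<theta>) z" if \<theta>: "\<theta> \<in> wOmega" for \<theta>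
    proof -
      obtain A where A: "A \<in> SL2" "\<theta> = slash wy A"
        using \<theta> unfolding wOmega_def by blast
      have "F \<theta> (act B z) = slash (slash h A) B z"
        using z F[OF A(1)] by (simp add: A(2) slash_def[of _ B])
      also have "slash (slash h A) B = F (slash wy (A ** B))"
        using F[OF SL2Z_mult[OF A(1) B]] by (simp add: slash_mult A B)
      also have "slash wy (A ** B) = \<sigma> \<theta>"
        by (simp add: \<sigma>_def A(2) slash_mult[OF A(1) B])
      finally show ?thesis .
    qed
    have LB: "L \<theta> (act B z) = L (\<sigma> \<theta>) z" if "\<theta> \<in> wOmega" for \<theta>
      unfolding L_def \<theta>B by (rule prod.reindex_bij_betw[OF bij'[OF that]])
    have EB: "E \<theta> (act B z) = E (\<sigma> \<theta>) z" if "\<theta> \<in> wOmega" for \<theta>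
    proof -
      have "E \<theta> (act B z) = (\<Prod>a\<in>wOmega - {\<theta>}. \<Prod>b\<in>wOmega - {\<sigma> a}. \<sigma> a z - b z)"
        unfolding E_def \<theta>B by (intro prod.cong refl prod.reindex_bij_betw[OF bij'] ) auto
      also have "\<dots> = E (\<sigma> \<theta>) z"
        unfolding E_def by (rule prod.reindex_bij_betw[OF bij'[OF that]])
      finally show ?thesis .
    qed
    have "N (act B z) = (\<Sum>\<theta>\<in>wOmega. smult (F (\<sigma> \<theta>) z * E (\<sigma> \<theta>) z) (L (\<sigma> \<theta>) z))"
      unfolding N_def by (intro sum.cong refl) (simp add: FB EB LB)
    also have "\<dots> = N z"
      unfolding N_def by (rule sum.reindex_bij_betw[OF bij])
    finally show ?thesis .
  qed
  ultimately have "\<exists>p. \<forall>z. Im z > 0 \<longrightarrow> coeff (N z) k = poly p (wJ z)" for k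
    by (intro tame_level_one) (auto simp: tame_poly_def)
  then obtain C where C: "\<And>k z. Im z > 0 \<Longrightarrow> coeff (N z) k = poly (C k) (wJ z)"
    by metis
  \<comment> \<open>The degree bound is independent of \<open>z\<close>, so one sum up to
    \<open>M\<close> represents the polynomial at every point.\<close>
  define M where "M = card wOmega"
  have deg: "degree (N z) \<le> M" for z
    unfolding N_def
  proof (rule degree_sum_le[OF finite_wOmega])
    fix \<theta>
    have "degree (smult (F \<theta> z * E \<theta> z) (L \<theta> z)) \<le> degree (L \<theta> z)"
      by (rule degree_smult_le)
    also have "\<dots> \<le> sum (degree \<circ> (\<lambda>\<theta>'. [:- \<theta>' z, 1:])) (wOmega - {\<theta>})"
      unfolding L_def using finite_wOmega by (intro degree_prod_sum_le) auto
    also have "\<dots> = card (wOmega - {\<theta>})"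
      by simp
    also have "\<dots> \<le> M"
      unfolding M_def using finite_wOmega by (intro card_mono) auto
    finally show "degree (smult (F \<theta> z * E \<theta> z) (L \<theta> z)) \<le> M" .
  qed
  show ?thesis
  proof (intro exI allI impI)
    fix z :: complex assume z: "Im z > 0"
    \<comment> \<open>\<open>wy\<close> is the node of the identity matrix; evaluation there
      annihilates all other terms and leaves \<open>h z * wD z\<close>.\<close>
    define \<theta>1 where "\<theta>1 = slash wy (mat 1)"
    have \<theta>1: "\<theta>1 \<in> wOmega" "\<theta>1 z = wy z" "F \<theta>1 z = h z"
      using z F[of "mat 1"] by (auto simp: \<theta>1_def wOmega_def slash_def fun_eq_iff split: if_splits)
    have L0: "poly (L \<theta> z) (wy z) = 0" if "\<theta> \<in> wOmega - {\<theta>1}" for \<theta>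
      unfolding L_def poly_prod using that \<theta>1 finite_wOmega by (intro prod_zero bexI[of _ \<theta>1]) auto
    have "poly (N z) (wy z) = (\<Sum>\<theta>\<in>wOmega. F \<theta> z * E \<theta> z * poly (L \<theta> z) (wy z))"
      by (simp add: N_def poly_sum)
    also have "\<dots> = F \<theta>1 z * E \<theta>1 z * poly (L \<theta>1 z) (wy z)"
      using L0 by (subst sum.remove[OF finite_wOmega \<theta>1(1)]) simp
    also have "\<dots> = h z * ((\<Prod>b\<in>wOmega - {\<theta>1}. \<theta>1 z - b z) * E \<theta>1 z)"
      by (simp add: L_def poly_prod \<theta>1)
    also have "(\<Prod>b\<in>wOmega - {\<theta>1}. \<theta>1 z - b z) * E \<theta>1 z = wD z"
      unfolding wD_def E_def by (rule prod.remove[OF finite_wOmega \<theta>1(1), symmetric])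
    finally have "h z * wD z = poly (N z) (wy z)" ..
    also have "\<dots> = poly (\<Sum>k\<le>M. monom (coeff (N z) k) k) (wy z)"
      by (subst poly_as_sum_of_monoms'[OF deg]) simp
    also have "\<dots> = (\<Sum>k\<le>M. poly (C k) (wJ z) * wy z ^ k)"
      by (simp add: poly_sum poly_monom C[OF z])
    finally show "h z * wD z = (\<Sum>k\<le>M. poly (C k) (wJ z) * wy z ^ k)" .
  qed
qed

text \<open>Polynomial functions of the three affine Weber coordinates, with the degree of the form
  forgotten.\<close>

definition form_fun :: "(complex \<Rightarrow> complex) \<Rightarrow> bool" where
  "form_fun g \<longleftrightarrow> (\<exists>d F. is_form d F \<and> (\<forall>\<tau>. Im \<tau> > 0 \<longrightarrow> g \<tau> = F (wpoint \<tau>)))"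

lemma form_fun_const: "form_fun (\<lambda>_. c)"
  unfolding form_fun_def using is_form_const by blast

lemma wpoint_4 [simp]: "wpoint z $ 4 = 1"
  by (simp add: wpoint)

text \<open>The last coordinate is 1 along the parametrisation, so its powers raise both forms to a
  common degree without changing any value.\<close>

lemma form_fun_add:
  assumes "form_fun f" "form_fun g"
  shows "form_fun (\<lambda>z. f z + g z)"
proof -
  from assms obtain d F e G where F: "is_form d F" "\<And>z. Im z > 0 \<Longrightarrow> f z = F (wpoint z)"
    and G: "is_form e G" "\<And>z. Im z > 0 \<Longrightarrow> g z = G (wpoint z)"
    unfolding form_fun_def by blast
  have "is_form (d + e) (\<lambda>v. F v * (v $ 4) ^ e)" "is_form (d + e) (\<lambda>v. G v * (v $ 4) ^ d)"
    using is_form_mult[OF F(1) is_form_coord_power[of e 4]] is_form_mult[OF G(1) is_form_coord_power[of d 4]]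
    by (simp_all add: add.commute)
  hence "is_form (d + e) (\<lambda>v. F v * (v $ 4) ^ e + G v * (v $ 4) ^ d)"
    by (rule is_form_add)
  moreover have "f z + g z = F (wpoint z) * (wpoint z $ 4) ^ e + G (wpoint z) * (wpoint z $ 4) ^ d" if "Im z > 0" for z
    using that by (simp add: F G)
  ultimately show ?thesis
    unfolding form_fun_def by blast
qed

lemma form_fun_mult:
  assumes "form_fun f" "form_fun g"
  shows "form_fun (\<lambda>z. f z * g z)"
proof -
  from assms obtain d F e G where F: "is_form d F" "\<And>z. Im z > 0 \<Longrightarrow> f z = F (wpoint z)"
    and G: "is_form e G" "\<And>z. Im z > 0 \<Longrightarrow> g z = G (wpoint z)"
    unfolding form_fun_def by blast
  have "f z * g z = F (wpoint z) * G (wpoint z)" if "Im z > 0" for z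
    using that by (simp add: F G)
  thus ?thesis
    unfolding form_fun_def using is_form_mult[OF F(1) G(1)] by blast
qed

lemma form_fun_cong: "(\<And>z. Im z > 0 \<Longrightarrow> f z = g z) \<Longrightarrow> form_fun f \<Longrightarrow> form_fun g"
  unfolding form_fun_def by metis

lemma form_fun_uminus: "form_fun f \<Longrightarrow> form_fun (\<lambda>z. - f z)"
  using form_fun_mult[OF form_fun_const[of "- 1"]] by simp

lemma form_fun_sum: "(\<And>i. i \<in> I \<Longrightarrow> form_fun (f i)) \<Longrightarrow> form_fun (\<lambda>z. \<Sum>i\<in>I. f i z)"
  by (induction I rule: infinite_finite_induct) (auto intro: form_fun_const form_fun_add)

lemma form_fun_prod: "(\<And>i. i \<in> I \<Longrightarrow> form_fun (f i)) \<Longrightarrow> form_fun (\<lambda>z. \<Prod>i\<in>I. f i z)"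
  by (induction I rule: infinite_finite_induct) (auto intro: form_fun_const form_fun_mult)

lemma form_fun_power: "form_fun f \<Longrightarrow> form_fun (\<lambda>z. f z ^ n)"
  by (induction n) (auto intro: form_fun_const form_fun_mult)

lemma form_fun_poly: "form_fun f \<Longrightarrow> form_fun (\<lambda>z. poly p (f z))"
  by (induction p) (auto intro: form_fun_const form_fun_mult form_fun_add)

lemma form_fun_wx: "form_fun wx0" "form_fun wx1" "form_fun wx2"
proof -
  have "form_fun (\<lambda>z. wpoint z $ i)" for i
    unfolding form_fun_def using is_form_coord[of i] by blast
  from this[of 1] this[of 2] this[of 3] show "form_fun wx0" "form_fun wx1" "form_fun wx2"
    by (simp_all add: wpoint)
qed

lemma form_fun_wJ: "form_fun wJ"
  unfolding wJ_def by (intro form_fun_add form_fun_power form_fun_wx)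

lemma form_fun_wy: "form_fun wy"
  unfolding wy_def by (intro form_fun_add form_fun_mult form_fun_const form_fun_wx)

lemma form_fun_wcusp: "form_fun (wcusp c d)"
proof -
  obtain a b e :: int where "\<And>z. wcusp c d z = of_int a * wx0 z + of_int b * wx1 z + of_int e * wx2 z"
    using wcusp_coefficients[of c d] by metis
  hence "wcusp c d = (\<lambda>z. of_int a * wx0 z + of_int b * wx1 z + of_int e * wx2 z)"
    by (rule ext)
  moreover have "form_fun \<dots>"
    by (intro form_fun_add form_fun_mult form_fun_const form_fun_wx)
  ultimately show ?thesis
    by simp
qed

lemma form_fun_wOmega:
  assumes "\<theta> \<in> wOmega"
  shows "form_fun \<theta>"
proof -
  obtain A where A: "A \<in> SL2" "\<theta> = slash wy A"
    using assms unfolding wOmega_def by blast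
  obtain s :: complex where s:
    "\<And>z. Im z > 0 \<Longrightarrow> wx0 (act A z) = s * wcusp (m11 A + m21 A) (m12 A + m22 A) z"
    "\<And>z. Im z > 0 \<Longrightarrow> wx1 (act A z) = s * wcusp (m11 A) (m12 A) z"
    "\<And>z. Im z > 0 \<Longrightarrow> wx2 (act A z) = s * wcusp (m21 A) (m22 A) z"
    using wy_moebius[OF A(1)] by metis
  show ?thesis
  proof (rule form_fun_cong)
    show "form_fun (\<lambda>z. s * wcusp (m11 A + m21 A) (m12 A + m22 A) z + 3 * (s * wcusp (m11 A) (m12 A) z)
        + 9 * (s * wcusp (m21 A) (m22 A) z))"
      by (intro form_fun_add form_fun_mult form_fun_const form_fun_wcusp)
  qed (simp add: A(2) slash_def wy_def s)
qed

lemma form_fun_wD: "form_fun wD"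
  unfolding wD_def diff_conv_add_uminus
  by (intro form_fun_prod form_fun_add form_fun_uminus) (auto intro: form_fun_wOmega)

lemma form_fun_holomorphic:
  assumes "form_fun f"
  shows "f holomorphic_on \<H>"
proof -
  obtain d F where F: "is_form d F" "\<And>z. Im z > 0 \<Longrightarrow> f z = F (wpoint z)"
    using assms unfolding form_fun_def by blast
  show ?thesis
    by (rule holomorphic_transform[OF form_wpoint_holomorphic[OF F(1)]]) (simp add: F(2))
qed

text \<open>Distinct conjugates both vanish off the half-plane, so they differ at some point of it,
  and the identity theorem applies to each of the finitely many factors.\<close>

lemma wD_eventually_nonzero:
  assumes z: "Im z > 0"
  shows "eventually (\<lambda>t. wD t \<noteq> 0) (at z)"
proof -
  have "eventually (\<lambda>t. a t - b t \<noteq> 0) (at z)" if "a \<in> wOmega" "b \<in> wOmega - {a}" for a b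
  proof (rule holomorphic_eventually_nonzero[OF _ _ z])
    show "(\<lambda>t. a t - b t) holomorphic_on \<H>"
      using that by (intro holomorphic_intros form_fun_holomorphic form_fun_wOmega) auto
    show "\<not> (\<forall>t. Im t > 0 \<longrightarrow> a t - b t = 0)"
    proof
      assume eq: "\<forall>t. Im t > 0 \<longrightarrow> a t - b t = 0"
      have "a t = b t" for t
        using that eq by (cases "Im t > 0") (auto simp: wOmega_def slash_def)
      thus False
        using that by auto
    qed
  qed
  hence "eventually (\<lambda>t. \<forall>a\<in>wOmega. \<forall>b\<in>wOmega - {a}. a t - b t \<noteq> 0) (at z)"
    using finite_wOmega by (intro eventually_ball_finite ballI) auto
  thus ?thesis
    by eventually_elim (use finite_wOmega in \<open>simp add: wD_def\<close>)
qed

text \<open>The pole at the cusp excludes constancy: for a constant the limit in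
  \<open>wJ_cusp\<close> would be 0 instead of 2.\<close>

lemma wJ_eventually_neq:
  assumes z: "Im z > 0"
  shows "eventually (\<lambda>t. wJ t - c \<noteq> 0) (at z)"
proof (rule holomorphic_eventually_nonzero[OF _ _ z])
  show "(\<lambda>t. wJ t - c) holomorphic_on \<H>"
    by (intro holomorphic_intros wJ_holomorphic)
  show "\<not> (\<forall>t. Im t > 0 \<longrightarrow> wJ t - c = 0)"
  proof
    assume eq: "\<forall>t. Im t > 0 \<longrightarrow> wJ t - c = 0"
    have "((\<lambda>t. (nome t)\<^sup>2 * c) \<longlongrightarrow> 0\<^sup>2 * c) cusp"
      by (intro tendsto_intros nome_tendsto_cusp)
    moreover have "eventually (\<lambda>t. (nome t)\<^sup>2 * c = (nome t)\<^sup>2 * wJ t) cusp"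
      using eventually_cusp_gt[of 0] by eventually_elim (use eq in auto)
    ultimately have "((\<lambda>t. (nome t)\<^sup>2 * wJ t) \<longlongrightarrow> 0\<^sup>2 * c) cusp"
      by (rule Lim_transform_eventually)
    from tendsto_unique[OF cusp_not_bot this wJ_cusp] show False
      by simp
  qed
qed

text \<open>The outcome is \<open>f = P / (wD * g)\<close>, where \<open>g\<close> clears the poles
  of \<open>f\<close> and \<open>P\<close> is the interpolated value of \<open>h * wD\<close> with
  \<open>h = g * f\<close>. Numerator and denominator are polynomials in the coordinates.\<close>

lemma modular_function_is_pullback:
  assumes f: "is_modular_function (\<Gamma>4) f"
  shows "\<exists>F G. (F, G) \<in> form_fractions W2 \<and> pullback F G = f"
proof -
  have f': "f nicely_meromorphic_on \<H>" "f meromorphic_on \<H>" "Gamma4_invariant f"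
    "\<And>t. \<not> Im t > 0 \<Longrightarrow> f t = 0"
    "\<And>A. A \<in> SL2 \<Longrightarrow> meromorphic_at_ioo (\<lambda>t. f (act A t))"
    using f by (auto simp: is_modular_function_def Gamma4_invariant_def nicely_meromorphic_on_def)
  obtain S n where S: "finite S" "S \<subseteq> \<H>"
    "\<And>z. Im z > 0 \<Longrightarrow> \<exists>l. ((\<lambda>w. (\<Prod>s\<in>S. (wJ w - wJ s) ^ n) * f w) \<longlongrightarrow> l) (at z)"
    by (rule modular_function_clear_poles[OF f]) blast
  define g where "g = (\<lambda>w. \<Prod>s\<in>S. (wJ w - wJ s) ^ n)"
  have g_form: "form_fun g"
    unfolding g_def diff_conv_add_uminus by (intro form_fun_prod form_fun_power form_fun_add form_fun_wJ form_fun_const)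
  have g_hol: "g holomorphic_on \<H>"
    by (rule form_fun_holomorphic[OF g_form])
  have g_inv: "g (act A t) = g t" if "A \<in> SL2" "Im t > 0" for A t
    using that by (simp add: g_def wJ_invariant)
  have g_ev: "eventually (\<lambda>t. g t \<noteq> 0) (at z)" if "Im z > 0" for z
  proof -
    have "eventually (\<lambda>t. \<forall>s\<in>S. wJ t - wJ s \<noteq> 0) (at z)"
      using S(1) wJ_eventually_neq[OF that] by (intro eventually_ball_finite) auto
    thus ?thesis
      by eventually_elim (use S(1) in \<open>simp add: g_def\<close>)
  qed
  have gf_mero: "(\<lambda>t. g t * f t) meromorphic_on \<H>"
  proof -
    have "g analytic_on \<H>"
      using g_hol by (simp add: analytic_on_open open_upper_half_plane)
    thus ?thesis
      by (intro meromorphic_on_mult f'(2)) (rule analytic_on_imp_meromorphic_on)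
  qed
  \<comment> \<open>The pointwise product may have wrong values at the former poles of
    \<open>f\<close>; normalisation replaces them by the limits, and \<open>h\<close> becomes
    holomorphic.\<close>
  define h where "h = normalize_mero (\<lambda>t. g t * f t)"
  have h_gen_eq: "gen_eq h (\<lambda>t. g t * f t)"
    unfolding h_def by (rule gen_eq_normalize[OF gf_mero])
  have "remove_sings (\<lambda>t. g t * f t) analytic_on {z}" if z: "Im z > 0" for z
  proof -
    have "(\<lambda>t. g t * f t) meromorphic_on {z}"
      by (rule meromorphic_on_subset[OF gf_mero]) (use z in auto)
    moreover obtain l where "((\<lambda>t. g t * f t) \<longlongrightarrow> l) (at z)"
      using S(3)[OF z] unfolding g_def by blast
    ultimately show ?thesis
      by (intro remove_sings_analytic_at) (auto simp: meromorphic_at_iff)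
  qed
  hence "remove_sings (\<lambda>t. g t * f t) analytic_on \<H>"
    by (subst analytic_on_analytic_at) auto
  hence "remove_sings (\<lambda>t. g t * f t) holomorphic_on \<H>"
    by (rule analytic_imp_holomorphic)
  hence h_hol: "h holomorphic_on \<H>"
    by (rule holomorphic_transform) (simp add: h_def normalize_mero_def)
  have h_inv: "Gamma4_invariant h"
    unfolding Gamma4_invariant_def
  proof (intro ballI allI impI)
    fix G A and t :: complex
    assume G: "G \<in> \<Gamma>4" "A \<in> G" and t: "Im t > 0"
    have "G \<in> weber_kernel 2"
      using G by (simp add: weber_kernel_2)
    hence A: "A \<in> SL2"
      using G(2) by (auto simp: weber_kernel_def carrier_PSL2Z SL2Z_iff)
    have "h (act A t) = normalize_mero (\<lambda>z. g (act A z) * f (act A z)) t"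
      unfolding h_def by (rule normalize_moebius_act[OF A t])
    also have "normalize_mero (\<lambda>z. g (act A z) * f (act A z)) = h"
      unfolding h_def
    proof (intro gen_eq_imp_normalize_eq gen_eqI)
      fix z :: complex assume "Im z > 0"
      thus "g (act A z) * f (act A z) = g z * f z"
        using f'(3) G g_inv[OF A] unfolding Gamma4_invariant_def by simp
    qed
    finally show "h (act A t) = h t" .
  qed
  \<comment> \<open>Since \<open>g\<close> is a polynomial in \<open>wJ\<close>, the growth of a
    conjugate of \<open>h\<close> reduces to that of the conjugate of \<open>f\<close>, which is
    controlled by meromorphy at the corresponding cusp.\<close>
  have h_mod: "moderate (\<lambda>t. h (act A t))" if A: "A \<in> SL2" for A
  proof -
    obtain p where p: "\<And>t. g t = poly p (wJ t)"
      by (rule that[of "\<Prod>s\<in>S. [:- wJ s, 1:] ^ n"]) (simp add: g_def poly_prod)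
    have mJ: "moderate wJ"
      unfolding moderate_def
      using order_tendstoD(2)[OF tendsto_norm[OF wJ_cusp], of 3]
      by (intro exI[of _ 1] exI[of _ 3]) (auto elim: eventually_mono)
    have "moderate (\<lambda>t. poly p (wJ t))"
      by (induction p) (auto intro!: moderate_const moderate_add[OF moderate_const moderate_mult[OF mJ]])
    hence mod: "moderate (\<lambda>t. poly p (wJ t) * f (act A t))"
      by (rule moderate_mult) (rule meromorphic_at_ioo_imp(1)[OF f'(5)[OF A]])
    have "eventually (\<lambda>t. poly p (wJ t) * f (act A t) = h (act A t)) cusp"
      using meromorphic_at_ioo_imp(2)[OF f'(5)[OF A]] eventually_cusp_gt[of 0]
    proof eventually_elim
      case (elim t)
      \<comment> \<open>Close to the cusp the conjugate of \<open>f\<close> is analytic, so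
        normalisation agrees with the plain product there.\<close>
      have "(\<lambda>z. g z * f (act A z)) analytic_on {t}"
        using elim g_hol by (intro analytic_intros) (auto intro: holomorphic_on_imp_analytic_at open_upper_half_plane)
      hence rs: "remove_sings (\<lambda>z. g z * f (act A z)) t = g t * f (act A t)"
        by (rule remove_sings_at_analytic)
      have "h (act A t) = normalize_mero (\<lambda>z. g (act A z) * f (act A z)) t"
        unfolding h_def by (rule normalize_moebius_act[OF A elim(2)])
      also have "normalize_mero (\<lambda>z. g (act A z) * f (act A z)) = normalize_mero (\<lambda>z. g z * f (act A z))"
        by (intro gen_eq_imp_normalize_eq gen_eqI) (simp add: g_inv[OF A])
      also have "normalize_mero (\<lambda>z. g z * f (act A z)) t = g t * f (act A t)"
        using elim(2) rs by (simp add: normalize_mero_def)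
      finally show ?case
        by (simp add: p)
    qed
    thus ?thesis
      using mod by (rule moderate_cong)
  qed
  obtain M :: nat and C :: "nat \<Rightarrow> complex poly" where MC: "\<And>t. Im t > 0 \<Longrightarrow> h t * wD t = (\<Sum>k\<le>M. poly (C k) (wJ t) * wy t ^ k)"
    using lagrange_level_one[OF h_hol h_inv h_mod] by blast
  have "form_fun (\<lambda>t. \<Sum>k\<le>M. poly (C k) (wJ t) * wy t ^ k)"
    by (intro form_fun_sum form_fun_mult form_fun_poly form_fun_power form_fun_wJ form_fun_wy)
  then obtain d F where F: "is_form d F"
    "\<And>t. Im t > 0 \<Longrightarrow> (\<Sum>k\<le>M. poly (C k) (wJ t) * wy t ^ k) = F (wpoint t)"
    unfolding form_fun_def by blast
  have "form_fun (\<lambda>t. wD t * g t)"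
    by (intro form_fun_mult form_fun_wD g_form)
  then obtain e G where G: "is_form e G" "\<And>t. Im t > 0 \<Longrightarrow> wD t * g t = G (wpoint t)"
    unfolding form_fun_def by blast
  \<comment> \<open>Elements of the function field need numerator and denominator of equal degree;
    powers of the last coordinate bring both to \<open>d + e\<close>.\<close>
  define F' G' where "F' = (\<lambda>v. F v * (v $ 4) ^ e)" and "G' = (\<lambda>v. G v * (v $ 4) ^ d)"
  have forms: "is_form (d + e) F'" "is_form (d + e) G'"
    using is_form_mult[OF F(1) is_form_coord_power[of e 4]] is_form_mult[OF G(1) is_form_coord_power[of d 4]]
    by (simp_all add: F'_def G'_def add.commute)
  have co: "F' (wpoint t) = h t * wD t" "G' (wpoint t) = wD t * g t" if "Im t > 0" for t
    using that by (simp_all add: F'_def G'_def MC F(2)[symmetric] G(2)[symmetric])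
  have nz: "eventually (\<lambda>t. wD t * g t \<noteq> 0) (at z)" if "Im z > 0" for z
    using wD_eventually_nonzero[OF that] g_ev[OF that] by eventually_elim simp
  have "\<not> (\<forall>t. Im t > 0 \<longrightarrow> G' (wpoint t) = 0)"
  proof
    assume "\<forall>t. Im t > 0 \<longrightarrow> G' (wpoint t) = 0"
    hence *: "wD t * g t = 0" if "Im t > 0" for t
      using that co by metis
    have "eventually (\<lambda>_. False) (at \<i>)"
      using nz[of \<i>, simplified] eventually_upper[of \<i>, simplified] by eventually_elim (use * in auto)
    thus False
      by simp
  qed
  hence ff: "(F', G') \<in> form_fractions W2"
    using forms by (auto simp: form_fractions_iff)
  have "gen_eq (\<lambda>t. F' (wpoint t) / G' (wpoint t)) f"
    unfolding gen_eq_def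
  proof (intro allI impI)
    fix z :: complex assume z: "Im z > 0"
    have "eventually (\<lambda>t. h t = g t * f t) (at z)"
      using h_gen_eq z by (simp add: gen_eq_def)
    thus "eventually (\<lambda>t. F' (wpoint t) / G' (wpoint t) = f t) (at z)"
      using nz[OF z] eventually_upper[OF z] by eventually_elim (simp add: co)
  qed
  hence "pullback F' G' = normalize_mero f"
    unfolding pullback_def by (rule gen_eq_imp_normalize_eq)
  also have "\<dots> = f"
    by (rule normalize_nicely_meromorphic_id[OF f'(1,4)])
  finally show ?thesis
    using ff by blast
qed

theorem proposition8:
  shows "weber_kernel 2 = principal_congruence_PSL2Z 4
    \<and> weber_curve_is_modular_curve 2 (principal_congruence_PSL2Z 4)"
  using weber_kernel_2 weber_curve_is_modular_curveI[OF modular_function_is_pullback] by blast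

end
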